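(* Let $\mathcal{U}$ be a replete full subcategory of $\mathcal{G}$ which is widely closed, such that the unit $\mathbf{1}\in \mathrm{A}(\mathcal{U})$ is finitely generated, and which is noetherian. Let $X,Y\in \mathrm{A}(\mathcal{U})^{c}$. If $\mathrm{supp}(X)\subseteq \mathrm{supp}(Y)$, then $X\in \mathrm{Serre}_{\otimes}^{+}\langle Y\rangle$.
   Context: Fix a field $k$ of characteristic $0$. $\mathcal{G}$ is the category of finite groups and conjugacy classes of surjective group homomorphisms; $G\twoheadrightarrow H$ denotes a surjective homomorphism. A replete full subcategory $\mathcal{U}\subseteq\mathcal{G}$ is widely closed if whenever $G\twoheadleftarrow H\twoheadrightarrow K$ are surjective homomorphisms with $G,H,K\in\mathcal{U}$, the image of the combined homomorphism $H\to G\times K$ is in $\mathcal{U}$. $\pi_0(\mathcal{U})$ is the set of isomorphism classes of objects of $\mathcal{U}$. $\mathrm{A}(\mathcal{U})$ is the abelian category of functors $\mathcal{U}^{op}\to \mathrm{Mod}\,k$, with pointwise tensor product $(X\otimes Y)(G)=X(G)\otimes_k Y(G)$ and unit $\mathbf{1}$ the constant functor with value $k$. For $G\in\mathcal{U}$, $e_G:=k[\mathrm{Hom}_{\mathcal{U}}(-,G)]$. An object $X$ is finitely generated if there is an epimorphism $\bigoplus_{i=1}^n e_{G_i}\twoheadrightarrow X$ with $n$ finite and $G_i\in\mathcal{U}$. $\mathcal{U}$ is noetherian if every subobject of $e_G$ is finitely generated for each $G\in\mathcal{U}$; $\mathrm{A}(\mathcal{U})^c$ is the full subcategory of finitely generated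 objects, a tensor abelian category (abelian, with symmetric monoidal structure whose tensor product is exact in each variable). The support of $X$ is $\mathrm{supp}(X)=\{[G]\in\pi_0(\mathcal{U})\mid X(G)\neq 0\}$. A Serre subcategory of an abelian category is a nonempty full subcategory $\mathcal{D}$ such that for every short exact sequence $0\to A\to B\to C\to 0$, $B\in\mathcal{D}$ iff $A,C\in\mathcal{D}$. A Serre ideal of a tensor abelian category $\mathcal{A}$ is a Serre subcategory $\mathcal{D}$ with $X\otimes Y\in\mathcal{D}$ for all $X\in\mathcal{D}$, $Y\in\mathcal{A}$. $\mathrm{Serre}_\otimes\langle S\rangle$ is the smallest Serre ideal containing the collection $S$. For $S\subseteq \pi_0(\mathcal{U})$ let $\uparrow(S)=\{[G]\in\pi_0(\mathcal{U})\mid \exists [H]\in S: G\twoheadrightarrow H\}$, and let $\uparrow(S)_{>n}$ consist of those $[G]\in\uparrow(S)$ with $|G|>n$. For $Y\in\mathrm{A}(\mathcal{U})^c$ define, inside $\mathrm{A}(\mathcal{U})^c$, $$\mathrm{Serre}_{\otimes,n}^{+}\langle Y\rangle:=\mathrm{Serre}_{\otimes}\langle \{Y\}\cup\{e_G\mid G\in\uparrow(\mathrm{supp}(Y))_{>n}\}\rangle,\qquad \mathrm{Serre}_{\otimes}^{+}\langle Y\rangle:=\bigcap_{n>0}\mathrm{Serre}_{\otimes,n}^{+}\langle Y\rangle.$$ *)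

theory Defs
  imports "HOL-Algebra.AbelCoset" "Jordan_Normal_Form.Missing_VectorSpace"
begin

text \<open>
  Universes. Groups have their elements in a type \<open>'a\<close>, the field in \<open>'k\<close>, and the vector spaces
  \<open>X(G)\<close> in \<open>'v\<close>; all three types are arbitrary. For infinite \<open>'a\<close> every finite group has a copy with
  elements in \<open>'a\<close>, and "belongs to \<open>U\<close>" is only ever meant up to isomorphism. A field of
  characteristic 0 is infinite, so \<open>k\<^sup>n\<close> is equipotent to \<open>k\<close> for \<open>n > 0\<close>: as soon as \<open>'v\<close> carries a
  nonzero vector space it carries a copy of every finite-dimensional one, hence a copy of every
  finitely generated functor. Objects constructed over another type (\<open>e\<^sub>G\<close>, \<open>X \<otimes> Y\<close>) are compared
  with functors valued in \<open>'v\<close> through isomorphism; this loses nothing, because Serre subcategories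
  are closed under isomorphism.
\<close>

section \<open>Finite groups and conjugacy classes of surjections\<close>

definition finite_groups :: "'a monoid set" where
  "finite_groups = {G. group G \<and> finite (carrier G)}"

text \<open>Representatives are restricted to \<open>carrier G\<close>, so that functions agreeing there are identified.\<close>

definition conj_class :: "'a monoid \<Rightarrow> 'a monoid \<Rightarrow> ('a \<Rightarrow> 'a) \<Rightarrow> ('a \<Rightarrow> 'a) set" where
  "conj_class G H f =
     {\<lambda>x\<in>carrier G. h \<otimes>\<^bsub>H\<^esub> f x \<otimes>\<^bsub>H\<^esub> inv\<^bsub>H\<^esub> h | h. h \<in> carrier H}"

definition Hom :: "'a monoid \<Rightarrow> 'a monoid \<Rightarrow> ('a \<Rightarrow> 'a) set set" where
  "Hom G H = conj_class G H ` epi G H"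

definition id_cls :: "'a monoid \<Rightarrow> ('a \<Rightarrow> 'a) set" where
  "id_cls G = conj_class G G (\<lambda>x. x)"

text \<open>For \<open>\<alpha> \<in> Hom G H\<close> and \<open>\<beta> \<in> Hom H K\<close> the composites of all representatives already make up a
  full conjugacy class, namely \<open>\<beta> \<circ> \<alpha> \<in> Hom G K\<close>.\<close>

definition comp_cls ::
    "'a monoid \<Rightarrow> ('a \<Rightarrow> 'a) set \<Rightarrow> ('a \<Rightarrow> 'a) set \<Rightarrow> ('a \<Rightarrow> 'a) set" where
  "comp_cls G \<beta> \<alpha> = {compose (carrier G) b a | a b. a \<in> \<alpha> \<and> b \<in> \<beta>}"

definition replete_full_subcat :: "'a monoid set \<Rightarrow> bool" where
  "replete_full_subcat U \<longleftrightarrow>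
     U \<subseteq> finite_groups \<and> (\<forall>G\<in>U. \<forall>H\<in>finite_groups. G \<cong> H \<longrightarrow> H \<in> U)"

text \<open>The image lives on the type \<open>'a \<times> 'a\<close>, so membership in the replete \<open>U\<close> is stated through an
  isomorphic copy.\<close>

definition widely_closed :: "'a monoid set \<Rightarrow> bool" where
  "widely_closed U \<longleftrightarrow>
     (\<forall>G\<in>U. \<forall>H\<in>U. \<forall>K\<in>U. \<forall>f\<in>epi H G. \<forall>g\<in>epi H K.
        \<exists>L\<in>U. L \<cong> (G \<times>\<times> K)\<lparr>carrier := (\<lambda>x. (f x, g x)) ` carrier H\<rparr>)"

definition iso_class :: "'a monoid set \<Rightarrow> 'a monoid \<Rightarrow> 'a monoid set" where
  "iso_class U G = {H \<in> U. G \<cong> H}"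

definition pi0 :: "'a monoid set \<Rightarrow> 'a monoid set set" where
  "pi0 U = iso_class U ` U"

definition up :: "'a monoid set \<Rightarrow> 'a monoid set set \<Rightarrow> 'a monoid set set" where
  "up U S = {c \<in> pi0 U. \<exists>G\<in>U. \<exists>H\<in>U. c = iso_class U G \<and> iso_class U H \<in> S \<and> epi G H \<noteq> {}}"

definition up_gt :: "'a monoid set \<Rightarrow> 'a monoid set set \<Rightarrow> nat \<Rightarrow> 'a monoid set set" where
  "up_gt U S n = {c \<in> up U S. \<forall>G\<in>c. order G > n}"


section \<open>Functors to vector spaces\<close>

text \<open>\<open>act X G H \<alpha> : X(H) \<rightarrow> X(G)\<close> is the value of \<open>X\<close> on \<open>\<alpha> \<in> Hom G H\<close>. Only the values of \<open>X\<close> on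
  \<open>U\<close> matter.\<close>

record ('a, 'k, 'v) presheaf =
  obj :: "'a monoid \<Rightarrow> ('k, 'v) module"
  act :: "'a monoid \<Rightarrow> 'a monoid \<Rightarrow> ('a \<Rightarrow> 'a) set \<Rightarrow> 'v \<Rightarrow> 'v"

definition A_of :: "'k ring \<Rightarrow> 'a monoid set \<Rightarrow> ('a, 'k, 'v) presheaf set" where
  "A_of k U = {X.
     (\<forall>G\<in>U. vectorspace k (obj X G)) \<and>
     (\<forall>G\<in>U. \<forall>H\<in>U. \<forall>\<alpha>\<in>Hom G H. act X G H \<alpha> \<in> module_hom k (obj X H) (obj X G)) \<and>
     (\<forall>G\<in>U. \<forall>x\<in>carrier (obj X G). act X G G (id_cls G) x = x) \<and>
     (\<forall>G\<in>U. \<forall>H\<in>U. \<forall>K\<in>U. \<forall>\<alpha>\<in>Hom G H. \<forall>\<beta>\<in>Hom H K. \<forall>x\<in>carrier (obj X K).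
        act X G K (comp_cls G \<beta> \<alpha>) x = act X G H \<alpha> (act X H K \<beta> x))}"

definition nat_trans :: "'k ring \<Rightarrow> 'a monoid set \<Rightarrow> ('a, 'k, 'v) presheaf \<Rightarrow>
    ('a, 'k, 'w) presheaf \<Rightarrow> ('a monoid \<Rightarrow> 'v \<Rightarrow> 'w) set" where
  "nat_trans k U X Y = {\<eta>.
     (\<forall>G\<in>U. \<eta> G \<in> module_hom k (obj X G) (obj Y G)) \<and>
     (\<forall>G\<in>U. \<forall>H\<in>U. \<forall>\<alpha>\<in>Hom G H. \<forall>x\<in>carrier (obj X H).
        \<eta> G (act X G H \<alpha> x) = act Y G H \<alpha> (\<eta> H x))}"

definition psh_iso :: "'k ring \<Rightarrow> 'a monoid set \<Rightarrow> ('a, 'k, 'v) presheaf \<Rightarrow>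
    ('a, 'k, 'w) presheaf \<Rightarrow> bool" where
  "psh_iso k U X Y \<longleftrightarrow>
     (\<exists>\<eta>\<in>nat_trans k U X Y. \<forall>G\<in>U. bij_betw (\<eta> G) (carrier (obj X G)) (carrier (obj Y G)))"

text \<open>Kernels and cokernels in a functor category are computed pointwise; accordingly epimorphisms and
  short exact sequences are the pointwise ones.\<close>

definition psh_epi :: "'k ring \<Rightarrow> 'a monoid set \<Rightarrow> ('a, 'k, 'v) presheaf \<Rightarrow>
    ('a, 'k, 'w) presheaf \<Rightarrow> ('a monoid \<Rightarrow> 'v \<Rightarrow> 'w) set" where
  "psh_epi k U X Y =
     {\<eta> \<in> nat_trans k U X Y. \<forall>G\<in>U. \<eta> G ` carrier (obj X G) = carrier (obj Y G)}"

definition short_exact :: "'k ring \<Rightarrow> 'a monoid set \<Rightarrow> ('a, 'k, 'v) presheaf \<Rightarrow>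
    ('a, 'k, 'v) presheaf \<Rightarrow> ('a, 'k, 'v) presheaf \<Rightarrow> bool" where
  "short_exact k U A B C \<longleftrightarrow>
     (\<exists>f\<in>nat_trans k U A B. \<exists>g\<in>nat_trans k U B C. \<forall>G\<in>U.
        inj_on (f G) (carrier (obj A G)) \<and>
        f G ` carrier (obj A G) = {x \<in> carrier (obj B G). g G x = \<zero>\<^bsub>obj C G\<^esub>} \<and>
        g G ` carrier (obj B G) = carrier (obj C G))"

definition supp :: "'a monoid set \<Rightarrow> ('a, 'k, 'v) presheaf \<Rightarrow> 'a monoid set set" where
  "supp U X = {c \<in> pi0 U. \<exists>G\<in>U. c = iso_class U G \<and> carrier (obj X G) \<noteq> {\<zero>\<^bsub>obj X G\<^esub>}}"

text \<open>The fields \<open>mult\<close> and \<open>one\<close>, which module records inherit from rings, play no role for modules.\<close>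

definition unit_psh :: "'k ring \<Rightarrow> ('a, 'k, 'k) presheaf" where
  "unit_psh k = \<lparr>
     obj = (\<lambda>_. \<lparr>carrier = carrier k, mult = mult k, one = \<one>\<^bsub>k\<^esub>, zero = \<zero>\<^bsub>k\<^esub>, add = add k,
                  smult = mult k\<rparr>),
     act = (\<lambda>_ _ _ x. x)\<rparr>"

text \<open>The free module \<open>k[S]\<close>: finitely supported functions, extended by zero outside \<open>S\<close>.\<close>

definition free_module :: "'k ring \<Rightarrow> 's set \<Rightarrow> ('k, 's \<Rightarrow> 'k) module" where
  "free_module k S = \<lparr>
     carrier = {f. (\<forall>x\<in>S. f x \<in> carrier k) \<and> (\<forall>x. x \<notin> S \<longrightarrow> f x = \<zero>\<^bsub>k\<^esub>) \<and>
                   finite {x. f x \<noteq> \<zero>\<^bsub>k\<^esub>}},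
     mult = undefined, one = undefined,
     zero = (\<lambda>_. \<zero>\<^bsub>k\<^esub>),
     add = (\<lambda>f g x. f x \<oplus>\<^bsub>k\<^esub> g x),
     smult = (\<lambda>c f x. c \<otimes>\<^bsub>k\<^esub> f x)\<rparr>"

definition free_map :: "'k ring \<Rightarrow> ('s \<Rightarrow> 't) \<Rightarrow> ('s \<Rightarrow> 'k) \<Rightarrow> ('t \<Rightarrow> 'k)" where
  "free_map k \<phi> f = (\<lambda>y. \<Oplus>\<^bsub>k\<^esub>x\<in>{x. f x \<noteq> \<zero>\<^bsub>k\<^esub> \<and> \<phi> x = y}. f x)"

definition e_psh :: "'k ring \<Rightarrow> 'a monoid \<Rightarrow> ('a, 'k, ('a \<Rightarrow> 'a) set \<Rightarrow> 'k) presheaf" where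
  "e_psh k G = \<lparr>
     obj = (\<lambda>H. free_module k (Hom H G)),
     act = (\<lambda>K H \<alpha>. free_map k (\<lambda>\<beta>. comp_cls K \<beta> \<alpha>))\<rparr>"

definition dsum_module :: "nat \<Rightarrow> (nat \<Rightarrow> ('k, 'v) module) \<Rightarrow> ('k, nat \<Rightarrow> 'v) module" where
  "dsum_module n M = \<lparr>
     carrier = (\<Pi>\<^sub>E i\<in>{..<n}. carrier (M i)),
     mult = undefined, one = undefined,
     zero = (\<lambda>i\<in>{..<n}. \<zero>\<^bsub>M i\<^esub>),
     add = (\<lambda>x y. \<lambda>i\<in>{..<n}. x i \<oplus>\<^bsub>M i\<^esub> y i),
     smult = (\<lambda>c x. \<lambda>i\<in>{..<n}. c \<odot>\<^bsub>M i\<^esub> x i)\<rparr>"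

definition dsum_psh ::
    "nat \<Rightarrow> (nat \<Rightarrow> ('a, 'k, 'v) presheaf) \<Rightarrow> ('a, 'k, nat \<Rightarrow> 'v) presheaf" where
  "dsum_psh n X = \<lparr>
     obj = (\<lambda>G. dsum_module n (\<lambda>i. obj (X i) G)),
     act = (\<lambda>G H \<alpha> x. \<lambda>i\<in>{..<n}. act (X i) G H \<alpha> (x i))\<rparr>"

definition fin_gen :: "'k ring \<Rightarrow> 'a monoid set \<Rightarrow> ('a, 'k, 'v) presheaf \<Rightarrow> bool" where
  "fin_gen k U X \<longleftrightarrow>
     (\<exists>n G. (\<forall>i<n. G i \<in> U) \<and> psh_epi k U (dsum_psh n (\<lambda>i. e_psh k (G i))) X \<noteq> {})"

definition Ac_of :: "'k ring \<Rightarrow> 'a monoid set \<Rightarrow> ('a, 'k, 'v) presheaf set" where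
  "Ac_of k U = {X \<in> A_of k U. fin_gen k U X}"

text \<open>Subobjects are represented by families \<open>N(G) \<subseteq> X(G)\<close> of subspaces stable under the action.\<close>

definition is_subfunctor :: "'k ring \<Rightarrow> 'a monoid set \<Rightarrow> ('a, 'k, 'v) presheaf \<Rightarrow>
    ('a monoid \<Rightarrow> 'v set) \<Rightarrow> bool" where
  "is_subfunctor k U X N \<longleftrightarrow>
     (\<forall>G\<in>U. submodule k (N G) (obj X G)) \<and>
     (\<forall>G\<in>U. \<forall>H\<in>U. \<forall>\<alpha>\<in>Hom G H. act X G H \<alpha> ` N H \<subseteq> N G)"

definition sub_psh :: "('a, 'k, 'v) presheaf \<Rightarrow> ('a monoid \<Rightarrow> 'v set) \<Rightarrow> ('a, 'k, 'v) presheaf" where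
  "sub_psh X N = X\<lparr>obj := (\<lambda>G. (obj X G)\<lparr>carrier := N G\<rparr>)\<rparr>"

definition noetherian :: "'k ring \<Rightarrow> 'a monoid set \<Rightarrow> bool" where
  "noetherian k U \<longleftrightarrow>
     (\<forall>G\<in>U. \<forall>N. is_subfunctor k U (e_psh k G) N \<longrightarrow> fin_gen k U (sub_psh (e_psh k G) N))"


section \<open>Tensor products\<close>

definition quot_module :: "('k, 'v) module \<Rightarrow> 'v set \<Rightarrow> ('k, 'v set) module" where
  "quot_module M W = \<lparr>
     carrier = a_rcosets\<^bsub>M\<^esub> W,
     mult = undefined, one = undefined,
     zero = W,
     add = set_add M,
     smult = (\<lambda>c C. \<Union>x\<in>C. W +>\<^bsub>M\<^esub> (c \<odot>\<^bsub>M\<^esub> x))\<rparr>"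

definition free_basis :: "'k ring \<Rightarrow> 's \<Rightarrow> ('s \<Rightarrow> 'k)" where
  "free_basis k s = (\<lambda>x. if x = s then \<one>\<^bsub>k\<^esub> else \<zero>\<^bsub>k\<^esub>)"

definition bilinear_rels ::
    "'k ring \<Rightarrow> ('k, 'v) module \<Rightarrow> ('k, 'w) module \<Rightarrow> ('v \<times> 'w \<Rightarrow> 'k) set" where
  "bilinear_rels k M N =
     (let F = free_module k (carrier M \<times> carrier N); \<delta> = free_basis k in
       {\<delta> (m \<oplus>\<^bsub>M\<^esub> m', n) \<ominus>\<^bsub>F\<^esub> (\<delta> (m, n) \<oplus>\<^bsub>F\<^esub> \<delta> (m', n)) | m m' n.
          m \<in> carrier M \<and> m' \<in> carrier M \<and> n \<in> carrier N} \<union>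
       {\<delta> (m, n \<oplus>\<^bsub>N\<^esub> n') \<ominus>\<^bsub>F\<^esub> (\<delta> (m, n) \<oplus>\<^bsub>F\<^esub> \<delta> (m, n')) | m n n'.
          m \<in> carrier M \<and> n \<in> carrier N \<and> n' \<in> carrier N} \<union>
       {\<delta> (c \<odot>\<^bsub>M\<^esub> m, n) \<ominus>\<^bsub>F\<^esub> (c \<odot>\<^bsub>F\<^esub> \<delta> (m, n)) | c m n.
          c \<in> carrier k \<and> m \<in> carrier M \<and> n \<in> carrier N} \<union>
       {\<delta> (m, c \<odot>\<^bsub>N\<^esub> n) \<ominus>\<^bsub>F\<^esub> (c \<odot>\<^bsub>F\<^esub> \<delta> (m, n)) | c m n.
          c \<in> carrier k \<and> m \<in> carrier M \<and> n \<in> carrier N})"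

definition tensor_ker ::
    "'k ring \<Rightarrow> ('k, 'v) module \<Rightarrow> ('k, 'w) module \<Rightarrow> ('v \<times> 'w \<Rightarrow> 'k) set" where
  "tensor_ker k M N =
     module.span k (free_module k (carrier M \<times> carrier N)) (bilinear_rels k M N)"

definition tensor_module ::
    "'k ring \<Rightarrow> ('k, 'v) module \<Rightarrow> ('k, 'w) module \<Rightarrow> ('k, ('v \<times> 'w \<Rightarrow> 'k) set) module" where
  "tensor_module k M N =
     quot_module (free_module k (carrier M \<times> carrier N)) (tensor_ker k M N)"

text \<open>\<open>\<phi> \<otimes> \<psi> : M \<otimes> N \<rightarrow> M' \<otimes> N'\<close>, on cosets; the union is over representatives of one coset, all of
  which yield the same coset of the target.\<close>

definition tensor_map :: "'k ring \<Rightarrow> ('k, 'v) module \<Rightarrow> ('k, 'w) module \<Rightarrow> ('v \<Rightarrow> 'v) \<Rightarrow> ('w \<Rightarrow> 'w) \<Rightarrow>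
    ('v \<times> 'w \<Rightarrow> 'k) set \<Rightarrow> ('v \<times> 'w \<Rightarrow> 'k) set" where
  "tensor_map k M' N' \<phi> \<psi> C =
     (\<Union>f\<in>C. tensor_ker k M' N' +>\<^bsub>free_module k (carrier M' \<times> carrier N')\<^esub>
               free_map k (map_prod \<phi> \<psi>) f)"

definition tensor_psh :: "'k ring \<Rightarrow> ('a, 'k, 'v) presheaf \<Rightarrow> ('a, 'k, 'w) presheaf \<Rightarrow>
    ('a, 'k, ('v \<times> 'w \<Rightarrow> 'k) set) presheaf" where
  "tensor_psh k X Y = \<lparr>
     obj = (\<lambda>G. tensor_module k (obj X G) (obj Y G)),
     act = (\<lambda>G H \<alpha>. tensor_map k (obj X G) (obj Y G) (act X G H \<alpha>) (act Y G H \<alpha>))\<rparr>"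


section \<open>Serre ideals of finitely generated functors\<close>

definition serre_subcat :: "'k ring \<Rightarrow> 'a monoid set \<Rightarrow> ('a, 'k, 'v) presheaf set \<Rightarrow> bool" where
  "serre_subcat k U D \<longleftrightarrow>
     D \<subseteq> Ac_of k U \<and> D \<noteq> {} \<and>
     (\<forall>A\<in>Ac_of k U. \<forall>B\<in>Ac_of k U. \<forall>C\<in>Ac_of k U.
        short_exact k U A B C \<longrightarrow> (B \<in> D \<longleftrightarrow> A \<in> D \<and> C \<in> D))"

definition serre_ideal :: "'k ring \<Rightarrow> 'a monoid set \<Rightarrow> ('a, 'k, 'v) presheaf set \<Rightarrow> bool" where
  "serre_ideal k U (D :: ('a, 'k, 'v) presheaf set) \<longleftrightarrow>
     serre_subcat k U D \<and>
     (\<forall>X\<in>D. \<forall>Y\<in>(Ac_of k U :: ('a, 'k, 'v) presheaf set). \<forall>Z\<in>A_of k U.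
        psh_iso k U Z (tensor_psh k X Y) \<longrightarrow> Z \<in> D)"

definition serre_gen :: "'k ring \<Rightarrow> 'a monoid set \<Rightarrow> ('a, 'k, 'v) presheaf set \<Rightarrow>
    ('a, 'k, 'v) presheaf set" where
  "serre_gen k U S = {X \<in> Ac_of k U. \<forall>D. serre_ideal k U D \<and> S \<subseteq> D \<longrightarrow> X \<in> D}"

definition serre_plus_n :: "'k ring \<Rightarrow> 'a monoid set \<Rightarrow> nat \<Rightarrow> ('a, 'k, 'v) presheaf \<Rightarrow>
    ('a, 'k, 'v) presheaf set" where
  "serre_plus_n k U n Y = serre_gen k U
     ({Y} \<union> {E \<in> A_of k U. \<exists>G\<in>U. iso_class U G \<in> up_gt U (supp U Y) n \<and>
                                 psh_iso k U E (e_psh k G)})"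

definition serre_plus :: "'k ring \<Rightarrow> 'a monoid set \<Rightarrow> ('a, 'k, 'v) presheaf \<Rightarrow>
    ('a, 'k, 'v) presheaf set" where
  "serre_plus k U Y = (\<Inter>n\<in>{0<..}. serre_plus_n k U n Y)"

end

theory Submission
  imports Defs
begin

text \<open>
  Let \<open>D\<close> be a Serre ideal containing \<open>Y\<close> and all \<open>e\<^sub>G\<close> with \<open>G \<in> \<up>(supp Y)\<close>, \<open>|G| > n\<close>. By downward induction on
  \<open>j\<close>, every finitely generated \<open>X\<close> that lives on groups of order greater than \<open>j\<close> in \<open>supp Y\<close> belongs to \<open>D\<close>.
  Filtering by generators reduces this to \<open>X\<close> generated by one \<open>0 \<noteq> x \<in> X(G)\<close>. If \<open>|G| > n\<close>, then \<open>X\<close> is a quotient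
  of \<open>e\<^sub>G \<in> D\<close>. Otherwise the part of \<open>X\<close> on groups larger than \<open>G\<close> is finitely generated and lies in \<open>D\<close> by
  induction, and the quotient by it is a subquotient of \<open>Y \<otimes> e\<^sub>G\<close>: for \<open>0 \<noteq> y \<in> Y(G)\<close> the map \<open>e\<^sub>G \<rightarrow> Y \<otimes> e\<^sub>G\<close>,
  \<open>id \<mapsto> y \<otimes> id\<close>, is injective on groups not larger than \<open>G\<close>. Characteristic 0 only enters through the
  infinity of the field, which provides copies of \<open>e\<^sub>G\<close> and \<open>Y \<otimes> e\<^sub>G\<close> in the value type.
\<close>

section \<open>The category of finite groups\<close>

text \<open>Why large representables have to be thrown in: a nonzero \<open>y\<close> over
  \<open>G\<close> may pull back to zero along a surjection from a larger group, so tensoring with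
  \<open>Y\<close> controls a functor generated over \<open>G\<close> only up to the order of
  \<open>G\<close>. Cutting off the larger groups pushes the defect to strictly larger orders, and
  after finitely many rounds the order exceeds \<open>n\<close>, where the representables in
  \<open>D\<close> take over. The piece that is cut off is finitely generated by noetherianity,
  without which the Serre condition would say nothing about it.

  The obstacle to writing this down is that the members of \<open>D\<close> take their values in the
  one type \<open>'v\<close>, whereas representables, tensor products and cosets live in other
  types. Every object that must be a member is therefore realised in \<open>'v\<close>: a subobject
  as a family of subspaces, a quotient through a map that separates the cosets and takes its labels
  in \<open>'v\<close>. Objects over other types occur as sources and targets of maps;
  \<open>serre_subquotient\<close> is the bridge back to \<open>D\<close>.\<close>

lemma conj_class_cong:
  assumes "\<And>x. x \<in> carrier G \<Longrightarrow> f x = g x"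
  shows "conj_class G H f = conj_class G H g"
proof -
  have "(\<lambda>x\<in>carrier G. h \<otimes>\<^bsub>H\<^esub> f x \<otimes>\<^bsub>H\<^esub> inv\<^bsub>H\<^esub> h) = (\<lambda>x\<in>carrier G. h \<otimes>\<^bsub>H\<^esub> g x \<otimes>\<^bsub>H\<^esub> inv\<^bsub>H\<^esub> h)" for h
    using assms by (auto simp: fun_eq_iff)
  then show ?thesis by (simp add: conj_class_def)
qed

text \<open>Conjugation can be moved past \<open>g\<close>: conjugating by \<open>h\<close>,
  applying \<open>g\<close> and conjugating by \<open>l\<close> is the same as applying
  \<open>g\<close> and conjugating by \<open>l\<close> times \<open>g h\<close>. With
  \<open>h\<close> trivial every conjugate is reached, so composing all representatives gives
  exactly one full class.\<close>

lemma comp_cls_conj_class: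
  assumes G: "group G" and H: "group H" and K: "group K"
    and f: "f \<in> hom G H" and g: "g \<in> hom H K"
  shows "comp_cls G (conj_class H K g) (conj_class G H f) = conj_class G K (g \<circ> f)"
proof -
  interpret H: group H by fact
  interpret K: group K by fact
  interpret gh: group_hom H K g using g by unfold_locales (auto simp: hom_def)
  have fc: "f x \<in> carrier H" if "x \<in> carrier G" for x
    using f that by (auto simp: hom_def)
  have *: "compose (carrier G) (\<lambda>y\<in>carrier H. l \<otimes>\<^bsub>K\<^esub> g y \<otimes>\<^bsub>K\<^esub> inv\<^bsub>K\<^esub> l)
         (\<lambda>x\<in>carrier G. h \<otimes>\<^bsub>H\<^esub> f x \<otimes>\<^bsub>H\<^esub> inv\<^bsub>H\<^esub> h) =
       (\<lambda>x\<in>carrier G. (l \<otimes>\<^bsub>K\<^esub> g h) \<otimes>\<^bsub>K\<^esub> (g \<circ> f) x \<otimes>\<^bsub>K\<^esub> inv\<^bsub>K\<^esub> (l \<otimes>\<^bsub>K\<^esub> g h))"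
    if "h \<in> carrier H" "l \<in> carrier K" for h l
    using that fc by (auto simp: compose_def fun_eq_iff K.inv_mult_group K.m_assoc)
  show ?thesis
  proof (intro equalityI subsetI)
    fix c assume "c \<in> comp_cls G (conj_class H K g) (conj_class G H f)"
    then obtain h l where "h \<in> carrier H" "l \<in> carrier K" and
      c: "c = compose (carrier G) (\<lambda>y\<in>carrier H. l \<otimes>\<^bsub>K\<^esub> g y \<otimes>\<^bsub>K\<^esub> inv\<^bsub>K\<^esub> l)
         (\<lambda>x\<in>carrier G. h \<otimes>\<^bsub>H\<^esub> f x \<otimes>\<^bsub>H\<^esub> inv\<^bsub>H\<^esub> h)"
      unfolding comp_cls_def conj_class_def by blast
    then have "c = (\<lambda>x\<in>carrier G. (l \<otimes>\<^bsub>K\<^esub> g h) \<otimes>\<^bsub>K\<^esub> (g \<circ> f) x \<otimes>\<^bsub>K\<^esub> inv\<^bsub>K\<^esub> (l \<otimes>\<^bsub>K\<^esub> g h))"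
      using * by simp
    moreover have "l \<otimes>\<^bsub>K\<^esub> g h \<in> carrier K"
      using \<open>h \<in> carrier H\<close> \<open>l \<in> carrier K\<close> by simp
    ultimately show "c \<in> conj_class G K (g \<circ> f)"
      unfolding conj_class_def by blast
  next
    fix c assume "c \<in> conj_class G K (g \<circ> f)"
    then obtain l where l: "l \<in> carrier K" and
      c: "c = (\<lambda>x\<in>carrier G. l \<otimes>\<^bsub>K\<^esub> (g \<circ> f) x \<otimes>\<^bsub>K\<^esub> inv\<^bsub>K\<^esub> l)"
      unfolding conj_class_def by blast
    have "c = compose (carrier G) (\<lambda>y\<in>carrier H. l \<otimes>\<^bsub>K\<^esub> g y \<otimes>\<^bsub>K\<^esub> inv\<^bsub>K\<^esub> l)
         (\<lambda>x\<in>carrier G. \<one>\<^bsub>H\<^esub> \<otimes>\<^bsub>H\<^esub> f x \<otimes>\<^bsub>H\<^esub> inv\<^bsub>H\<^esub> \<one>\<^bsub>H\<^esub>)"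
      using *[of "\<one>\<^bsub>H\<^esub>" l] c l by simp
    then show "c \<in> comp_cls G (conj_class H K g) (conj_class G H f)"
      unfolding comp_cls_def conj_class_def using l H.one_closed by blast
  qed
qed

lemma epi_hom: "f \<in> epi G H \<Longrightarrow> f \<in> hom G H"
  by (simp add: epi_def)

lemma Hom_cases:
  assumes "\<alpha> \<in> Hom G H"
  obtains f where "f \<in> epi G H" "\<alpha> = conj_class G H f"
  using assms by (auto simp: Hom_def)

lemma comp_cls_Hom:
  assumes "group G" "group H" "group K" "\<alpha> \<in> Hom G H" "\<beta> \<in> Hom H K"
  shows "comp_cls G \<beta> \<alpha> \<in> Hom G K"
proof -
  obtain f g where fg: "f \<in> epi G H" "\<alpha> = conj_class G H f" "g \<in> epi H K" "\<beta> = conj_class H K g"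
    using assms by (auto elim!: Hom_cases)
  then have "comp_cls G \<beta> \<alpha> = conj_class G K (g \<circ> f)"
    using comp_cls_conj_class assms epi_hom by metis
  then show ?thesis
    using epi_compose[OF fg(1,3)] by (auto simp: Hom_def)
qed

lemma comp_cls_assoc:
  assumes "group G" "group H" "group K" "group L"
    and "\<alpha> \<in> Hom G H" "\<beta> \<in> Hom H K" "\<gamma> \<in> Hom K L"
  shows "comp_cls G (comp_cls H \<gamma> \<beta>) \<alpha> = comp_cls G \<gamma> (comp_cls G \<beta> \<alpha>)"
proof -
  obtain f g h where fgh: "f \<in> epi G H" "\<alpha> = conj_class G H f" "g \<in> epi H K" "\<beta> = conj_class H K g"
    "h \<in> epi K L" "\<gamma> = conj_class K L h"
    using assms by (auto elim!: Hom_cases)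
  note homs = epi_hom[OF fgh(1)] epi_hom[OF fgh(3)] epi_hom[OF fgh(5)]
  have "g \<circ> f \<in> hom G K" "h \<circ> g \<in> hom H L"
    using epi_compose[OF fgh(1,3)] epi_compose[OF fgh(3,5)] epi_hom by auto
  then show ?thesis
    by (simp add: fgh comp_cls_conj_class assms homs comp_assoc)
qed

lemma id_cls_Hom: "id_cls G \<in> Hom G G"
  unfolding id_cls_def Hom_def by (auto intro!: imageI simp: epi_def hom_def)

lemma comp_id_cls:
  assumes "group G" "group H" "\<alpha> \<in> Hom G H"
  shows "comp_cls G \<alpha> (id_cls G) = \<alpha>" "comp_cls G (id_cls H) \<alpha> = \<alpha>"
proof -
  obtain f where f: "f \<in> epi G H" "\<alpha> = conj_class G H f"
    using assms by (auto elim!: Hom_cases)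
  have "(\<lambda>x. x) \<in> hom G G" "(\<lambda>x. x) \<in> hom H H" by (auto simp: hom_def)
  then show "comp_cls G \<alpha> (id_cls G) = \<alpha>" "comp_cls G (id_cls H) \<alpha> = \<alpha>"
    unfolding id_cls_def f(2)
    by (simp_all add: comp_cls_conj_class assms epi_hom[OF f(1)] comp_def)
qed

lemma Hom_order_le:
  assumes "finite (carrier G)" "\<alpha> \<in> Hom G H"
  shows "order H \<le> order G"
proof -
  obtain f where "f \<in> epi G H" using assms by (auto elim!: Hom_cases)
  then have "carrier H = f ` carrier G" by (simp add: epi_def)
  then show ?thesis using assms card_image_le by (simp add: order_def)
qed

text \<open>A surjection from a finite group onto a group that is not smaller is a bijection, hence
  an isomorphism, and the class of its inverse is the inverse morphism.\<close>

lemma Hom_inverse: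
  assumes G: "group G" "finite (carrier G)" and H: "group H" and \<alpha>: "\<alpha> \<in> Hom G H" and o: "order G \<le> order H"
  shows "\<exists>\<beta>\<in>Hom H G. comp_cls G \<beta> \<alpha> = id_cls G \<and> comp_cls H \<alpha> \<beta> = id_cls H"
proof -
  obtain f where f: "f \<in> epi G H" "\<alpha> = conj_class G H f"
    using \<alpha> by (auto elim!: Hom_cases)
  have im: "f ` carrier G = carrier H" using f by (simp add: epi_def)
  have "order H \<le> order G" using Hom_order_le G \<alpha> by blast
  with o have "card (f ` carrier G) = card (carrier G)"
    by (simp add: im order_def)
  then have inj: "inj_on f (carrier G)" using G by (simp add: eq_card_imp_inj_on)
  then have iso: "f \<in> iso G H" using f im by (simp add: iso_def bij_betw_def epi_def)
  define g where "g = inv_into (carrier G) f"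
  have g: "g \<in> iso H G" unfolding g_def using group.iso_set_sym[OF G(1) iso] .
  then have ge: "g \<in> epi H G" by (auto simp: iso_def epi_def bij_betw_def)
  have "comp_cls G (conj_class H G g) \<alpha> = conj_class G G (g \<circ> f)"
    unfolding f(2) using comp_cls_conj_class G H epi_hom f(1) ge by blast
  also have "\<dots> = id_cls G"
    unfolding id_cls_def by (rule conj_class_cong) (simp add: g_def inj)
  finally have 1: "comp_cls G (conj_class H G g) \<alpha> = id_cls G" .
  have "comp_cls H \<alpha> (conj_class H G g) = conj_class H H (f \<circ> g)"
    unfolding f(2) using comp_cls_conj_class G H epi_hom f(1) ge by blast
  also have "\<dots> = id_cls H"
    unfolding id_cls_def by (rule conj_class_cong) (simp add: g_def im f_inv_into_f)
  finally show ?thesis using 1 ge by (auto simp: Hom_def)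
qed

text \<open>A class is a set of functions from one finite function space. The use is that the values
  of \<open>e_psh\<close> are finite-dimensional.\<close>

lemma finite_Hom:
  assumes "finite (carrier G)" "finite (carrier H)" "group H"
  shows "finite (Hom G H)"
proof -
  interpret H: group H by fact
  have "Hom G H \<subseteq> Pow (carrier G \<rightarrow>\<^sub>E carrier H)"
    unfolding Hom_def conj_class_def epi_def hom_def by (auto simp: Pi_iff)
  moreover have "finite (Pow (carrier G \<rightarrow>\<^sub>E carrier H))"
    using assms by (simp add: finite_PiE)
  ultimately show ?thesis by (rule finite_subset)
qed

lemma is_iso_Hom: "G \<cong> H \<Longrightarrow> \<exists>\<alpha>. \<alpha> \<in> Hom G H"
  unfolding is_iso_def Hom_def by (auto simp: iso_def epi_def bij_betw_def)

lemma is_iso_order: "G \<cong> H \<Longrightarrow> order G = order H"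
  unfolding is_iso_def order_def iso_def using bij_betw_same_card by auto

section \<open>Modules and quotients\<close>

lemma module_hom_zero:
  assumes "module k M" "module k N" "f \<in> module_hom k M N"
  shows "f \<zero>\<^bsub>M\<^esub> = \<zero>\<^bsub>N\<^esub>"
proof -
  interpret mod_hom k M N f using assms by (simp add: mod_hom_def mod_hom_axioms_def)
  show ?thesis by simp
qed

lemma module_hom_minus:
  assumes "module k M" "module k N" "f \<in> module_hom k M N" "x \<in> carrier M" "y \<in> carrier M"
  shows "f (x \<ominus>\<^bsub>M\<^esub> y) = f x \<ominus>\<^bsub>N\<^esub> f y"
proof -
  interpret mod_hom k M N f using assms by (simp add: mod_hom_def mod_hom_axioms_def)
  show ?thesis using assms by simp
qed

lemma module_hom_mem: "f \<in> module_hom k M N \<Longrightarrow> x \<in> carrier M \<Longrightarrow> f x \<in> carrier N"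
  using module_hom_closed by blast

lemma module_homI:
  assumes "\<And>x. x \<in> carrier M \<Longrightarrow> f x \<in> carrier N"
    and "\<And>x y. x \<in> carrier M \<Longrightarrow> y \<in> carrier M \<Longrightarrow> f (x \<oplus>\<^bsub>M\<^esub> y) = f x \<oplus>\<^bsub>N\<^esub> f y"
    and "\<And>c x. c \<in> carrier k \<Longrightarrow> x \<in> carrier M \<Longrightarrow> f (c \<odot>\<^bsub>M\<^esub> x) = c \<odot>\<^bsub>N\<^esub> f x"
  shows "f \<in> module_hom k M N"
  using assms by (auto simp: module_hom_def)

lemma module_hom_compose:
  assumes "f \<in> module_hom k L M" "g \<in> module_hom k M N"
  shows "(\<lambda>x. g (f x)) \<in> module_hom k L N"
  using assms by (auto simp: module_hom_def Pi_iff)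

lemma module_hom_cong:
  assumes "module k M" "f \<in> module_hom k M N" "\<And>x. x \<in> carrier M \<Longrightarrow> f x = g x"
  shows "g \<in> module_hom k M N"
proof -
  interpret module k M by fact
  show ?thesis
  proof (rule module_homI)
    show "g x \<in> carrier N" if "x \<in> carrier M" for x
      using module_hom_mem[OF assms(2) that] assms(3)[OF that] by simp
    show "g (x \<oplus>\<^bsub>M\<^esub> y) = g x \<oplus>\<^bsub>N\<^esub> g y" if "x \<in> carrier M" "y \<in> carrier M" for x y
      using module_hom_add[OF assms(2) that] assms(3) that by (metis M.a_closed)
    show "g (c \<odot>\<^bsub>M\<^esub> x) = c \<odot>\<^bsub>N\<^esub> g x" if "c \<in> carrier k" "x \<in> carrier M" for c x
      using module_hom_smult[OF assms(2) that] assms(3) that by (metis smult_closed)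
  qed
qed

lemma module_hom_finsum:
  assumes "module k M" "module k N" "f \<in> module_hom k M N" "finite A" "g \<in> A \<rightarrow> carrier M"
  shows "f (\<Oplus>\<^bsub>M\<^esub>a\<in>A. g a) = (\<Oplus>\<^bsub>N\<^esub>a\<in>A. f (g a))"
  using assms(4,5)
proof induction
  interpret M: module k M by fact
  interpret N: module k N by fact
  case empty
  then show ?case using module_hom_zero[OF assms(1-3)] by simp
next
  interpret M: module k M by fact
  interpret N: module k N by fact
  case (insert a A)
  have "g a \<in> carrier M" "g \<in> A \<rightarrow> carrier M" "(\<lambda>a. f (g a)) \<in> A \<rightarrow> carrier N" "f (g a) \<in> carrier N"
    using insert module_hom_mem[OF assms(3)] by auto
  then show ?case
    using insert module_hom_add[OF assms(3)] by simp
qed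

lemma submodule_minus:
  assumes "submodule k N M" "x \<in> N" "y \<in> N"
  shows "x \<ominus>\<^bsub>M\<^esub> y \<in> N"
proof -
  interpret submodule k N M by fact
  interpret M: module k M by (rule module)
  have "y \<in> carrier M" using assms subset by auto
  then have "\<ominus>\<^bsub>M\<^esub> y = (\<ominus>\<^bsub>k\<^esub> \<one>\<^bsub>k\<^esub>) \<odot>\<^bsub>M\<^esub> y" by (simp only: M.smult_minus_1)
  then have "\<ominus>\<^bsub>M\<^esub> y \<in> N" using smult_closed[of "\<ominus>\<^bsub>k\<^esub> \<one>\<^bsub>k\<^esub>" y] assms(3) by simp
  then show ?thesis unfolding a_minus_def using assms by simp
qed

lemma submodule_vimage:
  assumes "module k M" "f \<in> module_hom k M M'" "submodule k N M'"
  shows "submodule k {x \<in> carrier M. f x \<in> N} M"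
proof -
  interpret N: submodule k N M' by fact
  interpret M: module k M by fact
  have "f \<zero>\<^bsub>M\<^esub> = \<zero>\<^bsub>M'\<^esub>" using module_hom_zero[OF assms(1) N.module assms(2)] .
  then show ?thesis
    by (intro submodule.intro)
       (auto simp: assms(1) module_hom_add[OF assms(2)] module_hom_smult[OF assms(2)])
qed

lemma submodule_image:
  assumes "module k M'" "f \<in> module_hom k M M'" "submodule k N M"
  shows "submodule k (f ` N) M'"
proof -
  interpret N: submodule k N M by fact
  interpret M: module k M by (rule N.module)
  have 0: "f \<zero>\<^bsub>M\<^esub> = \<zero>\<^bsub>M'\<^esub>" using module_hom_zero[OF N.module assms(1,2)] .
  have sub: "x \<in> carrier M" if "x \<in> N" for x using that N.subset by auto
  show ?thesis
  proof (intro submodule.intro)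
    show "f ` N \<subseteq> carrier M'" using module_hom_mem[OF assms(2)] sub by auto
    show "v \<oplus>\<^bsub>M'\<^esub> w \<in> f ` N" if vw: "v \<in> f ` N" "w \<in> f ` N" for v w
    proof -
      obtain x y where "x \<in> N" "y \<in> N" "v = f x" "w = f y" using vw by auto
      then show ?thesis using module_hom_add[OF assms(2) sub sub, of x y] N.m_closed[of x y] by (metis imageI)
    qed
    show "\<zero>\<^bsub>M'\<^esub> \<in> f ` N" using 0 N.zero_closed by (metis imageI)
    show "c \<odot>\<^bsub>M'\<^esub> v \<in> f ` N" if cv: "c \<in> carrier k" "v \<in> f ` N" for c v
    proof -
      obtain x where "x \<in> N" "v = f x" using cv by auto
      then show ?thesis using cv module_hom_smult[OF assms(2) _ sub, of c x] N.smult_closed[of c x] by (metis imageI)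
    qed
  qed fact
qed

lemma submodule_carrier: "module k M \<Longrightarrow> submodule k (carrier M) M"
  by (intro submodule.intro) (auto simp: module.smult_closed abelian_monoid.a_closed abelian_group.axioms module.axioms(2) abelian_monoid.zero_closed)

lemma submodule_zero:
  assumes "module k M" shows "submodule k {\<zero>\<^bsub>M\<^esub>} M"
proof -
  interpret module k M by fact
  show ?thesis by (intro submodule.intro) (auto simp: assms)
qed

lemma submodule_Inter:
  assumes "module k M" "\<And>N. N \<in> \<N> \<Longrightarrow> submodule k N M" "\<N> \<noteq> {}"
  shows "submodule k (\<Inter>\<N>) M"
  using assms(2,3) by (intro submodule.intro[OF assms(1)]) (fastforce simp: submodule_def)+

lemma submodule_Int:
  assumes "submodule k N M" "submodule k N' M"
  shows "submodule k (N \<inter> N') M"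
  using assms by (auto simp: submodule_def)

lemma submodule_plus:
  assumes "submodule k N M" "submodule k N' M"
  shows "submodule k {x \<oplus>\<^bsub>M\<^esub> y | x y. x \<in> N \<and> y \<in> N'} M"
proof -
  let ?N = "{x \<oplus>\<^bsub>M\<^esub> y | x y. x \<in> N \<and> y \<in> N'}"
  interpret N: submodule k N M by fact
  interpret N': submodule k N' M by fact
  interpret M: module k M by (rule N.module)
  note sub = subsetD[OF N.subset] subsetD[OF N'.subset]
  show ?thesis
  proof (intro submodule.intro)
    show "module k M" by (rule N.module)
    show "?N \<subseteq> carrier M" using sub by auto
    show "\<zero>\<^bsub>M\<^esub> \<in> ?N"
      by (intro CollectI exI[of _ "\<zero>\<^bsub>M\<^esub>"]) simp
    show "v \<oplus>\<^bsub>M\<^esub> w \<in> ?N"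
      if vw: "v \<in> ?N" "w \<in> ?N" for v w
    proof -
      obtain x y x' y' where xy: "x \<in> N" "y \<in> N'" "x' \<in> N" "y' \<in> N'" "v = x \<oplus>\<^bsub>M\<^esub> y" "w = x' \<oplus>\<^bsub>M\<^esub> y'"
        using vw by auto
      have "v \<oplus>\<^bsub>M\<^esub> w = (x \<oplus>\<^bsub>M\<^esub> x') \<oplus>\<^bsub>M\<^esub> (y \<oplus>\<^bsub>M\<^esub> y')"
        using xy sub by (simp add: M.M.a_ac)
      then show ?thesis using xy by blast
    qed
    show "c \<odot>\<^bsub>M\<^esub> v \<in> ?N"
      if cv: "c \<in> carrier k" "v \<in> ?N" for c v
    proof -
      obtain x y where xy: "x \<in> N" "y \<in> N'" "v = x \<oplus>\<^bsub>M\<^esub> y" using cv by auto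
      have "c \<odot>\<^bsub>M\<^esub> v = c \<odot>\<^bsub>M\<^esub> x \<oplus>\<^bsub>M\<^esub> c \<odot>\<^bsub>M\<^esub> y"
        using xy sub cv by (simp add: M.smult_r_distr)
      then show ?thesis using xy cv by blast
    qed
  qed
qed

lemma module_minus_eq_zero_iff:
  assumes "module k M" "x \<in> carrier M" "y \<in> carrier M"
  shows "x \<ominus>\<^bsub>M\<^esub> y = \<zero>\<^bsub>M\<^esub> \<longleftrightarrow> x = y"
proof -
  interpret module k M by fact
  show ?thesis using assms(2,3) M.minus_equality[of x "\<ominus>\<^bsub>M\<^esub> y"]
    by (auto simp: a_minus_def M.r_neg)
qed

text \<open>The operations are well defined only if the fibres of \<open>r\<close> are the cosets of a submodule.\<close>

definition push_module :: "('k, 'w) module \<Rightarrow> ('w \<Rightarrow> 'v) \<Rightarrow> ('k, 'v) module" where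
  "push_module M r =
     (let s = inv_into (carrier M) r in
      \<lparr>carrier = r ` carrier M, mult = undefined, one = undefined, zero = r \<zero>\<^bsub>M\<^esub>,
       add = (\<lambda>a b. r (s a \<oplus>\<^bsub>M\<^esub> s b)), smult = (\<lambda>c a. r (c \<odot>\<^bsub>M\<^esub> s a))\<rparr>)"

lemma carrier_push_module [simp]: "carrier (push_module M r) = r ` carrier M"
  and zero_push_module [simp]: "\<zero>\<^bsub>push_module M r\<^esub> = r \<zero>\<^bsub>M\<^esub>"
  by (simp_all add: push_module_def Let_def)

context
  fixes k :: "'k ring" and M :: "('k, 'w) module" and K :: "'w set" and r :: "'w \<Rightarrow> 'v"
  assumes K: "submodule k K M"
    and r: "\<And>x y. x \<in> carrier M \<Longrightarrow> y \<in> carrier M \<Longrightarrow> r x = r y \<longleftrightarrow> x \<ominus>\<^bsub>M\<^esub> y \<in> K"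
begin

interpretation K: submodule k K M by (rule K)
interpretation M: module k M by (rule K.module)

text \<open>The operation is computed on preimages \<open>x'\<close>, \<open>y'\<close> chosen by
  \<open>inv_into\<close>. They differ from \<open>x\<close>, \<open>y\<close> by elements of
  \<open>K\<close>, hence so do the sums.\<close>

lemma push_module_add:
  assumes "x \<in> carrier M" "y \<in> carrier M"
  shows "r x \<oplus>\<^bsub>push_module M r\<^esub> r y = r (x \<oplus>\<^bsub>M\<^esub> y)"
proof -
  define x' where "x' = inv_into (carrier M) r (r x)"
  define y' where "y' = inv_into (carrier M) r (r y)"
  have x': "x' \<in> carrier M" "r x' = r x" "y' \<in> carrier M" "r y' = r y"
    unfolding x'_def y'_def using assms by (auto simp: inv_into_into f_inv_into_f)
  then have "x' \<ominus>\<^bsub>M\<^esub> x \<in> K" "y' \<ominus>\<^bsub>M\<^esub> y \<in> K" using r assms by auto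
  then have "(x' \<ominus>\<^bsub>M\<^esub> x) \<oplus>\<^bsub>M\<^esub> (y' \<ominus>\<^bsub>M\<^esub> y) \<in> K" by simp
  moreover have "(x' \<ominus>\<^bsub>M\<^esub> x) \<oplus>\<^bsub>M\<^esub> (y' \<ominus>\<^bsub>M\<^esub> y) = (x' \<oplus>\<^bsub>M\<^esub> y') \<ominus>\<^bsub>M\<^esub> (x \<oplus>\<^bsub>M\<^esub> y)"
    using x' assms by (simp add: a_minus_def M.M.a_ac M.M.minus_add)
  ultimately have "r (x' \<oplus>\<^bsub>M\<^esub> y') = r (x \<oplus>\<^bsub>M\<^esub> y)"
    using r x' assms by simp
  then show ?thesis by (simp add: push_module_def Let_def flip: x'_def y'_def)
qed

lemma push_module_smult:
  assumes "c \<in> carrier k" "x \<in> carrier M"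
  shows "c \<odot>\<^bsub>push_module M r\<^esub> r x = r (c \<odot>\<^bsub>M\<^esub> x)"
proof -
  define x' where "x' = inv_into (carrier M) r (r x)"
  have x': "x' \<in> carrier M" "r x' = r x"
    unfolding x'_def using assms by (auto simp: inv_into_into f_inv_into_f)
  then have "x' \<ominus>\<^bsub>M\<^esub> x \<in> K" using r assms by auto
  then have "c \<odot>\<^bsub>M\<^esub> (x' \<ominus>\<^bsub>M\<^esub> x) \<in> K" using assms by simp
  moreover have "c \<odot>\<^bsub>M\<^esub> (x' \<ominus>\<^bsub>M\<^esub> x) = c \<odot>\<^bsub>M\<^esub> x' \<ominus>\<^bsub>M\<^esub> c \<odot>\<^bsub>M\<^esub> x"
    using x' assms by (simp add: a_minus_def M.smult_r_distr M.smult_r_minus)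
  ultimately have "r (c \<odot>\<^bsub>M\<^esub> x') = r (c \<odot>\<^bsub>M\<^esub> x)"
    using r x' assms by simp
  then show ?thesis by (simp add: push_module_def Let_def flip: x'_def)
qed

lemma push_module_module: "module k (push_module M r)"
proof -
  let ?M = "push_module M r"
  note [simp] = push_module_add push_module_smult
  show ?thesis
  proof (rule module_criteria)
    show "\<forall>v\<in>carrier ?M. \<exists>neg_v\<in>carrier ?M. v \<oplus>\<^bsub>?M\<^esub> neg_v = \<zero>\<^bsub>?M\<^esub>"
    proof
      fix v assume "v \<in> carrier ?M"
      then obtain x where x: "x \<in> carrier M" "v = r x" by auto
      then have "v \<oplus>\<^bsub>?M\<^esub> r (\<ominus>\<^bsub>M\<^esub> x) = \<zero>\<^bsub>?M\<^esub>"
        by (simp add: M.M.r_neg)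
      then show "\<exists>neg_v\<in>carrier ?M. v \<oplus>\<^bsub>?M\<^esub> neg_v = \<zero>\<^bsub>?M\<^esub>"
        using x by (intro bexI[of _ "r (\<ominus>\<^bsub>M\<^esub> x)"]) auto
    qed
  qed (auto simp: M.R.is_cring M.M.a_ac M.smult_assoc1 M.smult_l_distr M.smult_r_distr)
qed

lemma push_module_hom: "r \<in> module_hom k M (push_module M r)"
  by (rule module_homI) (auto simp: push_module_add push_module_smult)

lemma push_module_ker:
  assumes "x \<in> carrier M"
  shows "r x = \<zero>\<^bsub>push_module M r\<^esub> \<longleftrightarrow> x \<in> K"
proof -
  have "\<ominus>\<^bsub>M\<^esub> \<zero>\<^bsub>M\<^esub> = \<zero>\<^bsub>M\<^esub>" using M.M.minus_equality[of "\<zero>\<^bsub>M\<^esub>" "\<zero>\<^bsub>M\<^esub>"] by simp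
  with r[OF assms M.M.zero_closed] assms show ?thesis by (simp only: a_minus_def zero_push_module M.M.r_zero)
qed

end

section \<open>Free modules\<close>

lemma free_module_simps [simp]:
  "\<zero>\<^bsub>free_module k S\<^esub> = (\<lambda>_. \<zero>\<^bsub>k\<^esub>)"
  "f \<oplus>\<^bsub>free_module k S\<^esub> g = (\<lambda>x. f x \<oplus>\<^bsub>k\<^esub> g x)"
  "c \<odot>\<^bsub>free_module k S\<^esub> f = (\<lambda>x. c \<otimes>\<^bsub>k\<^esub> f x)"
  by (simp_all add: free_module_def)

lemma free_moduleI:
  assumes "\<And>x. x \<in> S \<Longrightarrow> f x \<in> carrier k" "\<And>x. x \<notin> S \<Longrightarrow> f x = \<zero>\<^bsub>k\<^esub>" "finite {x. f x \<noteq> \<zero>\<^bsub>k\<^esub>}"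
  shows "f \<in> carrier (free_module k S)"
  using assms by (simp add: free_module_def)

lemma free_moduleD:
  assumes "f \<in> carrier (free_module k S)"
  shows "x \<in> S \<Longrightarrow> f x \<in> carrier k" "x \<notin> S \<Longrightarrow> f x = \<zero>\<^bsub>k\<^esub>" "finite {x. f x \<noteq> \<zero>\<^bsub>k\<^esub>}"
  using assms by (simp_all add: free_module_def)

lemma free_module_value:
  assumes "cring k" "f \<in> carrier (free_module k S)"
  shows "f x \<in> carrier k"
proof -
  interpret cring k by fact
  show ?thesis using free_moduleD(1,2)[OF assms(2)] by (cases "x \<in> S") auto
qed

lemma free_module_supp: "f \<in> carrier (free_module k S) \<Longrightarrow> {x. f x \<noteq> \<zero>\<^bsub>k\<^esub>} \<subseteq> S"
  by (metis (mono_tags, lifting) free_moduleD(2) mem_Collect_eq subsetI)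

lemma free_module_module:
  assumes "cring k" shows "module k (free_module k S)"
proof -
  let ?F = "free_module k S"
  interpret cring k by fact
  note v = free_module_value[OF assms, where S = S]
  have add: "(\<lambda>x. f x \<oplus>\<^bsub>k\<^esub> g x) \<in> carrier ?F"
    if "f \<in> carrier ?F" "g \<in> carrier ?F" for f g
  proof (rule free_moduleI)
    have "{x. f x \<oplus>\<^bsub>k\<^esub> g x \<noteq> \<zero>\<^bsub>k\<^esub>} \<subseteq> {x. f x \<noteq> \<zero>\<^bsub>k\<^esub>} \<union> {x. g x \<noteq> \<zero>\<^bsub>k\<^esub>}" by auto
    then show "finite {x. f x \<oplus>\<^bsub>k\<^esub> g x \<noteq> \<zero>\<^bsub>k\<^esub>}"
      using free_moduleD(3)[OF that(1)] free_moduleD(3)[OF that(2)] by (meson finite_UnI finite_subset)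
  qed (simp_all add: free_moduleD(1,2)[OF that(1)] free_moduleD(1,2)[OF that(2)])
  have smult: "(\<lambda>x. c \<otimes>\<^bsub>k\<^esub> f x) \<in> carrier ?F"
    if "f \<in> carrier ?F" "c \<in> carrier k" for f c
  proof (rule free_moduleI)
    have "{x. c \<otimes>\<^bsub>k\<^esub> f x \<noteq> \<zero>\<^bsub>k\<^esub>} \<subseteq> {x. f x \<noteq> \<zero>\<^bsub>k\<^esub>}" using that by auto
    then show "finite {x. c \<otimes>\<^bsub>k\<^esub> f x \<noteq> \<zero>\<^bsub>k\<^esub>}"
      using free_moduleD(3)[OF that(1)] by (meson finite_subset)
  qed (use that(2) in \<open>simp_all add: free_moduleD(1,2)[OF that(1)]\<close>)
  show ?thesis
  proof (rule module_criteria)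
    show "\<zero>\<^bsub>?F\<^esub> \<in> carrier ?F"
      by (rule free_moduleI) auto
    show "\<forall>v\<in>carrier ?F. \<exists>w\<in>carrier ?F. v \<oplus>\<^bsub>?F\<^esub> w = \<zero>\<^bsub>?F\<^esub>"
    proof
      fix f assume f: "f \<in> carrier ?F"
      have "(\<lambda>x. (\<ominus>\<^bsub>k\<^esub> \<one>\<^bsub>k\<^esub>) \<otimes>\<^bsub>k\<^esub> f x) \<in> carrier ?F"
        using smult[OF f] by simp
      moreover have "f \<oplus>\<^bsub>?F\<^esub> (\<lambda>x. (\<ominus>\<^bsub>k\<^esub> \<one>\<^bsub>k\<^esub>) \<otimes>\<^bsub>k\<^esub> f x) = \<zero>\<^bsub>?F\<^esub>"
        using v[OF f] by (simp add: fun_eq_iff l_minus r_neg)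
      ultimately show "\<exists>w\<in>carrier ?F. f \<oplus>\<^bsub>?F\<^esub> w = \<zero>\<^bsub>?F\<^esub>"
        by blast
    qed
  qed (use assms add smult v in \<open>auto simp: fun_eq_iff a_ac m_assoc l_distr r_distr\<close>)
qed

lemma free_basis_mem:
  assumes "cring k" "s \<in> S"
  shows "free_basis k s \<in> carrier (free_module k S)"
proof -
  interpret cring k by fact
  have "{x. free_basis k s x \<noteq> \<zero>\<^bsub>k\<^esub>} \<subseteq> {s}" by (auto simp: free_basis_def)
  then show ?thesis
    by (intro free_moduleI) (use assms(2) in \<open>auto simp: free_basis_def finite_subset\<close>)
qed

text \<open>Induction over a finite set that contains the support of \<open>f\<close>, clearing one
  coordinate at a time. The set only bounds the support, so \<open>f\<close> may already vanish at
  the removed point.\<close>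

lemma free_module_generated:
  assumes k: "cring k" and N: "submodule k N (free_module k S)"
    and basis: "\<And>s. s \<in> S \<Longrightarrow> free_basis k s \<in> N"
    and f: "f \<in> carrier (free_module k S)"
  shows "f \<in> N"
proof -
  let ?F = "free_module k S"
  interpret cring k by fact
  interpret N: submodule k N "?F" by fact
  have "f \<in> N" if "finite A" "f \<in> carrier ?F" "{x. f x \<noteq> \<zero>\<^bsub>k\<^esub>} \<subseteq> A" "A \<subseteq> S" for A f
    using that
  proof (induction A arbitrary: f)
    case empty
    then have "f = \<zero>\<^bsub>?F\<^esub>" by auto
    then show ?case using N.zero_closed by simp
  next
    case (insert a A)
    define g where "g = f(a := \<zero>\<^bsub>k\<^esub>)"
    have "finite {x. g x \<noteq> \<zero>\<^bsub>k\<^esub>}"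
      by (rule finite_subset[OF _ free_moduleD(3)[OF insert.prems(1)]]) (auto simp: g_def)
    then have "g \<in> carrier ?F"
      by (intro free_moduleI) (simp_all add: g_def free_moduleD(1,2)[OF insert.prems(1)])
    moreover have "{x. g x \<noteq> \<zero>\<^bsub>k\<^esub>} \<subseteq> A" using insert.prems by (auto simp: g_def)
    ultimately have "g \<in> N" using insert by auto
    have fa: "f a \<in> carrier k" "\<And>x. f x \<in> carrier k"
      using free_module_value[OF k insert.prems(1)] by auto
    have "f a \<odot>\<^bsub>?F\<^esub> free_basis k a \<in> N"
      using basis insert.prems fa by (intro N.smult_closed) auto
    then have "f a \<odot>\<^bsub>?F\<^esub> free_basis k a \<oplus>\<^bsub>?F\<^esub> g \<in> N"
      using \<open>g \<in> N\<close> by (rule N.m_closed)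
    also have "f a \<odot>\<^bsub>?F\<^esub> free_basis k a \<oplus>\<^bsub>?F\<^esub> g = f"
      using fa by (auto simp: g_def free_basis_def fun_eq_iff)
    finally show ?case .
  qed
  from this[OF free_moduleD(3)[OF f] f _ free_module_supp[OF f]] show ?thesis by simp
qed

text \<open>The elements on which \<open>g\<close> and \<open>h\<close> agree form a submodule, and
  it contains the basis. Most identities between maps out of free modules are reduced to basis
  vectors in this way.\<close>

lemma free_module_hom_eqI:
  assumes k: "cring k" and M: "module k M"
    and g: "g \<in> module_hom k (free_module k S) M" and h: "h \<in> module_hom k (free_module k S) M"
    and eq: "\<And>s. s \<in> S \<Longrightarrow> g (free_basis k s) = h (free_basis k s)"
    and f: "f \<in> carrier (free_module k S)"
  shows "g f = h f"
proof -
  let ?F = "free_module k S"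
  interpret F: module k "?F" by (rule free_module_module[OF k])
  let ?N = "{f \<in> carrier ?F. g f = h f}"
  have "submodule k ?N ?F"
  proof (intro submodule.intro)
    show "v \<oplus>\<^bsub>?F\<^esub> w \<in> ?N" if "v \<in> ?N" "w \<in> ?N" for v w
      using that module_hom_add[OF g, of v w] module_hom_add[OF h, of v w] F.M.a_closed[of v w] by auto
    show "\<zero>\<^bsub>?F\<^esub> \<in> ?N"
      using module_hom_zero[OF F.module_axioms M g] module_hom_zero[OF F.module_axioms M h]
        F.M.zero_closed by auto
    show "c \<odot>\<^bsub>?F\<^esub> v \<in> ?N" if "c \<in> carrier k" "v \<in> ?N" for c v
      using that module_hom_smult[OF g, of c v] module_hom_smult[OF h, of c v] F.smult_closed[of c v] by auto
  qed (auto intro: F.module_axioms)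
  then have "f \<in> ?N"
    by (rule free_module_generated[OF k]) (use eq free_basis_mem[OF k] f in auto)
  then show ?thesis by simp
qed

text \<open>The linear map that the universal property of the free module attaches to
  \<open>g\<close>. The set \<open>S\<close> is no argument because the sum runs over the support of
  \<open>f\<close>.\<close>

definition lin_ext :: "'k ring \<Rightarrow> ('k, 'v) module \<Rightarrow> ('s \<Rightarrow> 'v) \<Rightarrow> ('s \<Rightarrow> 'k) \<Rightarrow> 'v" where
  "lin_ext k M g f = (\<Oplus>\<^bsub>M\<^esub>p\<in>{p. f p \<noteq> \<zero>\<^bsub>k\<^esub>}. f p \<odot>\<^bsub>M\<^esub> g p)"

text \<open>Terms outside the support vanish. Two elements and their sum have different supports, so
  additivity can only be read off after all three sums are taken over a common index set.\<close>

lemma lin_ext_superset: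
  assumes k: "cring k" and M: "module k M" and g: "g \<in> S \<rightarrow> carrier M" and f: "f \<in> carrier (free_module k S)"
    and A: "finite A" "{p. f p \<noteq> \<zero>\<^bsub>k\<^esub>} \<subseteq> A" "A \<subseteq> S"
  shows "lin_ext k M g f = (\<Oplus>\<^bsub>M\<^esub>p\<in>A. f p \<odot>\<^bsub>M\<^esub> g p)"
proof -
  interpret M: module k M by fact
  have c: "f p \<odot>\<^bsub>M\<^esub> g p \<in> carrier M" if "p \<in> A" for p
    using that A by (intro M.smult_closed free_module_value[OF k f] funcset_mem[OF g]) auto
  show ?thesis unfolding lin_ext_def
  proof (rule M.M.add.finprod_mono_neutral_cong_left)
    show "finite A" "{p. f p \<noteq> \<zero>\<^bsub>k\<^esub>} \<subseteq> A" by fact+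
    show "f i \<odot>\<^bsub>M\<^esub> g i = \<zero>\<^bsub>M\<^esub>" if "i \<in> A - {p. f p \<noteq> \<zero>\<^bsub>k\<^esub>}" for i
      using that A funcset_mem[OF g, of i] by auto
  qed (use c in auto)
qed

lemma lin_ext_hom:
  assumes k: "cring k" and M: "module k M" and g: "g \<in> S \<rightarrow> carrier M"
  shows "lin_ext k M g \<in> module_hom k (free_module k S) M"
proof (rule module_homI)
  let ?F = "free_module k S"
  interpret M: module k M by fact
  note sup = lin_ext_superset[OF k M g] and val = free_module_value[OF k]
  note F = module.smult_closed[OF free_module_module[OF k]]
    abelian_group.axioms(1)[OF module.axioms(2)[OF free_module_module[OF k]], THEN abelian_monoid.a_closed]
  have c: "(\<lambda>p. f p \<odot>\<^bsub>M\<^esub> g p) \<in> A \<rightarrow> carrier M" if "f \<in> carrier ?F" "A \<subseteq> S" for f A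
    using that by (intro funcsetI M.smult_closed val funcset_mem[OF g]) auto
  fix f assume f: "f \<in> carrier ?F"
  let ?A = "{p. f p \<noteq> \<zero>\<^bsub>k\<^esub>}"
  note fA = free_moduleD(3)[OF f] free_module_supp[OF f]
  show "lin_ext k M g f \<in> carrier M"
    unfolding lin_ext_def using c[OF f fA(2)] by (rule M.M.finsum_closed)
  { fix h assume h: "h \<in> carrier ?F"
    let ?B = "?A \<union> {p. h p \<noteq> \<zero>\<^bsub>k\<^esub>}"
    have B: "finite ?B" "?B \<subseteq> S" using fA free_moduleD(3)[OF h] free_module_supp[OF h] by auto
    have fh: "f \<oplus>\<^bsub>?F\<^esub> h \<in> carrier ?F" using F(2)[OF f h] .
    have "lin_ext k M g (f \<oplus>\<^bsub>?F\<^esub> h) = (\<Oplus>\<^bsub>M\<^esub>p\<in>?B. (f \<oplus>\<^bsub>?F\<^esub> h) p \<odot>\<^bsub>M\<^esub> g p)"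
      by (rule sup[OF fh B(1) _ B(2)]) auto
    also have "\<dots> = (\<Oplus>\<^bsub>M\<^esub>p\<in>?B. f p \<odot>\<^bsub>M\<^esub> g p \<oplus>\<^bsub>M\<^esub> h p \<odot>\<^bsub>M\<^esub> g p)"
    proof (rule M.M.add.finprod_cong')
      show "(\<lambda>p. f p \<odot>\<^bsub>M\<^esub> g p \<oplus>\<^bsub>M\<^esub> h p \<odot>\<^bsub>M\<^esub> g p) \<in> ?B \<rightarrow> carrier M"
        by (intro funcsetI M.M.a_closed funcset_mem[OF c[OF f B(2)]] funcset_mem[OF c[OF h B(2)]])
      show "(f \<oplus>\<^bsub>?F\<^esub> h) i \<odot>\<^bsub>M\<^esub> g i = f i \<odot>\<^bsub>M\<^esub> g i \<oplus>\<^bsub>M\<^esub> h i \<odot>\<^bsub>M\<^esub> g i" if "i \<in> ?B" for i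
        using M.smult_l_distr[OF val[OF f] val[OF h] funcset_mem[OF g subsetD[OF B(2) that]]] by simp
    qed simp
    also have "\<dots> = (\<Oplus>\<^bsub>M\<^esub>p\<in>?B. f p \<odot>\<^bsub>M\<^esub> g p) \<oplus>\<^bsub>M\<^esub> (\<Oplus>\<^bsub>M\<^esub>p\<in>?B. h p \<odot>\<^bsub>M\<^esub> g p)"
      by (rule M.M.finsum_addf[OF c[OF f B(2)] c[OF h B(2)]])
    also have "\<dots> = lin_ext k M g f \<oplus>\<^bsub>M\<^esub> lin_ext k M g h"
      using sup[OF f B(1) _ B(2)] sup[OF h B(1) _ B(2)] by simp
    finally show "lin_ext k M g (f \<oplus>\<^bsub>?F\<^esub> h) = lin_ext k M g f \<oplus>\<^bsub>M\<^esub> lin_ext k M g h" .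
  }
  fix a assume a: "a \<in> carrier k"
  have af: "a \<odot>\<^bsub>?F\<^esub> f \<in> carrier ?F" using F(1)[OF a f] .
  have "lin_ext k M g (a \<odot>\<^bsub>?F\<^esub> f) = (\<Oplus>\<^bsub>M\<^esub>p\<in>?A. (a \<odot>\<^bsub>?F\<^esub> f) p \<odot>\<^bsub>M\<^esub> g p)"
    by (rule sup[OF af fA(1) _ fA(2)]) (use a in auto)
  also have "\<dots> = (\<Oplus>\<^bsub>M\<^esub>p\<in>?A. a \<odot>\<^bsub>M\<^esub> (f p \<odot>\<^bsub>M\<^esub> g p))"
  proof (rule M.M.add.finprod_cong')
    show "(\<lambda>p. a \<odot>\<^bsub>M\<^esub> (f p \<odot>\<^bsub>M\<^esub> g p)) \<in> ?A \<rightarrow> carrier M"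
      by (intro funcsetI M.smult_closed[OF a] funcset_mem[OF c[OF f fA(2)]])
    show "(a \<odot>\<^bsub>?F\<^esub> f) i \<odot>\<^bsub>M\<^esub> g i = a \<odot>\<^bsub>M\<^esub> (f i \<odot>\<^bsub>M\<^esub> g i)" if "i \<in> ?A" for i
      using M.smult_assoc1[OF a val[OF f] funcset_mem[OF g subsetD[OF fA(2) that]]] by simp
  qed simp
  also have "\<dots> = a \<odot>\<^bsub>M\<^esub> (\<Oplus>\<^bsub>M\<^esub>p\<in>?A. f p \<odot>\<^bsub>M\<^esub> g p)"
    by (rule M.finsum_smult_ldistr[symmetric, OF fA(1) a c[OF f fA(2)]])
  finally show "lin_ext k M g (a \<odot>\<^bsub>?F\<^esub> f) = a \<odot>\<^bsub>M\<^esub> lin_ext k M g f"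
    by (simp only: lin_ext_def)
qed

lemma lin_ext_basis:
  assumes k: "cring k" and M: "module k M" and g: "g \<in> S \<rightarrow> carrier M" and s: "s \<in> S"
  shows "lin_ext k M g (free_basis k s) = g s"
proof -
  interpret M: module k M by fact
  have "g s \<in> carrier M" using g s by auto
  have "lin_ext k M g (free_basis k s) = (\<Oplus>\<^bsub>M\<^esub>p\<in>{s}. free_basis k s p \<odot>\<^bsub>M\<^esub> g p)"
    by (rule lin_ext_superset[OF k M g free_basis_mem[OF k s]]) (use s in \<open>auto simp: free_basis_def\<close>)
  also have "\<dots> = free_basis k s s \<odot>\<^bsub>M\<^esub> g s"
    using \<open>g s \<in> carrier M\<close> by (subst M.M.finsum_insert) (auto simp: free_basis_def)
  finally show ?thesis using \<open>g s \<in> carrier M\<close> by (simp add: free_basis_def)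
qed

lemma free_module_finsum:
  assumes k: "cring k" and "finite A" "h \<in> A \<rightarrow> carrier (free_module k S)"
  shows "(\<Oplus>\<^bsub>free_module k S\<^esub>p\<in>A. h p) y = (\<Oplus>\<^bsub>k\<^esub>p\<in>A. h p y)"
  using assms(2,3)
proof induction
  interpret cring k by fact
  interpret F: module k "free_module k S" by (rule free_module_module[OF k])
  {
    case empty
    show ?case by simp
  next
    case (insert a A)
    then have "h a \<in> carrier (free_module k S)" "h \<in> A \<rightarrow> carrier (free_module k S)" by auto
    moreover from this have "(\<lambda>p. h p y) \<in> A \<rightarrow> carrier k" "h a y \<in> carrier k"
      using free_module_value[OF k, where S = S] by auto
    ultimately show ?case using insert by simp
  }
qed

text \<open>Evaluating the linear extension at \<open>y\<close> leaves the terms with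
  \<open>\<phi> p = y\<close>, and these form the fibre sum that defines \<open>free_map\<close>.
  Linearity and functoriality of \<open>free_map\<close> then follow from its values on the
  basis.\<close>

lemma free_map_lin_ext:
  assumes k: "cring k" and \<phi>: "\<phi> \<in> S \<rightarrow> T" and f: "f \<in> carrier (free_module k S)"
  shows "free_map k \<phi> f = lin_ext k (free_module k T) (\<lambda>s. free_basis k (\<phi> s)) f"
proof
  fix y
  interpret cring k by fact
  let ?A = "{p. f p \<noteq> \<zero>\<^bsub>k\<^esub>}"
  note fA = free_moduleD(3)[OF f] free_module_supp[OF f]
  note val = free_module_value[OF k f]
  have "(\<lambda>p. f p \<odot>\<^bsub>free_module k T\<^esub> free_basis k (\<phi> p)) \<in> ?A \<rightarrow> carrier (free_module k T)"
    using fA(2) \<phi> val by (blast intro: module.smult_closed[OF free_module_module[OF k]] free_basis_mem[OF k])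
  then have "lin_ext k (free_module k T) (\<lambda>s. free_basis k (\<phi> s)) f y = (\<Oplus>\<^bsub>k\<^esub>p\<in>?A. f p \<otimes>\<^bsub>k\<^esub> free_basis k (\<phi> p) y)"
    unfolding lin_ext_def using free_module_finsum[OF k fA(1)] by simp
  also have "\<dots> = free_map k \<phi> f y"
    unfolding free_map_def
    by (rule add.finprod_mono_neutral_cong_right) (use fA(1) val in \<open>auto simp: free_basis_def\<close>)
  finally show "free_map k \<phi> f y = lin_ext k (free_module k T) (\<lambda>s. free_basis k (\<phi> s)) f y" ..
qed

lemma free_map_hom:
  assumes k: "cring k" and \<phi>: "\<phi> \<in> S \<rightarrow> T"
  shows "free_map k \<phi> \<in> module_hom k (free_module k S) (free_module k T)"
proof (rule module_hom_cong[OF free_module_module[OF k]])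
  show "lin_ext k (free_module k T) (\<lambda>s. free_basis k (\<phi> s)) \<in> module_hom k (free_module k S) (free_module k T)"
    by (intro lin_ext_hom[OF k free_module_module[OF k]] funcsetI free_basis_mem[OF k] funcset_mem[OF \<phi>])
qed (simp add: free_map_lin_ext[OF k \<phi>])

lemma free_map_basis:
  assumes k: "cring k" and "\<phi> s \<in> T"
  shows "free_map k \<phi> (free_basis k s) = free_basis k (\<phi> s)"
proof -
  have \<phi>: "\<phi> \<in> {s} \<rightarrow> T" using assms by auto
  have "free_map k \<phi> (free_basis k s) = lin_ext k (free_module k T) (\<lambda>s. free_basis k (\<phi> s)) (free_basis k s)"
    by (rule free_map_lin_ext[OF k \<phi> free_basis_mem[OF k]]) simp
  also have "\<dots> = free_basis k (\<phi> s)"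
    by (rule lin_ext_basis[OF k free_module_module[OF k], of _ "{s}"])
      (simp_all add: free_basis_mem[OF k] assms)
  finally show ?thesis .
qed

lemma free_map_compose:
  assumes k: "cring k" and \<phi>: "\<phi> \<in> S \<rightarrow> T" and \<psi>: "\<psi> \<in> T \<rightarrow> W" and \<chi>: "\<And>s. s \<in> S \<Longrightarrow> \<chi> s = \<psi> (\<phi> s)"
    and f: "f \<in> carrier (free_module k S)"
  shows "free_map k \<chi> f = free_map k \<psi> (free_map k \<phi> f)"
proof (rule free_module_hom_eqI[OF k free_module_module[OF k], of _ S W])
  show "free_map k \<chi> \<in> module_hom k (free_module k S) (free_module k W)"
    by (rule free_map_hom[OF k]) (use \<phi> \<psi> \<chi> in auto)
  show "(\<lambda>f. free_map k \<psi> (free_map k \<phi> f)) \<in> module_hom k (free_module k S) (free_module k W)"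
    by (rule module_hom_compose[OF free_map_hom[OF k \<phi>] free_map_hom[OF k \<psi>]])
  show "free_map k \<chi> (free_basis k s) = free_map k \<psi> (free_map k \<phi> (free_basis k s))" if "s \<in> S" for s
  proof -
    have "\<phi> s \<in> T" "\<psi> (\<phi> s) \<in> W" "\<chi> s \<in> W" using that \<phi> \<psi> \<chi> by auto
    then show ?thesis
      using that by (simp add: free_map_basis[OF k, of \<chi> s W] free_map_basis[OF k, of \<phi> s T]
          free_map_basis[OF k, of \<psi> "\<phi> s" W] \<chi>)
  qed
qed fact

lemma free_map_ident:
  assumes k: "cring k" and \<phi>: "\<And>s. s \<in> S \<Longrightarrow> \<phi> s = s" and f: "f \<in> carrier (free_module k S)"
  shows "free_map k \<phi> f = f"
proof (rule free_module_hom_eqI[OF k free_module_module[OF k], of _ S S "\<lambda>f. f"])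
  show "free_map k \<phi> \<in> module_hom k (free_module k S) (free_module k S)"
    by (rule free_map_hom[OF k]) (use \<phi> in auto)
qed (use f \<phi> free_map_basis[OF k, of \<phi> _ S] in \<open>auto simp: module_hom_def\<close>)

section \<open>Functors to vector spaces\<close>

text \<open>Here \<open>r\<close> picks an element of the coset of its argument instead of forming
  the coset, so that a quotient keeps the element type of the module. The choice is constant on
  cosets because congruent elements define the same predicate \<open>P x\<close>, to which
  \<open>SOME\<close> is applied.\<close>

lemma submodule_coset_rep:
  assumes N: "submodule k N M"
  shows "\<exists>r. \<forall>x\<in>carrier M. \<forall>y\<in>carrier M. (r x = (r y :: 'v)) \<longleftrightarrow> x \<ominus>\<^bsub>M\<^esub> (y :: 'v) \<in> N"
proof -
  interpret N: submodule k N M by fact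
  interpret M: module k M by (rule N.module)
  define P where "P = (\<lambda>x z. z \<in> carrier M \<and> x \<ominus>\<^bsub>M\<^esub> z \<in> N)"
  have sym: "y \<ominus>\<^bsub>M\<^esub> x \<in> N" if "x \<in> carrier M" "y \<in> carrier M" "x \<ominus>\<^bsub>M\<^esub> y \<in> N" for x y
  proof -
    have "\<zero>\<^bsub>M\<^esub> \<ominus>\<^bsub>M\<^esub> (x \<ominus>\<^bsub>M\<^esub> y) \<in> N" using submodule_minus[OF N] that by simp
    moreover have "\<zero>\<^bsub>M\<^esub> \<ominus>\<^bsub>M\<^esub> (x \<ominus>\<^bsub>M\<^esub> y) = y \<ominus>\<^bsub>M\<^esub> x"
      using that by (simp add: a_minus_def M.M.minus_add M.M.a_ac)
    ultimately show ?thesis by simp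
  qed
  have trans: "x \<ominus>\<^bsub>M\<^esub> z \<in> N"
    if "x \<in> carrier M" "y \<in> carrier M" "z \<in> carrier M" "x \<ominus>\<^bsub>M\<^esub> y \<in> N" "y \<ominus>\<^bsub>M\<^esub> z \<in> N" for x y z
  proof -
    have "(x \<ominus>\<^bsub>M\<^esub> y) \<oplus>\<^bsub>M\<^esub> (y \<ominus>\<^bsub>M\<^esub> z) = x \<oplus>\<^bsub>M\<^esub> (\<ominus>\<^bsub>M\<^esub> y \<oplus>\<^bsub>M\<^esub> y) \<ominus>\<^bsub>M\<^esub> z"
      using that by (simp add: a_minus_def M.M.a_assoc del: M.M.l_neg)
    also have "\<dots> = x \<ominus>\<^bsub>M\<^esub> z" using that by (simp add: M.M.l_neg)
    finally show ?thesis using N.m_closed[OF that(4,5)] by simp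
  qed
  have refl: "x \<ominus>\<^bsub>M\<^esub> x \<in> N" if "x \<in> carrier M" for x
    using that by (simp add: a_minus_def M.M.r_neg)
  have PS: "P x (SOME z. P x z)" if "x \<in> carrier M" for x
    by (rule someI[of "P x" x]) (use that refl in \<open>simp add: P_def\<close>)
  have "(SOME z. P x z) = (SOME z. P y z) \<longleftrightarrow> x \<ominus>\<^bsub>M\<^esub> y \<in> N" if xy: "x \<in> carrier M" "y \<in> carrier M" for x y
  proof
    assume eq: "(SOME z. P x z) = (SOME z. P y z)"
    have "P x (SOME z. P x z)" by (rule PS[OF xy(1)])
    moreover have "P y (SOME z. P x z)" unfolding eq by (rule PS[OF xy(2)])
    ultimately show "x \<ominus>\<^bsub>M\<^esub> y \<in> N"
      using sym[OF xy(2), of "SOME z. P x z"] trans[OF xy(1) _ xy(2), of "SOME z. P x z"] by (auto simp: P_def)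
  next
    assume "x \<ominus>\<^bsub>M\<^esub> y \<in> N"
    then have "y \<ominus>\<^bsub>M\<^esub> x \<in> N" by (rule sym[OF xy])
    have "P x z = P y z" for z
    proof
      assume "P x z"
      then have "z \<in> carrier M" "x \<ominus>\<^bsub>M\<^esub> z \<in> N" by (simp_all only: P_def)
      then show "P y z" using trans[OF xy(2,1) _ \<open>y \<ominus>\<^bsub>M\<^esub> x \<in> N\<close>] by (simp only: P_def)
    next
      assume "P y z"
      then have "z \<in> carrier M" "y \<ominus>\<^bsub>M\<^esub> z \<in> N" by (simp_all only: P_def)
      then show "P x z" using trans[OF xy _ \<open>x \<ominus>\<^bsub>M\<^esub> y \<in> N\<close>] by (simp only: P_def)
    qed
    then have "P x = P y" by (rule ext)
    then show "(SOME z. P x z) = (SOME z. P y z)" by simp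
  qed
  then show ?thesis by (intro exI[of _ "\<lambda>x. SOME z. P x z"] ballI)
qed

locale presheaves =
  fixes k :: "'k ring" and U :: "'a monoid set"
  assumes field_k: "field k" and U_finite_groups: "U \<subseteq> finite_groups"
begin

lemma cring_k: "cring k"
proof -
  interpret field k by (rule field_k)
  show ?thesis by unfold_locales
qed

lemma group_U: "G \<in> U \<Longrightarrow> group G" and finite_U: "G \<in> U \<Longrightarrow> finite (carrier G)"
  using U_finite_groups by (auto simp: finite_groups_def)

lemmas comp_cls_Hom_U = comp_cls_Hom[OF group_U group_U group_U]
lemmas comp_id_cls_U = comp_id_cls[OF group_U group_U]

lemma A_of_module: "X \<in> A_of k U \<Longrightarrow> G \<in> U \<Longrightarrow> module k (obj X G)"
  by (auto simp: A_of_def vectorspace_def)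

lemma A_of_act_hom:
  "X \<in> A_of k U \<Longrightarrow> G \<in> U \<Longrightarrow> H \<in> U \<Longrightarrow> \<alpha> \<in> Hom G H \<Longrightarrow> act X G H \<alpha> \<in> module_hom k (obj X H) (obj X G)"
  by (simp add: A_of_def)

lemma A_of_act_mem:
  "X \<in> A_of k U \<Longrightarrow> G \<in> U \<Longrightarrow> H \<in> U \<Longrightarrow> \<alpha> \<in> Hom G H \<Longrightarrow> x \<in> carrier (obj X H) \<Longrightarrow>
    act X G H \<alpha> x \<in> carrier (obj X G)"
  using module_hom_mem[OF A_of_act_hom] .

lemma A_of_id:
  "X \<in> A_of k U \<Longrightarrow> G \<in> U \<Longrightarrow> x \<in> carrier (obj X G) \<Longrightarrow> act X G G (id_cls G) x = x"
  by (simp add: A_of_def)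

lemma A_of_comp:
  "X \<in> A_of k U \<Longrightarrow> G \<in> U \<Longrightarrow> H \<in> U \<Longrightarrow> K \<in> U \<Longrightarrow> \<alpha> \<in> Hom G H \<Longrightarrow> \<beta> \<in> Hom H K \<Longrightarrow>
    x \<in> carrier (obj X K) \<Longrightarrow> act X G K (comp_cls G \<beta> \<alpha>) x = act X G H \<alpha> (act X H K \<beta> x)"
  by (simp add: A_of_def)

lemma A_ofI:
  assumes "\<And>G. G \<in> U \<Longrightarrow> module k (obj X G)"
    and "\<And>G H \<alpha>. G \<in> U \<Longrightarrow> H \<in> U \<Longrightarrow> \<alpha> \<in> Hom G H \<Longrightarrow> act X G H \<alpha> \<in> module_hom k (obj X H) (obj X G)"
    and "\<And>G x. G \<in> U \<Longrightarrow> x \<in> carrier (obj X G) \<Longrightarrow> act X G G (id_cls G) x = x"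
    and "\<And>G H K \<alpha> \<beta> x. G \<in> U \<Longrightarrow> H \<in> U \<Longrightarrow> K \<in> U \<Longrightarrow> \<alpha> \<in> Hom G H \<Longrightarrow> \<beta> \<in> Hom H K \<Longrightarrow>
      x \<in> carrier (obj X K) \<Longrightarrow> act X G K (comp_cls G \<beta> \<alpha>) x = act X G H \<alpha> (act X H K \<beta> x)"
  shows "X \<in> A_of k U"
  unfolding A_of_def vectorspace_def
  by (intro CollectI conjI ballI field_k; rule assms; assumption)

lemma nat_transI:
  assumes "\<And>G. G \<in> U \<Longrightarrow> \<eta> G \<in> module_hom k (obj X G) (obj Y G)"
    and "\<And>G H \<alpha> x. G \<in> U \<Longrightarrow> H \<in> U \<Longrightarrow> \<alpha> \<in> Hom G H \<Longrightarrow> x \<in> carrier (obj X H) \<Longrightarrow>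
      \<eta> G (act X G H \<alpha> x) = act Y G H \<alpha> (\<eta> H x)"
  shows "\<eta> \<in> nat_trans k U X Y"
  using assms by (simp add: nat_trans_def)

lemma nat_trans_hom: "\<eta> \<in> nat_trans k U X Y \<Longrightarrow> G \<in> U \<Longrightarrow> \<eta> G \<in> module_hom k (obj X G) (obj Y G)"
  by (simp add: nat_trans_def)

lemma nat_trans_mem:
  "\<eta> \<in> nat_trans k U X Y \<Longrightarrow> G \<in> U \<Longrightarrow> x \<in> carrier (obj X G) \<Longrightarrow> \<eta> G x \<in> carrier (obj Y G)"
  using module_hom_mem[OF nat_trans_hom] .

lemma nat_trans_act:
  "\<eta> \<in> nat_trans k U X Y \<Longrightarrow> G \<in> U \<Longrightarrow> H \<in> U \<Longrightarrow> \<alpha> \<in> Hom G H \<Longrightarrow> x \<in> carrier (obj X H) \<Longrightarrow>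
    \<eta> G (act X G H \<alpha> x) = act Y G H \<alpha> (\<eta> H x)"
  by (simp add: nat_trans_def)

lemma nat_trans_compose:
  assumes \<eta>: "\<eta> \<in> nat_trans k U X Y" and \<theta>: "\<theta> \<in> nat_trans k U Y Z"
  shows "(\<lambda>G x. \<theta> G (\<eta> G x)) \<in> nat_trans k U X Z"
proof (rule nat_transI)
  show "(\<lambda>x. \<theta> G (\<eta> G x)) \<in> module_hom k (obj X G) (obj Z G)" if "G \<in> U" for G
    by (rule module_hom_compose[OF nat_trans_hom[OF \<eta> that] nat_trans_hom[OF \<theta> that]])
qed (simp add: nat_trans_act[OF \<eta>] nat_trans_act[OF \<theta>] nat_trans_mem[OF \<eta>])

lemma nat_trans_ident: "(\<lambda>_ x. x) \<in> nat_trans k U X X"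
  by (simp add: nat_trans_def module_hom_def)

lemma nat_trans_minus:
  assumes "X \<in> A_of k U" "Y \<in> A_of k U" "\<eta> \<in> nat_trans k U X Y" "G \<in> U" "x \<in> carrier (obj X G)" "y \<in> carrier (obj X G)"
  shows "\<eta> G (x \<ominus>\<^bsub>obj X G\<^esub> y) = \<eta> G x \<ominus>\<^bsub>obj Y G\<^esub> \<eta> G y"
  by (rule module_hom_minus[OF A_of_module[OF assms(1,4)] A_of_module[OF assms(2,4)] nat_trans_hom[OF assms(3,4)] assms(5,6)])

lemma nat_trans_zero:
  assumes "X \<in> A_of k U" "Y \<in> A_of k U" "\<eta> \<in> nat_trans k U X Y" "G \<in> U"
  shows "\<eta> G \<zero>\<^bsub>obj X G\<^esub> = \<zero>\<^bsub>obj Y G\<^esub>"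
  by (rule module_hom_zero[OF A_of_module[OF assms(1,4)] A_of_module[OF assms(2,4)] nat_trans_hom[OF assms(3,4)]])

section \<open>Subfunctors and the subobjects they define\<close>

lemma subfunctorI:
  assumes "\<And>G. G \<in> U \<Longrightarrow> submodule k (N G) (obj X G)"
    and "\<And>G H \<alpha> x. G \<in> U \<Longrightarrow> H \<in> U \<Longrightarrow> \<alpha> \<in> Hom G H \<Longrightarrow> x \<in> N H \<Longrightarrow> act X G H \<alpha> x \<in> N G"
  shows "is_subfunctor k U X N"
  using assms by (auto simp: is_subfunctor_def)

lemma subfunctor_submodule: "is_subfunctor k U X N \<Longrightarrow> G \<in> U \<Longrightarrow> submodule k (N G) (obj X G)"
  by (simp add: is_subfunctor_def)

lemma subfunctor_mem: "is_subfunctor k U X N \<Longrightarrow> G \<in> U \<Longrightarrow> x \<in> N G \<Longrightarrow> x \<in> carrier (obj X G)"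
  using submodule.subset[OF subfunctor_submodule] by blast

lemma subfunctor_act:
  "is_subfunctor k U X N \<Longrightarrow> G \<in> U \<Longrightarrow> H \<in> U \<Longrightarrow> \<alpha> \<in> Hom G H \<Longrightarrow> x \<in> N H \<Longrightarrow> act X G H \<alpha> x \<in> N G"
  by (auto simp: is_subfunctor_def image_subset_iff)

lemma subfunctor_carrier: "X \<in> A_of k U \<Longrightarrow> is_subfunctor k U X (\<lambda>G. carrier (obj X G))"
  by (intro subfunctorI submodule_carrier A_of_module A_of_act_mem)

lemma subfunctor_zero:
  assumes X: "X \<in> A_of k U" shows "is_subfunctor k U X (\<lambda>G. {\<zero>\<^bsub>obj X G\<^esub>})"
  by (intro subfunctorI submodule_zero A_of_module[OF X])
     (use module_hom_zero[OF A_of_module[OF X] A_of_module[OF X] A_of_act_hom[OF X]] in auto)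

lemma subfunctor_Int:
  "is_subfunctor k U X N \<Longrightarrow> is_subfunctor k U X N' \<Longrightarrow> is_subfunctor k U X (\<lambda>G. N G \<inter> N' G)"
  by (intro subfunctorI submodule_Int) (auto intro: subfunctor_submodule subfunctor_act)

lemma subfunctor_plus:
  assumes X: "X \<in> A_of k U" and N: "is_subfunctor k U X N" and N': "is_subfunctor k U X N'"
  shows "is_subfunctor k U X (\<lambda>G. {x \<oplus>\<^bsub>obj X G\<^esub> y | x y. x \<in> N G \<and> y \<in> N' G})"
proof (rule subfunctorI)
  fix G H \<alpha> z assume GH: "G \<in> U" "H \<in> U" "\<alpha> \<in> Hom G H" and "z \<in> {x \<oplus>\<^bsub>obj X H\<^esub> y | x y. x \<in> N H \<and> y \<in> N' H}"
  then obtain x y where xy: "x \<in> N H" "y \<in> N' H" "z = x \<oplus>\<^bsub>obj X H\<^esub> y" by auto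
  then have "act X G H \<alpha> z = act X G H \<alpha> x \<oplus>\<^bsub>obj X G\<^esub> act X G H \<alpha> y"
    using module_hom_add[OF A_of_act_hom[OF X GH]] subfunctor_mem[OF N GH(2)] subfunctor_mem[OF N' GH(2)] by blast
  then show "act X G H \<alpha> z \<in> {x \<oplus>\<^bsub>obj X G\<^esub> y | x y. x \<in> N G \<and> y \<in> N' G}"
    using subfunctor_act[OF N GH xy(1)] subfunctor_act[OF N' GH xy(2)] by blast
qed (intro submodule_plus subfunctor_submodule assms; assumption)

lemma subfunctor_vimage:
  assumes X: "X \<in> A_of k U" and \<eta>: "\<eta> \<in> nat_trans k U X Y" and N: "is_subfunctor k U Y N"
  shows "is_subfunctor k U X (\<lambda>G. {x \<in> carrier (obj X G). \<eta> G x \<in> N G})"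
  by (intro subfunctorI submodule_vimage[OF A_of_module[OF X] nat_trans_hom[OF \<eta>] subfunctor_submodule[OF N]])
     (auto simp: A_of_act_mem[OF X] nat_trans_act[OF \<eta>] subfunctor_act[OF N])

lemma subfunctor_image:
  assumes Y: "Y \<in> A_of k U" and \<eta>: "\<eta> \<in> nat_trans k U X Y" and N: "is_subfunctor k U X N"
  shows "is_subfunctor k U Y (\<lambda>G. \<eta> G ` N G)"
proof (intro subfunctorI submodule_image[OF A_of_module[OF Y] nat_trans_hom[OF \<eta>] subfunctor_submodule[OF N]])
  fix G H \<alpha> y assume GH: "G \<in> U" "H \<in> U" "\<alpha> \<in> Hom G H" and "y \<in> \<eta> H ` N H"
  then obtain x where x: "x \<in> N H" "y = \<eta> H x" by auto
  then have "act Y G H \<alpha> y = \<eta> G (act X G H \<alpha> x)"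
    using nat_trans_act[OF \<eta> GH subfunctor_mem[OF N GH(2)]] by simp
  then show "act Y G H \<alpha> y \<in> \<eta> G ` N G" using subfunctor_act[OF N GH x(1)] by blast
qed

lemma sub_psh_simps [simp]:
  "carrier (obj (sub_psh X N) G) = N G" "\<zero>\<^bsub>obj (sub_psh X N) G\<^esub> = \<zero>\<^bsub>obj X G\<^esub>"
  "x \<oplus>\<^bsub>obj (sub_psh X N) G\<^esub> y = x \<oplus>\<^bsub>obj X G\<^esub> y" "c \<odot>\<^bsub>obj (sub_psh X N) G\<^esub> y = c \<odot>\<^bsub>obj X G\<^esub> y"
  "act (sub_psh X N) = act X"
  by (simp_all add: sub_psh_def)

lemma sub_psh_A_of:
  assumes X: "X \<in> A_of k U" and N: "is_subfunctor k U X N"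
  shows "sub_psh X N \<in> A_of k U"
proof (rule A_ofI)
  let ?S = "sub_psh X N"
  note mem = subfunctor_mem[OF N]
  show "module k (obj ?S G)" if "G \<in> U" for G
    using module.submodule_is_module[OF A_of_module[OF X that] subfunctor_submodule[OF N that]]
    by (simp add: sub_psh_def)
  show "act ?S G H \<alpha> \<in> module_hom k (obj ?S H) (obj ?S G)"
    if GH: "G \<in> U" "H \<in> U" "\<alpha> \<in> Hom G H" for G H \<alpha>
    using subfunctor_act[OF N GH] module_hom_add[OF A_of_act_hom[OF X GH] mem mem]
      module_hom_smult[OF A_of_act_hom[OF X GH] _ mem] GH
    by (intro module_homI) auto
qed (use subfunctor_mem[OF N] A_of_id[OF X] A_of_comp[OF X] in auto)

lemma sub_psh_incl:
  assumes N: "is_subfunctor k U X N"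
  shows "(\<lambda>_ x. x) \<in> nat_trans k U (sub_psh X N) X"
  using subfunctor_mem[OF N] by (intro nat_transI module_homI) auto

lemma subfunctor_sub_psh:
  assumes X: "X \<in> A_of k U" and N: "is_subfunctor k U X N" and M: "is_subfunctor k U (sub_psh X N) M"
  shows "is_subfunctor k U X M"
proof -
  have "is_subfunctor k U X (\<lambda>G. (\<lambda>x. x) ` M G)"
    by (rule subfunctor_image[OF X sub_psh_incl[OF N] M])
  then show ?thesis by simp
qed

section \<open>Quotient functors and copies in another value type\<close>

text \<open>The quotient of \<open>P\<close> by the kernel of \<open>r\<close>, with values in the target type of \<open>r\<close>. The map \<open>r\<close> need only
  separate the cosets, so this also serves to move a functor to another value type.\<close>

definition quot_psh :: "('a, 'k, 'w) presheaf \<Rightarrow> ('a monoid \<Rightarrow> 'w \<Rightarrow> 'v) \<Rightarrow> ('a, 'k, 'v) presheaf" where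
  "quot_psh P r = \<lparr>obj = (\<lambda>G. push_module (obj P G) (r G)),
     act = (\<lambda>G H \<alpha> a. r G (act P G H \<alpha> (inv_into (carrier (obj P H)) (r H) a)))\<rparr>"

definition coset_map :: "('a, 'k, 'w) presheaf \<Rightarrow> ('a monoid \<Rightarrow> 'w set) \<Rightarrow> ('a monoid \<Rightarrow> 'w \<Rightarrow> 'v) \<Rightarrow> bool" where
  "coset_map P N r \<longleftrightarrow> (\<forall>G\<in>U. \<forall>x\<in>carrier (obj P G). \<forall>y\<in>carrier (obj P G). r G x = r G y \<longleftrightarrow> x \<ominus>\<^bsub>obj P G\<^esub> y \<in> N G)"

lemma coset_mapD:
  "coset_map P N r \<Longrightarrow> G \<in> U \<Longrightarrow> x \<in> carrier (obj P G) \<Longrightarrow> y \<in> carrier (obj P G) \<Longrightarrow>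
    r G x = r G y \<longleftrightarrow> x \<ominus>\<^bsub>obj P G\<^esub> y \<in> N G"
  by (simp add: coset_map_def)

lemma obj_quot_psh: "obj (quot_psh P r) G = push_module (obj P G) (r G)"
  by (simp add: quot_psh_def)

lemma carrier_quot_psh [simp]: "carrier (obj (quot_psh P r) G) = r G ` carrier (obj P G)"
  by (simp add: quot_psh_def)

context
  fixes P :: "('a, 'k, 'w) presheaf" and N and r :: "'a monoid \<Rightarrow> 'w \<Rightarrow> 'v"
  assumes P: "P \<in> A_of k U" and N: "is_subfunctor k U P N" and r: "coset_map P N r"
begin

text \<open>The preimage chosen by \<open>inv_into\<close> differs from \<open>x\<close> by an
  element of \<open>N\<close>, and the action preserves \<open>N\<close>.\<close>

lemma quot_psh_act:
  assumes "G \<in> U" "H \<in> U" "\<alpha> \<in> Hom G H" "x \<in> carrier (obj P H)"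
  shows "act (quot_psh P r) G H \<alpha> (r H x) = r G (act P G H \<alpha> x)"
proof -
  define x' where "x' = inv_into (carrier (obj P H)) (r H) (r H x)"
  have x': "x' \<in> carrier (obj P H)" "r H x' = r H x"
    unfolding x'_def using assms by (auto simp: inv_into_into f_inv_into_f)
  then have "x' \<ominus>\<^bsub>obj P H\<^esub> x \<in> N H" using coset_mapD[OF r] assms by auto
  then have "act P G H \<alpha> (x' \<ominus>\<^bsub>obj P H\<^esub> x) \<in> N G" using subfunctor_act[OF N] assms by auto
  then have "act P G H \<alpha> x' \<ominus>\<^bsub>obj P G\<^esub> act P G H \<alpha> x \<in> N G"
    using module_hom_minus[OF A_of_module[OF P] A_of_module[OF P] A_of_act_hom[OF P]] assms x' by simp
  then have "r G (act P G H \<alpha> x') = r G (act P G H \<alpha> x)"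
    using coset_mapD[OF r] assms x' A_of_act_mem[OF P] by auto
  then show ?thesis by (simp add: quot_psh_def flip: x'_def)
qed

lemma quot_psh_hom: "G \<in> U \<Longrightarrow> r G \<in> module_hom k (obj P G) (obj (quot_psh P r) G)"
  unfolding obj_quot_psh by (rule push_module_hom[OF subfunctor_submodule[OF N] coset_mapD[OF r]])

lemma quot_psh_A_of: "quot_psh P r \<in> A_of k U"
proof (rule A_ofI)
  let ?Q = "quot_psh P r"
  show "module k (obj ?Q G)" if "G \<in> U" for G
    unfolding obj_quot_psh using that
    by (intro push_module_module[OF subfunctor_submodule[OF N] coset_mapD[OF r]])
  show "act ?Q G G (id_cls G) x = x" if "G \<in> U" "x \<in> carrier (obj ?Q G)" for G x
    using that quot_psh_act[OF that(1) that(1) id_cls_Hom] A_of_id[OF P] by auto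
  show "act ?Q G K (comp_cls G \<beta> \<alpha>) x = act ?Q G H \<alpha> (act ?Q H K \<beta> x)"
    if "G \<in> U" "H \<in> U" "K \<in> U" "\<alpha> \<in> Hom G H" "\<beta> \<in> Hom H K" "x \<in> carrier (obj ?Q K)" for G H K \<alpha> \<beta> x
    using that A_of_comp[OF P that(1-5)] A_of_act_mem[OF P]
    by (auto simp: quot_psh_act comp_cls_Hom_U)
  show "act ?Q G H \<alpha> \<in> module_hom k (obj ?Q H) (obj ?Q G)"
    if GH: "G \<in> U" "H \<in> U" "\<alpha> \<in> Hom G H" for G H \<alpha>
  proof (rule module_homI)
    interpret PH: module k "obj P H" using A_of_module[OF P GH(2)] .
    note hG = quot_psh_hom[OF GH(1)] and hH = quot_psh_hom[OF GH(2)] and hA = A_of_act_hom[OF P GH]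
    fix x assume "x \<in> carrier (obj ?Q H)"
    then obtain a where a: "a \<in> carrier (obj P H)" "x = r H a" by auto
    show "act ?Q G H \<alpha> x \<in> carrier (obj ?Q G)"
      using a quot_psh_act[OF GH] A_of_act_mem[OF P GH] by auto
    show "act ?Q G H \<alpha> (c \<odot>\<^bsub>obj ?Q H\<^esub> x) = c \<odot>\<^bsub>obj ?Q G\<^esub> act ?Q G H \<alpha> x"
      if c: "c \<in> carrier k" for c
      using a c quot_psh_act[OF GH] A_of_act_mem[OF P GH] module_hom_smult[OF hA c]
      by (simp flip: module_hom_smult[OF hG] module_hom_smult[OF hH])
    fix y assume "y \<in> carrier (obj ?Q H)"
    then obtain b where b: "b \<in> carrier (obj P H)" "y = r H b" by auto
    show "act ?Q G H \<alpha> (x \<oplus>\<^bsub>obj ?Q H\<^esub> y) =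
        act ?Q G H \<alpha> x \<oplus>\<^bsub>obj ?Q G\<^esub> act ?Q G H \<alpha> y"
      using a b quot_psh_act[OF GH] A_of_act_mem[OF P GH] module_hom_add[OF hA]
      by (simp flip: module_hom_add[OF hG] module_hom_add[OF hH])
  qed
qed

lemma quot_psh_nat_trans: "r \<in> nat_trans k U P (quot_psh P r)"
  by (rule nat_transI) (simp_all add: quot_psh_hom quot_psh_act)

lemma quot_psh_ker:
  "G \<in> U \<Longrightarrow> x \<in> carrier (obj P G) \<Longrightarrow> r G x = \<zero>\<^bsub>obj (quot_psh P r) G\<^esub> \<longleftrightarrow> x \<in> N G"
  unfolding obj_quot_psh by (rule push_module_ker[OF subfunctor_submodule[OF N] coset_mapD[OF r]])

end

text \<open>Coset representatives are chosen group by group. Source and target type agree, so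
  quotients of functors with values in \<open>'v\<close> have values in \<open>'v\<close> again and
  may belong to the same Serre subcategory.\<close>

lemma ex_coset_map:
  assumes "is_subfunctor k U X N"
  shows "\<exists>r. coset_map X N (r :: 'a monoid \<Rightarrow> 'v \<Rightarrow> 'v)"
proof -
  have "\<forall>G\<in>U. \<exists>r. \<forall>x\<in>carrier (obj X G). \<forall>y\<in>carrier (obj X G). (r x = (r y :: 'v)) \<longleftrightarrow> x \<ominus>\<^bsub>obj X G\<^esub> y \<in> N G"
    using submodule_coset_rep[OF subfunctor_submodule[OF assms]] by auto
  then show ?thesis unfolding coset_map_def by (rule bchoice)
qed

text \<open>An injection separates the cosets of zero. The quotient by zero along an injection is
  how a functor is copied into another value type.\<close>

lemma inj_coset_map:
  assumes P: "P \<in> A_of k U" and "\<And>G. G \<in> U \<Longrightarrow> inj_on (r G) (carrier (obj P G))"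
  shows "coset_map P (\<lambda>G. {\<zero>\<^bsub>obj P G\<^esub>}) r"
  unfolding coset_map_def using module_minus_eq_zero_iff[OF A_of_module[OF P]]
  by (auto dest: inj_onD[OF assms(2)])

section \<open>Representable functors and the Yoneda lemma\<close>

lemma comp_cls_funcset: "G \<in> U \<Longrightarrow> H \<in> U \<Longrightarrow> K \<in> U \<Longrightarrow> \<alpha> \<in> Hom K H \<Longrightarrow> (\<lambda>\<beta>. comp_cls K \<beta> \<alpha>) \<in> Hom H G \<rightarrow> Hom K G"
  using comp_cls_Hom_U by blast

lemma e_psh_simps: "obj (e_psh k G) H = free_module k (Hom H G)" "act (e_psh k G) K H \<alpha> = free_map k (\<lambda>\<beta>. comp_cls K \<beta> \<alpha>)"
  by (simp_all add: e_psh_def)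

lemma e_psh_A_of:
  assumes G: "G \<in> U" shows "e_psh k G \<in> A_of k U"
proof (rule A_ofI)
  let ?e = "e_psh k G"
  show "act ?e H H (id_cls H) x = x" if "H \<in> U" "x \<in> carrier (obj ?e H)" for H x
    using that unfolding e_psh_simps
    by (intro free_map_ident[OF cring_k, of "Hom H G"] comp_id_cls_U(1)[OF that(1) G])
  show "act ?e H L (comp_cls H \<beta> \<alpha>) x = act ?e H K \<alpha> (act ?e K L \<beta> x)"
    if "H \<in> U" "K \<in> U" "L \<in> U" "\<alpha> \<in> Hom H K" "\<beta> \<in> Hom K L" "x \<in> carrier (obj ?e L)" for H K L \<alpha> \<beta> x
    unfolding e_psh_simps
    by (rule free_map_compose[OF cring_k comp_cls_funcset comp_cls_funcset])
       (use that G in \<open>auto simp: e_psh_simps comp_cls_assoc[OF group_U group_U group_U group_U]\<close>)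
qed (simp_all add: e_psh_simps free_module_module cring_k free_map_hom comp_cls_funcset[OF G])

text \<open>The transformation out of \<open>e_psh k G\<close> that corresponds to \<open>x\<close>
  under the Yoneda lemma.\<close>

definition yoneda :: "('a, 'k, 'v) presheaf \<Rightarrow> 'a monoid \<Rightarrow> 'v \<Rightarrow> 'a monoid \<Rightarrow> (('a \<Rightarrow> 'a) set \<Rightarrow> 'k) \<Rightarrow> 'v" where
  "yoneda X G x H = lin_ext k (obj X H) (\<lambda>\<beta>. act X H G \<beta> x)"

context
  fixes X :: "('a, 'k, 'v) presheaf" and G x
  assumes X: "X \<in> A_of k U" and G: "G \<in> U" and x: "x \<in> carrier (obj X G)"
begin

lemma yoneda_hom: "H \<in> U \<Longrightarrow> yoneda X G x H \<in> module_hom k (free_module k (Hom H G)) (obj X H)"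
  unfolding yoneda_def
  by (rule lin_ext_hom[OF cring_k A_of_module[OF X]]) (auto intro: A_of_act_mem[OF X _ G _ x])

lemma yoneda_basis: "H \<in> U \<Longrightarrow> \<beta> \<in> Hom H G \<Longrightarrow> yoneda X G x H (free_basis k \<beta>) = act X H G \<beta> x"
  unfolding yoneda_def
  by (rule lin_ext_basis[OF cring_k A_of_module[OF X]]) (auto intro: A_of_act_mem[OF X _ G _ x])

text \<open>Both sides are linear in \<open>f\<close>, and on a basis vector the claim is the
  functoriality of \<open>X\<close>.\<close>

lemma yoneda_nat_trans: "yoneda X G x \<in> nat_trans k U (e_psh k G) X"
proof (rule nat_transI)
  show "yoneda X G x H \<in> module_hom k (obj (e_psh k G) H) (obj X H)" if "H \<in> U" for H
    using yoneda_hom[OF that] by (simp add: e_psh_simps)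
  fix K H \<alpha> f assume KH: "K \<in> U" "H \<in> U" "\<alpha> \<in> Hom K H" and f: "f \<in> carrier (obj (e_psh k G) H)"
  let ?c = "\<lambda>\<beta>. comp_cls K \<beta> \<alpha>"
  let ?F = "free_module k (Hom H G)"
  show "yoneda X G x K (act (e_psh k G) K H \<alpha> f) = act X K H \<alpha> (yoneda X G x H f)"
    unfolding e_psh_simps
  proof (rule free_module_hom_eqI[OF cring_k A_of_module[OF X KH(1)], where f = f])
    show "(\<lambda>f. yoneda X G x K (free_map k ?c f)) \<in> module_hom k ?F (obj X K)"
      by (rule module_hom_compose[OF free_map_hom[OF cring_k comp_cls_funcset[OF G KH(2,1,3)]] yoneda_hom[OF KH(1)]])
    show "(\<lambda>f. act X K H \<alpha> (yoneda X G x H f)) \<in> module_hom k ?F (obj X K)"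
      by (rule module_hom_compose[OF yoneda_hom[OF KH(2)] A_of_act_hom[OF X KH]])
    show "yoneda X G x K (free_map k ?c (free_basis k \<beta>)) = act X K H \<alpha> (yoneda X G x H (free_basis k \<beta>))"
      if \<beta>: "\<beta> \<in> Hom H G" for \<beta>
    proof -
      have c: "comp_cls K \<beta> \<alpha> \<in> Hom K G" using comp_cls_Hom_U[OF KH(1,2) G KH(3) \<beta>] .
      then show ?thesis
        by (simp add: free_map_basis[OF cring_k, where \<phi> = "\<lambda>\<beta>. comp_cls K \<beta> \<alpha>", OF c] yoneda_basis[OF KH(1) c] yoneda_basis[OF KH(2) \<beta>]
            A_of_comp[OF X KH(1,2) G KH(3) \<beta> x])
    qed
  qed (use f in \<open>simp add: e_psh_simps\<close>)
qed

lemma yoneda_ident: "yoneda X G x G (free_basis k (id_cls G)) = x"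
  using yoneda_basis[OF G id_cls_Hom] A_of_id[OF X G x] by simp

end

text \<open>The basis vector \<beta> is the image of the identity under the action of
  \<beta>.\<close>

lemma e_psh_generated:
  assumes G: "G \<in> U" and N: "is_subfunctor k U (e_psh k G) N" and id: "free_basis k (id_cls G) \<in> N G"
    and H: "H \<in> U" and f: "f \<in> carrier (free_module k (Hom H G))"
  shows "f \<in> N H"
proof (rule free_module_generated[OF cring_k _ _ f])
  show "submodule k (N H) (free_module k (Hom H G))"
    using subfunctor_submodule[OF N H] by (simp add: e_psh_simps)
  fix \<beta> assume \<beta>: "\<beta> \<in> Hom H G"
  have "act (e_psh k G) H G \<beta> (free_basis k (id_cls G)) \<in> N H"
    using subfunctor_act[OF N H G \<beta> id] .
  then show "free_basis k \<beta> \<in> N H"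
    by (simp add: e_psh_simps free_map_basis[OF cring_k, of _ _ "Hom H G"] comp_id_cls_U H G \<beta>)
qed

section \<open>Finite generation\<close>

text \<open>Generation is expressed through least subfunctors and not through linear combinations: a
  property holds on all of \<open>N\<close> as soon as it cuts out a subfunctor of \<open>X\<close>
  and holds on \<open>S\<close>.\<close>

definition generates :: "('a, 'k, 'v) presheaf \<Rightarrow> ('a monoid \<times> 'v) set \<Rightarrow> ('a monoid \<Rightarrow> 'v set) \<Rightarrow> bool" where
  "generates X S N \<longleftrightarrow> (\<forall>(G, x)\<in>S. G \<in> U \<and> x \<in> N G) \<and>
     (\<forall>Q. is_subfunctor k U X Q \<and> (\<forall>(G, x)\<in>S. x \<in> Q G) \<longrightarrow> (\<forall>H\<in>U. N H \<subseteq> Q H))"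

lemma generatesI:
  assumes "\<And>G x. (G, x) \<in> S \<Longrightarrow> G \<in> U \<and> x \<in> N G"
    and "\<And>Q H x. is_subfunctor k U X Q \<Longrightarrow> (\<And>G x. (G, x) \<in> S \<Longrightarrow> x \<in> Q G) \<Longrightarrow> H \<in> U \<Longrightarrow> x \<in> N H \<Longrightarrow> x \<in> Q H"
  shows "generates X S N"
proof -
  have "x \<in> Q H" if "is_subfunctor k U X Q" "\<forall>(G, x)\<in>S. x \<in> Q G" "H \<in> U" "x \<in> N H" for Q H x
    by (rule assms(2)[OF that(1) _ that(3,4)]) (use that(2) in auto)
  then show ?thesis using assms(1) unfolding generates_def by auto
qed

lemma generates_mem: "generates X S N \<Longrightarrow> (G, x) \<in> S \<Longrightarrow> G \<in> U \<and> x \<in> N G"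
  by (auto simp: generates_def)

lemma generatesD:
  assumes "generates X S N" "is_subfunctor k U X Q" "\<And>G x. (G, x) \<in> S \<Longrightarrow> x \<in> Q G" "H \<in> U" "x \<in> N H"
  shows "x \<in> Q H"
  using assms unfolding generates_def by blast

text \<open>A subfunctor of the subobject is also one of \<open>X\<close>, and a subfunctor of
  \<open>X\<close> can be intersected with \<open>N\<close>. Generators of a subobject can therefore
  be handled inside the ambient functor.\<close>

lemma generates_sub_psh:
  assumes X: "X \<in> A_of k U" and N: "is_subfunctor k U X N"
  shows "generates (sub_psh X N) S N \<longleftrightarrow> generates X S N"
proof
  assume S: "generates (sub_psh X N) S N"
  show "generates X S N"
  proof (rule generatesI)
    fix Q H x assume Q: "is_subfunctor k U X Q" "\<And>G x. (G, x) \<in> S \<Longrightarrow> x \<in> Q G" "H \<in> U" "x \<in> N H"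
    have "is_subfunctor k U (sub_psh X N) (\<lambda>G. {x \<in> carrier (obj (sub_psh X N) G). x \<in> Q G})"
      by (rule subfunctor_vimage[OF sub_psh_A_of[OF X N] sub_psh_incl[OF N] Q(1)])
    from generatesD[OF S this _ Q(3,4)] show "x \<in> Q H"
      using Q(2) generates_mem[OF S] by auto
  qed (use generates_mem[OF S] in auto)
next
  assume S: "generates X S N"
  show "generates (sub_psh X N) S N"
  proof (rule generatesI)
    fix Q H x assume Q: "is_subfunctor k U (sub_psh X N) Q" "\<And>G x. (G, x) \<in> S \<Longrightarrow> x \<in> Q G" "H \<in> U" "x \<in> N H"
    show "x \<in> Q H" by (rule generatesD[OF S subfunctor_sub_psh[OF X N Q(1)] Q(2-4)])
  qed (use generates_mem[OF S] in auto)
qed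

definition gen_sub :: "('a, 'k, 'v) presheaf \<Rightarrow> ('a monoid \<times> 'v) set \<Rightarrow> 'a monoid \<Rightarrow> 'v set" where
  "gen_sub X S H = \<Inter>{Q H | Q. is_subfunctor k U X Q \<and> (\<forall>(G, x)\<in>S. x \<in> Q G)}"

lemma gen_sub_subfunctor:
  assumes X: "X \<in> A_of k U" and S: "\<And>G x. (G, x) \<in> S \<Longrightarrow> x \<in> carrier (obj X G)"
  shows "is_subfunctor k U X (gen_sub X S)"
proof (rule subfunctorI)
  show "submodule k (gen_sub X S G) (obj X G)" if "G \<in> U" for G
    unfolding gen_sub_def
  proof (rule submodule_Inter[OF A_of_module[OF X that]])
    show "{Q G |Q. is_subfunctor k U X Q \<and> (\<forall>(G, x)\<in>S. x \<in> Q G)} \<noteq> {}"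
      using subfunctor_carrier[OF X] S by auto
  qed (use subfunctor_submodule that in auto)
qed (auto simp: gen_sub_def intro: subfunctor_act)

lemma gen_sub_least:
  assumes "is_subfunctor k U X Q" "\<And>G x. (G, x) \<in> S \<Longrightarrow> x \<in> Q G"
  shows "gen_sub X S H \<subseteq> Q H"
  using assms unfolding gen_sub_def by blast

lemma gen_sub_mem: "(G, x) \<in> S \<Longrightarrow> x \<in> gen_sub X S G"
  by (auto simp: gen_sub_def)

lemma generates_gen_sub:
  assumes "\<And>G x. (G, x) \<in> S \<Longrightarrow> G \<in> U"
  shows "generates X S (gen_sub X S)"
proof (rule generatesI)
  show "x \<in> Q H" if "is_subfunctor k U X Q" "\<And>G x. (G, x) \<in> S \<Longrightarrow> x \<in> Q G" "x \<in> gen_sub X S H" for Q H x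
    using subsetD[OF gen_sub_least[OF that(1,2)] that(3)] .
qed (simp add: assms gen_sub_mem)

section \<open>Finite direct sums of functors\<close>

lemma dsum_module_simps:
  "carrier (dsum_module n M) = (\<Pi>\<^sub>E i\<in>{..<n}. carrier (M i))"
  "\<zero>\<^bsub>dsum_module n M\<^esub> = (\<lambda>i\<in>{..<n}. \<zero>\<^bsub>M i\<^esub>)"
  "x \<oplus>\<^bsub>dsum_module n M\<^esub> y = (\<lambda>i\<in>{..<n}. x i \<oplus>\<^bsub>M i\<^esub> y i)"
  "c \<odot>\<^bsub>dsum_module n M\<^esub> x = (\<lambda>i\<in>{..<n}. c \<odot>\<^bsub>M i\<^esub> x i)"
  by (simp_all add: dsum_module_def)

lemma dsum_module_module:
  assumes M: "\<And>i. i < n \<Longrightarrow> module k (M i)"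
  shows "module k (dsum_module n M)"
proof (rule module_criteria)
  let ?D = "dsum_module n M"
  note ag = abelian_group.axioms(1)[OF module.axioms(2)[OF M]]
  note [simp] = abelian_monoid.a_closed[OF ag] abelian_monoid.zero_closed[OF ag]
    module.smult_closed[OF M] abelian_monoid.r_zero[OF ag] module.smult_one[OF M]
  show "\<forall>v\<in>carrier ?D. \<exists>w\<in>carrier ?D. v \<oplus>\<^bsub>?D\<^esub> w = \<zero>\<^bsub>?D\<^esub>"
  proof
    fix v assume v: "v \<in> carrier ?D"
    have "v i \<oplus>\<^bsub>M i\<^esub> \<ominus>\<^bsub>M i\<^esub> v i = \<zero>\<^bsub>M i\<^esub>" "\<ominus>\<^bsub>M i\<^esub> v i \<in> carrier (M i)" if "i < n" for i
      using v that abelian_group.r_neg[OF module.axioms(2)[OF M]] abelian_group.a_inv_closed[OF module.axioms(2)[OF M]]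
      by (auto simp: dsum_module_simps PiE_iff)
    then show "\<exists>w\<in>carrier ?D. v \<oplus>\<^bsub>?D\<^esub> w = \<zero>\<^bsub>?D\<^esub>"
      by (intro bexI[of _ "\<lambda>i\<in>{..<n}. \<ominus>\<^bsub>M i\<^esub> v i"]) (auto simp: dsum_module_simps PiE_iff fun_eq_iff)
  qed
  show "\<forall>v w. v \<in> carrier ?D \<and> w \<in> carrier ?D \<longrightarrow>
      v \<oplus>\<^bsub>?D\<^esub> w = w \<oplus>\<^bsub>?D\<^esub> v"
    using abelian_monoid.a_comm[OF ag] by (auto simp: dsum_module_simps PiE_iff fun_eq_iff)
  show "\<forall>v w x. v \<in> carrier ?D \<and> w \<in> carrier ?D \<and> x \<in> carrier ?D \<longrightarrow>
      v \<oplus>\<^bsub>?D\<^esub> w \<oplus>\<^bsub>?D\<^esub> x = v \<oplus>\<^bsub>?D\<^esub> (w \<oplus>\<^bsub>?D\<^esub> x)"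
    using abelian_monoid.a_assoc[OF ag] by (auto simp: dsum_module_simps PiE_iff fun_eq_iff)
qed (auto simp: cring_k dsum_module_simps PiE_iff fun_eq_iff extensional_def
    abelian_monoid.a_closed[OF abelian_group.axioms(1)[OF module.axioms(2)[OF M]]]
    abelian_monoid.zero_closed[OF abelian_group.axioms(1)[OF module.axioms(2)[OF M]]]
    abelian_monoid.r_zero[OF abelian_group.axioms(1)[OF module.axioms(2)[OF M]]]
    module.smult_closed[OF M] module.smult_one[OF M] module.smult_assoc1[OF M]
    module.smult_l_distr[OF M] module.smult_r_distr[OF M])

lemma dsum_psh_simps:
  "obj (dsum_psh n X) G = dsum_module n (\<lambda>i. obj (X i) G)"
  "act (dsum_psh n X) G H \<alpha> x = (\<lambda>i\<in>{..<n}. act (X i) G H \<alpha> (x i))"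
  by (simp_all add: dsum_psh_def)

lemma dsum_psh_A_of:
  assumes X: "\<And>i. i < n \<Longrightarrow> X i \<in> A_of k U"
  shows "dsum_psh n X \<in> A_of k U"
proof (rule A_ofI)
  let ?D = "dsum_psh n X"
  show "act ?D G H \<alpha> \<in> module_hom k (obj ?D H) (obj ?D G)"
    if GH: "G \<in> U" "H \<in> U" "\<alpha> \<in> Hom G H" for G H \<alpha>
    using A_of_act_mem[OF X GH] module_hom_add[OF A_of_act_hom[OF X GH]] module_hom_smult[OF A_of_act_hom[OF X GH]]
    by (intro module_homI) (auto simp: dsum_psh_simps dsum_module_simps PiE_iff fun_eq_iff)
  show "act ?D G G (id_cls G) x = x" if "G \<in> U" "x \<in> carrier (obj ?D G)" for G x
    using that A_of_id[OF X that(1)]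
    by (auto simp: dsum_psh_simps dsum_module_simps PiE_iff fun_eq_iff extensional_def)
  show "act ?D G K (comp_cls G \<beta> \<alpha>) x = act ?D G H \<alpha> (act ?D H K \<beta> x)"
    if "G \<in> U" "H \<in> U" "K \<in> U" "\<alpha> \<in> Hom G H" "\<beta> \<in> Hom H K" "x \<in> carrier (obj ?D K)" for G H K \<alpha> \<beta> x
    using that(6) A_of_comp[OF X that(1-5)]
    by (auto simp: dsum_psh_simps dsum_module_simps PiE_iff fun_eq_iff)
qed (auto simp: dsum_psh_simps intro!: dsum_module_module A_of_module[OF X])

definition dsum_inj :: "nat \<Rightarrow> (nat \<Rightarrow> ('a, 'k, 'v) presheaf) \<Rightarrow> nat \<Rightarrow> 'a monoid \<Rightarrow> 'v \<Rightarrow> nat \<Rightarrow> 'v" where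
  "dsum_inj n X i H x = (\<lambda>j\<in>{..<n}. if j = i then x else \<zero>\<^bsub>obj (X j) H\<^esub>)"

lemma dsum_inj_nat_trans:
  assumes X: "\<And>i. i < n \<Longrightarrow> X i \<in> A_of k U" and i: "i < n"
  shows "dsum_inj n X i \<in> nat_trans k U (X i) (dsum_psh n X)"
proof (rule nat_transI)
  let ?D = "dsum_psh n X"
  show "dsum_inj n X i G \<in> module_hom k (obj (X i) G) (obj ?D G)" if G: "G \<in> U" for G
  proof -
    note M = A_of_module[OF X G]
    note ag = abelian_group.axioms(1)[OF module.axioms(2)[OF M]]
    show ?thesis
      using i abelian_monoid.r_zero[OF ag] abelian_monoid.zero_closed[OF ag] module.smult_r_null[OF M]
      by (intro module_homI) (auto simp: dsum_psh_simps dsum_module_simps dsum_inj_def PiE_iff fun_eq_iff)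
  qed
  show "dsum_inj n X i G (act (X i) G H \<alpha> x) = act ?D G H \<alpha> (dsum_inj n X i H x)"
    if GH: "G \<in> U" "H \<in> U" "\<alpha> \<in> Hom G H" and "x \<in> carrier (obj (X i) H)" for G H \<alpha> x
    using module_hom_zero[OF A_of_module[OF X GH(2)] A_of_module[OF X GH(1)] A_of_act_hom[OF X GH]]
    by (auto simp: dsum_psh_simps dsum_inj_def fun_eq_iff)
qed

text \<open>The generators are the images of the identities of the groups \<open>G i\<close>. If a
  subfunctor \<open>Q\<close> contains them, its preimage in each summand is a subfunctor that
  contains the identity, hence the whole summand.\<close>

lemma fin_gen_imp_generates:
  assumes X: "X \<in> A_of k U" and fg: "fin_gen k U X"
  shows "\<exists>S. finite S \<and> generates X S (\<lambda>G. carrier (obj X G))"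
proof -
  obtain n G \<eta> where G: "\<And>i. i < n \<Longrightarrow> G i \<in> U" and \<eta>: "\<eta> \<in> psh_epi k U (dsum_psh n (\<lambda>i. e_psh k (G i))) X"
    using fg unfolding fin_gen_def by blast
  let ?D = "dsum_psh n (\<lambda>i. e_psh k (G i))" and ?e = "\<lambda>i. e_psh k (G i)"
  have nt: "\<eta> \<in> nat_trans k U ?D X" and sur: "\<And>H. H \<in> U \<Longrightarrow> \<eta> H ` carrier (obj ?D H) = carrier (obj X H)"
    using \<eta> by (auto simp: psh_epi_def)
  have eA: "\<And>i. i < n \<Longrightarrow> ?e i \<in> A_of k U" using e_psh_A_of G by blast
  have DA: "?D \<in> A_of k U" by (rule dsum_psh_A_of[OF eA])
  have inj: "(\<lambda>H f. \<eta> H (dsum_inj n ?e i H f)) \<in> nat_trans k U (?e i) X" if "i < n" for i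
    by (rule nat_trans_compose[OF dsum_inj_nat_trans[OF eA that] nt])
  define g where "g = (\<lambda>i. (G i, \<eta> (G i) (dsum_inj n ?e i (G i) (free_basis k (id_cls (G i))))))"
  have "generates X (g ` {..<n}) (\<lambda>G. carrier (obj X G))"
  proof (rule generatesI)
    fix H x assume "(H, x) \<in> g ` {..<n}"
    then obtain i where i: "i < n" "H = G i" "x = \<eta> (G i) (dsum_inj n ?e i (G i) (free_basis k (id_cls (G i))))"
      by (auto simp: g_def)
    show "H \<in> U \<and> x \<in> carrier (obj X H)"
      unfolding i(2,3) using nat_trans_mem[OF inj[OF i(1)] G[OF i(1)]] G[OF i(1)]
      by (simp add: e_psh_simps free_basis_mem[OF cring_k id_cls_Hom])
  next
    fix Q H x assume Q: "is_subfunctor k U X Q" and S: "\<And>H x. (H, x) \<in> g ` {..<n} \<Longrightarrow> x \<in> Q H"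
      and H: "H \<in> U" and x: "x \<in> carrier (obj X H)"
    interpret Q: submodule k "Q H" "obj X H" by (rule subfunctor_submodule[OF Q H])
    have *: "\<eta> H (dsum_inj n ?e i H f) \<in> Q H" if i: "i < n" and f: "f \<in> carrier (obj (?e i) H)" for i f
    proof -
      have "is_subfunctor k U (?e i) (\<lambda>H. {f \<in> carrier (obj (?e i) H). \<eta> H (dsum_inj n ?e i H f) \<in> Q H})"
        by (rule subfunctor_vimage[OF eA[OF i] inj[OF i] Q])
      from e_psh_generated[OF G[OF i] this _ H, of f] show ?thesis
        using S[of "G i"] f i by (auto simp: g_def e_psh_simps free_basis_mem[OF cring_k id_cls_Hom])
    qed
    obtain u where u: "u \<in> carrier (obj ?D H)" "x = \<eta> H u" using sur[OF H] x by auto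
    then have ui: "u i \<in> carrier (obj (?e i) H)" if "i < n" for i
      using that by (auto simp: dsum_psh_simps dsum_module_simps)
    \<comment> \<open>\<open>t j\<close> keeps the first \<open>j\<close> coordinates of
      \<open>u\<close>, so that each step adds a single injected coordinate and the induction needs
      binary sums only.\<close>
    define t where "t = (\<lambda>j. \<lambda>i\<in>{..<n}. if i < j then u i else \<zero>\<^bsub>obj (?e i) H\<^esub>)"
    note em = A_of_module[OF eA H]
    note ag = abelian_group.axioms(1)[OF module.axioms(2)[OF em]]
    have tc: "t j \<in> carrier (obj ?D H)" for j
      using ui abelian_monoid.zero_closed[OF ag] by (auto simp: t_def dsum_psh_simps dsum_module_simps)
    have "\<eta> H (t j) \<in> Q H" if "j \<le> n" for j
      using that
    proof (induction j)
      case 0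
      have "t 0 = \<zero>\<^bsub>obj ?D H\<^esub>" by (auto simp: t_def dsum_psh_simps dsum_module_simps)
      then show ?case using nat_trans_zero[OF DA X nt H] by simp
    next
      case (Suc j)
      then have j: "j < n" by simp
      have "t (Suc j) = t j \<oplus>\<^bsub>obj ?D H\<^esub> dsum_inj n ?e j H (u j)"
      proof
        fix i
        show "t (Suc j) i = (t j \<oplus>\<^bsub>obj ?D H\<^esub> dsum_inj n ?e j H (u j)) i"
          using ui[of i] abelian_monoid.r_zero[OF ag, of i] abelian_monoid.l_zero[OF ag, of i]
            abelian_monoid.zero_closed[OF ag, of i] 
          by (cases "i < n"; cases "i = j"; cases "i < j") (simp_all add: t_def dsum_psh_simps dsum_module_simps dsum_inj_def del: free_module_simps)
      qed
      then have "\<eta> H (t (Suc j)) = \<eta> H (t j) \<oplus>\<^bsub>obj X H\<^esub> \<eta> H (dsum_inj n ?e j H (u j))"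
        using module_hom_add[OF nat_trans_hom[OF nt H] tc nat_trans_mem[OF dsum_inj_nat_trans[where X = ?e, OF eA j] H ui[OF j]]]
        by simp
      then show ?case using Suc *[OF j ui[OF j]] by simp
    qed
    moreover have "t n = u" using u(1) by (auto simp: t_def dsum_psh_simps dsum_module_simps PiE_iff extensional_def)
    ultimately show "x \<in> Q H" using u(2) by (metis order_refl)
  qed
  then show ?thesis by blast
qed

text \<open>The Yoneda maps of the generators add up to a map from the direct sum of representables.
  Its image is a subfunctor that contains all generators, hence everything.\<close>

lemma generates_imp_fin_gen:
  assumes X: "X \<in> A_of k U" and S: "generates X S (\<lambda>G. carrier (obj X G))" and fin: "finite S"
  shows "fin_gen k U X"
proof -
  obtain n and s :: "nat \<Rightarrow> _" where s: "S = s ` {i. i < n}"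
    using fin by (auto simp: finite_conv_nat_seg_image)
  define G where "G = (\<lambda>i. fst (s i))"
  define x where "x = (\<lambda>i. snd (s i))"
  have Gx: "G i \<in> U" "x i \<in> carrier (obj X (G i))" if "i < n" for i
    using generates_mem[OF S, of "G i" "x i"] that by (auto simp: s G_def x_def)
  let ?e = "\<lambda>i. e_psh k (G i)"
  let ?D = "dsum_psh n ?e"
  have DA: "?D \<in> A_of k U" by (rule dsum_psh_A_of[OF e_psh_A_of[OF Gx(1)]])
  define y where "y = (\<lambda>i. yoneda X (G i) (x i))"
  have y: "y i \<in> nat_trans k U (?e i) X" if "i < n" for i
    unfolding y_def by (rule yoneda_nat_trans[OF X Gx[OF that]])
  define \<eta> where "\<eta> = (\<lambda>H u. \<Oplus>\<^bsub>obj X H\<^esub>i\<in>{..<n}. y i H (u i))"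
  have ui: "u i \<in> carrier (obj (?e i) H)" if "u \<in> carrier (obj ?D H)" "i < n" for u i H
    using that by (auto simp: dsum_psh_simps dsum_module_simps)
  have yc: "(\<lambda>i. y i H (u i)) \<in> {..<n} \<rightarrow> carrier (obj X H)" if "H \<in> U" "u \<in> carrier (obj ?D H)" for H u
    using nat_trans_mem[OF y that(1) ui[OF that(2)]] by auto
  have nt: "\<eta> \<in> nat_trans k U ?D X"
  proof (rule nat_transI)
    fix H assume H: "H \<in> U"
    interpret M: module k "obj X H" by (rule A_of_module[OF X H])
    show "\<eta> H \<in> module_hom k (obj ?D H) (obj X H)"
    proof (rule module_homI)
      fix u assume u: "u \<in> carrier (obj ?D H)"
      show "\<eta> H u \<in> carrier (obj X H)"
        unfolding \<eta>_def by (rule M.M.finsum_closed[OF yc[OF H u]])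
      show "\<eta> H (u \<oplus>\<^bsub>obj ?D H\<^esub> v) = \<eta> H u \<oplus>\<^bsub>obj X H\<^esub> \<eta> H v" if v: "v \<in> carrier (obj ?D H)" for v
      proof -
        have "\<eta> H (u \<oplus>\<^bsub>obj ?D H\<^esub> v) = (\<Oplus>\<^bsub>obj X H\<^esub>i\<in>{..<n}. y i H (u i) \<oplus>\<^bsub>obj X H\<^esub> y i H (v i))"
          unfolding \<eta>_def
        proof (rule M.M.add.finprod_cong')
          show "(\<lambda>i. y i H (u i) \<oplus>\<^bsub>obj X H\<^esub> y i H (v i)) \<in> {..<n} \<rightarrow> carrier (obj X H)"
            by (intro funcsetI M.M.a_closed funcset_mem[OF yc[OF H u]] funcset_mem[OF yc[OF H v]])
          show "y i H ((u \<oplus>\<^bsub>obj ?D H\<^esub> v) i) = y i H (u i) \<oplus>\<^bsub>obj X H\<^esub> y i H (v i)" if "i \<in> {..<n}" for i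
            using that module_hom_add[OF nat_trans_hom[OF y H] ui[OF u] ui[OF v]]
            by (simp add: dsum_psh_simps dsum_module_simps)
        qed simp
        then show ?thesis unfolding \<eta>_def using M.M.finsum_addf[OF yc[OF H u] yc[OF H v]] by simp
      qed
      show "\<eta> H (c \<odot>\<^bsub>obj ?D H\<^esub> u) = c \<odot>\<^bsub>obj X H\<^esub> \<eta> H u" if c: "c \<in> carrier k" for c
      proof -
        have "\<eta> H (c \<odot>\<^bsub>obj ?D H\<^esub> u) = (\<Oplus>\<^bsub>obj X H\<^esub>i\<in>{..<n}. c \<odot>\<^bsub>obj X H\<^esub> y i H (u i))"
          unfolding \<eta>_def
        proof (rule M.M.add.finprod_cong')
          show "(\<lambda>i. c \<odot>\<^bsub>obj X H\<^esub> y i H (u i)) \<in> {..<n} \<rightarrow> carrier (obj X H)"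
            by (intro funcsetI M.smult_closed[OF c] funcset_mem[OF yc[OF H u]])
          show "y i H ((c \<odot>\<^bsub>obj ?D H\<^esub> u) i) = c \<odot>\<^bsub>obj X H\<^esub> y i H (u i)" if "i \<in> {..<n}" for i
            using that module_hom_smult[OF nat_trans_hom[OF y H] c ui[OF u]]
            by (simp add: dsum_psh_simps dsum_module_simps)
        qed simp
        then show ?thesis unfolding \<eta>_def using M.finsum_smult_ldistr[OF _ c yc[OF H u]] by simp
      qed
    qed
    fix K \<alpha> u assume K: "K \<in> U" "\<alpha> \<in> Hom K H" and u: "u \<in> carrier (obj ?D H)"
    have "act X K H \<alpha> (\<eta> H u) = (\<Oplus>\<^bsub>obj X K\<^esub>i\<in>{..<n}. act X K H \<alpha> (y i H (u i)))"
      unfolding \<eta>_def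
      by (rule module_hom_finsum[OF A_of_module[OF X H] A_of_module[OF X K(1)] A_of_act_hom[OF X K(1) H K(2)] _ yc[OF H u]]) simp
    also have "\<dots> = \<eta> K (act ?D K H \<alpha> u)"
      unfolding \<eta>_def
    proof (rule abelian_monoid.finsum_cong')
      show "abelian_monoid (obj X K)" using A_of_module[OF X K(1)] by (simp add: module_def abelian_group_def)
      show "(\<lambda>i. y i K (act ?D K H \<alpha> u i)) \<in> {..<n} \<rightarrow> carrier (obj X K)"
        by (rule yc[OF K(1) A_of_act_mem[OF DA K(1) H K(2) u]])
      show "act X K H \<alpha> (y i H (u i)) = y i K (act ?D K H \<alpha> u i)" if "i \<in> {..<n}" for i
        using that nat_trans_act[OF y K(1) H K(2) ui[OF u]] by (simp add: dsum_psh_simps)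
    qed simp
    finally show "\<eta> K (act ?D K H \<alpha> u) = act X K H \<alpha> (\<eta> H u)" ..
  qed
  have im: "is_subfunctor k U X (\<lambda>H. \<eta> H ` carrier (obj ?D H))"
    by (rule subfunctor_image[OF X nt subfunctor_carrier[OF DA]])
  have xi: "x i \<in> \<eta> (G i) ` carrier (obj ?D (G i))" if i: "i < n" for i
  proof
    interpret M: module k "obj X (G i)" by (rule A_of_module[OF X Gx(1)[OF i]])
    let ?u = "dsum_inj n ?e i (G i) (free_basis k (id_cls (G i)))"
    show u: "?u \<in> carrier (obj ?D (G i))"
      using nat_trans_mem[OF dsum_inj_nat_trans[where X = ?e, OF e_psh_A_of[OF Gx(1)] i] Gx(1)[OF i]]
      by (simp add: e_psh_simps free_basis_mem[OF cring_k id_cls_Hom])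
    \<comment> \<open>The other coordinates of \<open>?u\<close> are zero and contribute nothing;
      the \<open>i\<close>-th is the identity, which the Yoneda map sends to
      \<open>x i\<close>.\<close>
    have "\<eta> (G i) ?u = (\<Oplus>\<^bsub>obj X (G i)\<^esub>j\<in>{..<n}. if i = j then x i else \<zero>\<^bsub>obj X (G i)\<^esub>)"
      unfolding \<eta>_def
    proof (rule M.M.add.finprod_cong')
      show "(\<lambda>j. if i = j then x i else \<zero>\<^bsub>obj X (G i)\<^esub>) \<in> {..<n} \<rightarrow> carrier (obj X (G i))"
        using Gx[OF i] by auto
      show "y j (G i) (?u j) = (if i = j then x i else \<zero>\<^bsub>obj X (G i)\<^esub>)" if "j \<in> {..<n}" for j
      proof (cases "i = j")
        case True
        then show ?thesis using that yoneda_ident[OF X Gx[of i]] by (simp add: dsum_inj_def y_def)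
      next
        case False
        then show ?thesis
          using that nat_trans_zero[OF e_psh_A_of[OF Gx(1)] X y Gx(1)[OF i], of j] by (simp add: dsum_inj_def)
      qed
    qed simp
    also have "\<dots> = x i"
      by (rule M.M.add.finprod_singleton[of i "{..<n}" "\<lambda>_. x i"]) (use i Gx in auto)
    finally show "x i = \<eta> (G i) ?u" ..
  qed
  have "z \<in> \<eta> H ` carrier (obj ?D H)" if Hz: "(H, z) \<in> S" for H z
  proof -
    obtain i where "i < n" "(H, z) = s i" using Hz unfolding s by blast
    then show ?thesis using xi[of i] by (metis G_def x_def fst_conv snd_conv)
  qed
  then have "carrier (obj X H) \<subseteq> \<eta> H ` carrier (obj ?D H)" if "H \<in> U" for H
    using generatesD[OF S im _ that] by blast
  then have "\<eta> \<in> psh_epi k U ?D X"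
    using nt nat_trans_mem[OF nt] unfolding psh_epi_def by blast
  then show ?thesis unfolding fin_gen_def using Gx(1) by blast
qed

lemma fin_gen_iff_generates:
  "X \<in> A_of k U \<Longrightarrow> fin_gen k U X \<longleftrightarrow> (\<exists>S. finite S \<and> generates X S (\<lambda>G. carrier (obj X G)))"
  using fin_gen_imp_generates generates_imp_fin_gen by blast

lemma fin_gen_sub_psh_iff:
  assumes "X \<in> A_of k U" "is_subfunctor k U X N"
  shows "fin_gen k U (sub_psh X N) \<longleftrightarrow> (\<exists>S. finite S \<and> generates X S N)"
  by (simp add: fin_gen_iff_generates[OF sub_psh_A_of[OF assms]] generates_sub_psh[OF assms])

lemma fin_gen_e_psh:
  assumes G: "G \<in> U" shows "fin_gen k U (e_psh k G)"
proof -
  have "generates (e_psh k G) {(G, free_basis k (id_cls G))} (\<lambda>H. carrier (obj (e_psh k G) H))"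
  proof (rule generatesI)
    fix Q H x assume "is_subfunctor k U (e_psh k G) Q"
      "\<And>H x. (H, x) \<in> {(G, free_basis k (id_cls G))} \<Longrightarrow> x \<in> Q H" "H \<in> U" "x \<in> carrier (obj (e_psh k G) H)"
    then show "x \<in> Q H" using e_psh_generated[OF G] by (simp add: e_psh_simps)
  qed (simp add: e_psh_simps G free_basis_mem[OF cring_k id_cls_Hom])
  then show ?thesis using generates_imp_fin_gen[OF e_psh_A_of[OF G]] by blast
qed

lemma fin_gen_epi:
  assumes X: "fin_gen k U X" and \<eta>: "\<eta> \<in> psh_epi k U X Y"
  shows "fin_gen k U Y"
proof -
  obtain n G \<theta> where G: "\<forall>i<n. G i \<in> U" and \<theta>: "\<theta> \<in> psh_epi k U (dsum_psh n (\<lambda>i. e_psh k (G i))) X"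
    using X unfolding fin_gen_def by blast
  have "(\<lambda>G x. \<eta> G (\<theta> G x)) \<in> psh_epi k U (dsum_psh n (\<lambda>i. e_psh k (G i))) Y"
    using nat_trans_compose \<eta> \<theta> unfolding psh_epi_def by (force simp flip: image_image)
  then show ?thesis using G unfolding fin_gen_def by blast
qed

end

section \<open>Noetherianity and Serre subcategories\<close>

lemma module_add_minus_cancel:
  assumes "module k M" "a \<in> carrier M" "y \<in> carrier M"
  shows "(a \<oplus>\<^bsub>M\<^esub> y) \<ominus>\<^bsub>M\<^esub> a = y"
proof -
  interpret module k M by fact
  have "(a \<oplus>\<^bsub>M\<^esub> y) \<ominus>\<^bsub>M\<^esub> a = y \<oplus>\<^bsub>M\<^esub> (a \<oplus>\<^bsub>M\<^esub> \<ominus>\<^bsub>M\<^esub> a)"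
    using assms(2,3) by (simp only: a_minus_def M.a_comm[of a y] M.a_assoc M.a_inv_closed)
  then show ?thesis using assms(2,3) by (simp add: M.r_neg)
qed

context presheaves
begin

text \<open>\<open>noetherian\<close> speaks of subobjects of representables only; this extends it
  to finitely generated functors. Adding one generator \<open>x\<close> to the subfunctor
  \<open>A\<close> generated by the others, the part of \<open>N\<close> inside \<open>A\<close> is
  covered by induction, and \<open>N\<close> modulo \<open>A\<close> is governed by a subobject of
  \<open>e_psh k G\<close>. Claiming the result for all subfunctors below \<open>gen_sub X S\<close>
  keeps \<open>X\<close> fixed during the induction.\<close>

lemma generated_subfunctor_noetherian:
  assumes noeth: "noetherian k U" and X: "X \<in> A_of k U" and "finite S"
    and "\<And>G x. (G, x) \<in> S \<Longrightarrow> G \<in> U \<and> x \<in> carrier (obj X G)"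
    and "is_subfunctor k U X N" and "\<And>H. H \<in> U \<Longrightarrow> N H \<subseteq> gen_sub X S H"
  shows "\<exists>T. finite T \<and> generates X T N"
  using assms(3-)
proof (induction S arbitrary: N)
  case empty
  have "gen_sub X {} H \<subseteq> {\<zero>\<^bsub>obj X H\<^esub>}" for H
    by (rule gen_sub_least[OF subfunctor_zero[OF X]]) simp
  then have N: "N H \<subseteq> {\<zero>\<^bsub>obj X H\<^esub>}" if "H \<in> U" for H using empty(3)[OF that] by blast
  have "generates X {} N"
  proof (rule generatesI)
    fix Q H x assume "is_subfunctor k U X Q" "H \<in> U" "x \<in> N H"
    then show "x \<in> Q H"
      using N submodule.zero_closed[OF subfunctor_submodule] by blast
  qed simp
  then show ?case by blast
next
  case (insert p S)
  obtain G x where p: "p = (G, x)" by (cases p)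
  let ?e = "e_psh k G"
  have G: "G \<in> U" and x: "x \<in> carrier (obj X G)" using insert.prems(1) p by auto
  have S: "(H, z) \<in> S \<Longrightarrow> H \<in> U \<and> z \<in> carrier (obj X H)" for H z using insert.prems(1) by auto
  note N = insert.prems(2)
  define A where "A = gen_sub X S"
  have A: "is_subfunctor k U X A" unfolding A_def by (rule gen_sub_subfunctor[OF X]) (use S in blast)
  define y where "y = yoneda X G x"
  have y: "y \<in> nat_trans k U ?e X" unfolding y_def by (rule yoneda_nat_trans[OF X G x])
  note eA = e_psh_A_of[OF G]
  define R where "R = (\<lambda>H. {a \<oplus>\<^bsub>obj X H\<^esub> b | a b. a \<in> A H \<and> b \<in> y H ` carrier (obj ?e H)})"
  have R: "is_subfunctor k U X R"
    unfolding R_def by (rule subfunctor_plus[OF X A subfunctor_image[OF X y subfunctor_carrier[OF eA]]])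
  have NR: "N H \<subseteq> R H" if "H \<in> U" for H
  proof -
    have "z \<in> R K" if z: "(K, z) \<in> insert p S" for K z
    proof -
      have K: "K \<in> U" and zc: "z \<in> carrier (obj X K)" using insert.prems(1)[OF z] by auto
      interpret M: module k "obj X K" by (rule A_of_module[OF X K])
      show ?thesis
      proof (cases "(K, z) = p")
        case True
        have "y K (free_basis k (id_cls G)) = z"
          using True p yoneda_ident[OF X G x] by (simp add: y_def)
        then have "z = \<zero>\<^bsub>obj X K\<^esub> \<oplus>\<^bsub>obj X K\<^esub> y K (free_basis k (id_cls G))"
          using M.M.l_zero[OF zc] by simp
        moreover have "\<zero>\<^bsub>obj X K\<^esub> \<in> A K" using submodule.zero_closed[OF subfunctor_submodule[OF A K]] .
        moreover have "free_basis k (id_cls G) \<in> carrier (obj ?e K)"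
          using True p free_basis_mem[OF cring_k id_cls_Hom] by (simp add: e_psh_simps)
        ultimately show ?thesis unfolding R_def by blast
      next
        case False
        then have "z \<in> A K" using z by (auto simp: A_def gen_sub_mem)
        moreover have "z = z \<oplus>\<^bsub>obj X K\<^esub> y K \<zero>\<^bsub>obj ?e K\<^esub>"
          using nat_trans_zero[OF eA X y K] zc by simp
        moreover have "\<zero>\<^bsub>obj ?e K\<^esub> \<in> carrier (obj ?e K)"
          using submodule.zero_closed[OF subfunctor_submodule[OF subfunctor_carrier[OF eA] K]] .
        ultimately show ?thesis unfolding R_def by blast
      qed
    qed
    then have "gen_sub X (insert p S) H \<subseteq> R H" by (rule gen_sub_least[OF R])
    then show ?thesis using insert.prems(3)[OF that] by blast
  qed
  \<comment> \<open>The preimage of \<open>N + A\<close> under the Yoneda map of \<open>x\<close>.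
    Since \<open>N\<close> lies in \<open>R\<close>, it maps onto \<open>N\<close> modulo
    \<open>A\<close>, and as a subobject of a representable it is finitely generated.\<close>
  define P where "P = (\<lambda>H. {f \<in> carrier (obj ?e H). y H f \<in> {n \<oplus>\<^bsub>obj X H\<^esub> a | n a. n \<in> N H \<and> a \<in> A H}})"
  have P: "is_subfunctor k U ?e P"
    unfolding P_def by (rule subfunctor_vimage[OF eA y subfunctor_plus[OF X N A]])
  then have "fin_gen k U (sub_psh ?e P)" using noeth G by (simp add: noetherian_def)
  then obtain T1 where T1: "finite T1" "generates ?e T1 P"
    using fin_gen_sub_psh_iff[OF eA P] by blast
  have NA: "is_subfunctor k U X (\<lambda>H. N H \<inter> A H)" by (rule subfunctor_Int[OF N A])
  obtain T2 where T2: "finite T2" "generates X T2 (\<lambda>H. N H \<inter> A H)"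
    using insert.IH[OF S NA] unfolding A_def by blast
  \<comment> \<open>Each generator of \<open>P\<close> is sent to \<open>N + A\<close>, and the
    summand in \<open>N\<close> is kept. These elements, together with the generators
    \<open>T2\<close> of the intersection of \<open>N\<close> and \<open>A\<close>, are going to
    generate \<open>N\<close>.\<close>
  have "\<forall>q\<in>T1. \<exists>m. m \<in> N (fst q) \<and> (\<exists>a\<in>A (fst q). y (fst q) (snd q) = m \<oplus>\<^bsub>obj X (fst q)\<^esub> a)"
  proof
    fix q assume "q \<in> T1"
    then have "snd q \<in> P (fst q)" using generates_mem[OF T1(2), of "fst q" "snd q"] by simp
    then show "\<exists>m. m \<in> N (fst q) \<and> (\<exists>a\<in>A (fst q). y (fst q) (snd q) = m \<oplus>\<^bsub>obj X (fst q)\<^esub> a)"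
      unfolding P_def by blast
  qed
  then obtain m where m: "\<And>q. q \<in> T1 \<Longrightarrow> m q \<in> N (fst q) \<and> (\<exists>a\<in>A (fst q). y (fst q) (snd q) = m q \<oplus>\<^bsub>obj X (fst q)\<^esub> a)"
    by metis
  let ?T = "T2 \<union> (\<lambda>q. (fst q, m q)) ` T1"
  have "generates X ?T N"
  proof (rule generatesI)
    show "H \<in> U \<and> z \<in> N H" if "(H, z) \<in> ?T" for H z
      using that m generates_mem[OF T2(2), of H z] generates_mem[OF T1(2)] by auto
  next
    fix Q H v assume Q: "is_subfunctor k U X Q" and TQ: "\<And>H z. (H, z) \<in> ?T \<Longrightarrow> z \<in> Q H"
      and H: "H \<in> U" and v: "v \<in> N H"
    interpret M: module k "obj X H" by (rule A_of_module[OF X H])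
    interpret A: submodule k "A H" "obj X H" by (rule subfunctor_submodule[OF A H])
    interpret Q: submodule k "Q H" "obj X H" by (rule subfunctor_submodule[OF Q H])
    \<comment> \<open>The intersection with \<open>N\<close> makes the remainder
      \<open>a \<oplus> a'\<close> below a difference of two elements of \<open>N\<close>. It thus
      lies in both \<open>N\<close> and \<open>A\<close>, where \<open>T2\<close> generates.\<close>
    define Q' where "Q' = (\<lambda>H. Q H \<inter> N H)"
    have Q': "is_subfunctor k U X Q'" unfolding Q'_def by (rule subfunctor_Int[OF Q N])
    define P' where "P' = (\<lambda>H. {f \<in> carrier (obj ?e H). y H f \<in> {n \<oplus>\<^bsub>obj X H\<^esub> a | n a. n \<in> Q' H \<and> a \<in> A H}})"
    have P': "is_subfunctor k U ?e P'"
      unfolding P'_def by (rule subfunctor_vimage[OF eA y subfunctor_plus[OF X Q' A]])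
    have T1P': "f \<in> P' K" if "(K, f) \<in> T1" for K f
    proof -
      have "m (K, f) \<in> Q' K" using m[OF that] TQ[of K "m (K, f)"] that by (force simp: Q'_def)
      moreover have "f \<in> carrier (obj ?e K)"
        using generates_mem[OF T1(2) that] by (simp add: P_def)
      ultimately show ?thesis using m[OF that] unfolding P'_def by auto
    qed
    obtain a f where a: "a \<in> A H" and f: "f \<in> carrier (obj ?e H)" and vaf: "v = a \<oplus>\<^bsub>obj X H\<^esub> y H f"
      using NR[OF H] v unfolding R_def by blast
    have c: "v \<in> carrier (obj X H)" "a \<in> carrier (obj X H)" "y H f \<in> carrier (obj X H)"
      using subfunctor_mem[OF N H v] a A.subset nat_trans_mem[OF y H f] by auto
    have "\<ominus>\<^bsub>obj X H\<^esub> a \<in> A H"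
      using submodule_minus[OF A.submodule_axioms A.zero_closed a] c by (simp add: a_minus_def)
    moreover have "y H f = v \<oplus>\<^bsub>obj X H\<^esub> \<ominus>\<^bsub>obj X H\<^esub> a"
      using module_add_minus_cancel[OF M.module_axioms c(2,3)] by (simp add: vaf a_minus_def)
    ultimately have fP: "f \<in> P H" using v f unfolding P_def by blast
    have "f \<in> P' H" by (rule generatesD[OF T1(2) P' _ H fP]) (rule T1P')
    then obtain q a' where q: "q \<in> Q' H" "a' \<in> A H" "y H f = q \<oplus>\<^bsub>obj X H\<^esub> a'"
      unfolding P'_def by blast
    have c': "q \<in> carrier (obj X H)" "a' \<in> carrier (obj X H)"
      using subfunctor_mem[OF Q' H q(1)] q(2) A.subset by auto
    have vq: "v = q \<oplus>\<^bsub>obj X H\<^esub> (a \<oplus>\<^bsub>obj X H\<^esub> a')" using c c' by (simp add: vaf q(3) M.M.a_ac)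
    then have "a \<oplus>\<^bsub>obj X H\<^esub> a' = v \<ominus>\<^bsub>obj X H\<^esub> q"
      using module_add_minus_cancel[OF M.module_axioms c'(1)] c c' by simp
    moreover have "v \<ominus>\<^bsub>obj X H\<^esub> q \<in> N H"
      using submodule_minus[OF subfunctor_submodule[OF N H] v] q(1) by (simp add: Q'_def)
    ultimately have NAa: "a \<oplus>\<^bsub>obj X H\<^esub> a' \<in> N H \<inter> A H"
      using A.m_closed[OF a q(2)] by simp
    have "a \<oplus>\<^bsub>obj X H\<^esub> a' \<in> Q H"
      by (rule generatesD[OF T2(2) Q _ H NAa]) (use TQ in blast)
    then show "v \<in> Q H" using q(1) by (simp add: vq Q'_def)
  qed
  then show ?case using T1(1) T2(1) by (meson finite_UnI finite_imageI)
qed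

lemma subfunctor_fin_gen:
  assumes noeth: "noetherian k U" and X: "X \<in> Ac_of k U" and N: "is_subfunctor k U X N"
  shows "\<exists>T. finite T \<and> generates X T N"
proof -
  have XA: "X \<in> A_of k U" and fg: "fin_gen k U X" using X by (auto simp: Ac_of_def)
  obtain S where S: "finite S" "generates X S (\<lambda>G. carrier (obj X G))"
    using fin_gen_imp_generates[OF XA fg] by blast
  have mem: "G \<in> U \<and> x \<in> carrier (obj X G)" if "(G, x) \<in> S" for G x
    using generates_mem[OF S(2) that] by simp
  have gs: "is_subfunctor k U X (gen_sub X S)"
    by (rule gen_sub_subfunctor[OF XA]) (use mem in blast)
  have "N H \<subseteq> gen_sub X S H" if "H \<in> U" for H
    using generatesD[OF S(2) gs gen_sub_mem that] subfunctor_mem[OF N that] by blast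
  then show ?thesis using generated_subfunctor_noetherian[OF noeth XA S(1) mem N] by blast
qed

lemma sub_psh_Ac:
  assumes "noetherian k U" "X \<in> Ac_of k U" "is_subfunctor k U X N"
  shows "sub_psh X N \<in> Ac_of k U"
  using assms subfunctor_fin_gen[OF assms] fin_gen_sub_psh_iff sub_psh_A_of by (auto simp: Ac_of_def)

lemma epi_Ac:
  assumes "X \<in> Ac_of k U" "Y \<in> A_of k U" "\<eta> \<in> psh_epi k U X Y"
  shows "Y \<in> Ac_of k U"
  using assms fin_gen_epi by (auto simp: Ac_of_def)

section \<open>Closure properties of Serre subcategories\<close>

lemma quot_psh_epi:
  assumes "P \<in> A_of k U" "is_subfunctor k U P N" "coset_map P N r"
  shows "r \<in> psh_epi k U P (quot_psh P r)"
  using quot_psh_nat_trans[OF assms] by (simp add: psh_epi_def)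

text \<open>The Serre condition only concerns exact sequences of finitely generated objects;
  noetherianity puts the subobject among them.\<close>

lemma serre_sub_quot:
  assumes D: "serre_subcat k U D" and noeth: "noetherian k U" and X: "X \<in> Ac_of k U"
    and N: "is_subfunctor k U X N" and r: "coset_map X N r"
  shows "X \<in> D \<longleftrightarrow> sub_psh X N \<in> D \<and> quot_psh X r \<in> D"
proof -
  have XA: "X \<in> A_of k U" using X by (simp add: Ac_of_def)
  have Q: "quot_psh X r \<in> Ac_of k U"
    by (rule epi_Ac[OF X quot_psh_A_of[OF XA N r] quot_psh_epi[OF XA N r]])
  have "short_exact k U (sub_psh X N) X (quot_psh X r)"
    unfolding short_exact_def
  proof (intro bexI ballI conjI)
    fix G assume G: "G \<in> U"
    show "(\<lambda>_ x. x) G ` carrier (obj (sub_psh X N) G) = {x \<in> carrier (obj X G). r G x = \<zero>\<^bsub>obj (quot_psh X r) G\<^esub>}"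
      using quot_psh_ker[OF XA N r G] subfunctor_mem[OF N G] by auto
  qed (auto simp: sub_psh_incl[OF N] quot_psh_nat_trans[OF XA N r])
  then show ?thesis using D sub_psh_Ac[OF noeth X N] X Q unfolding serre_subcat_def by blast
qed

text \<open>No quotient is formed: \<open>Y\<close> itself is the third term of the exact sequence
  that starts with the kernel of \<eta>. Closure under isomorphism is a special case.\<close>

lemma serre_epi:
  assumes D: "serre_subcat k U D" and noeth: "noetherian k U" and X: "X \<in> D"
    and Y: "Y \<in> A_of k U" and \<eta>: "\<eta> \<in> psh_epi k U X Y"
  shows "Y \<in> D"
proof -
  have Xc: "X \<in> Ac_of k U" and XA: "X \<in> A_of k U" using D X by (auto simp: serre_subcat_def Ac_of_def)
  have Yc: "Y \<in> Ac_of k U" by (rule epi_Ac[OF Xc Y \<eta>])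
  have nt: "\<eta> \<in> nat_trans k U X Y" using \<eta> by (simp add: psh_epi_def)
  define N where "N = (\<lambda>G. {x \<in> carrier (obj X G). \<eta> G x \<in> {\<zero>\<^bsub>obj Y G\<^esub>}})"
  have N: "is_subfunctor k U X N" unfolding N_def by (rule subfunctor_vimage[OF XA nt subfunctor_zero[OF Y]])
  have "short_exact k U (sub_psh X N) X Y"
    unfolding short_exact_def
    by (intro bexI[of _ \<eta>] bexI[of _ "\<lambda>_ x. x"] ballI conjI nt sub_psh_incl[OF N])
       (use \<eta> in \<open>auto simp: N_def psh_epi_def\<close>)
  then show ?thesis using D X sub_psh_Ac[OF noeth Xc N] Xc Yc unfolding serre_subcat_def by blast
qed

text \<open>By the inclusion of kernels \<theta> factors through the image of \<eta>, a subobject of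
  \<open>Z\<close>, so \<open>W\<close> is a quotient of a member of \<open>D\<close>. The value
  type of \<open>E\<close> is free: \<open>E\<close> can be a representable in its original
  form.\<close>

lemma serre_subquotient:
  assumes D: "serre_subcat k U D" and noeth: "noetherian k U" and Z: "Z \<in> D"
    and E: "E \<in> A_of k U" and W: "W \<in> A_of k U"
    and \<eta>: "\<eta> \<in> nat_trans k U E Z" and \<theta>: "\<theta> \<in> psh_epi k U E W"
    and ker: "\<And>G x. G \<in> U \<Longrightarrow> x \<in> carrier (obj E G) \<Longrightarrow> \<eta> G x = \<zero>\<^bsub>obj Z G\<^esub> \<Longrightarrow> \<theta> G x = \<zero>\<^bsub>obj W G\<^esub>"
  shows "W \<in> D"
proof -
  have Zc: "Z \<in> Ac_of k U" and ZA: "Z \<in> A_of k U" using D Z by (auto simp: serre_subcat_def Ac_of_def)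
  have \<theta>n: "\<theta> \<in> nat_trans k U E W" using \<theta> by (simp add: psh_epi_def)
  define N where "N = (\<lambda>G. \<eta> G ` carrier (obj E G))"
  have N: "is_subfunctor k U Z N"
    unfolding N_def by (rule subfunctor_image[OF ZA \<eta> subfunctor_carrier[OF E]])
  obtain r :: "'a monoid \<Rightarrow> 'b \<Rightarrow> 'b" where r: "coset_map Z N r" using ex_coset_map[OF N] by blast
  have ND: "sub_psh Z N \<in> D" using serre_sub_quot[OF D noeth Zc N r] Z by blast
  let ?S = "sub_psh Z N"
  \<comment> \<open>The factorisation of \<theta> through the image of \<eta>. Any preimage will do,
    since two of them differ by an element that \<eta>, hence \<theta>, kills.\<close>
  define g where "g = (\<lambda>G z. \<theta> G (SOME x. x \<in> carrier (obj E G) \<and> \<eta> G x = z))"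
  have g: "g G (\<eta> G x) = \<theta> G x" if G: "G \<in> U" and x: "x \<in> carrier (obj E G)" for G x
  proof -
    define x' where "x' = (SOME x'. x' \<in> carrier (obj E G) \<and> \<eta> G x' = \<eta> G x)"
    have x': "x' \<in> carrier (obj E G) \<and> \<eta> G x' = \<eta> G x"
      unfolding x'_def by (rule someI[of _ x]) (simp add: x)
    interpret ME: module k "obj E G" by (rule A_of_module[OF E G])
    have "\<eta> G (x' \<ominus>\<^bsub>obj E G\<^esub> x) = \<zero>\<^bsub>obj Z G\<^esub>"
      using nat_trans_minus[OF E ZA \<eta> G _ x] x' module_minus_eq_zero_iff[OF A_of_module[OF ZA G]] nat_trans_mem[OF \<eta> G x] by simp
    then have "\<theta> G (x' \<ominus>\<^bsub>obj E G\<^esub> x) = \<zero>\<^bsub>obj W G\<^esub>"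
      using ker[OF G] x x' by simp
    then have "\<theta> G x' = \<theta> G x"
      using nat_trans_minus[OF E W \<theta>n G _ x] x' module_minus_eq_zero_iff[OF A_of_module[OF W G]]
        nat_trans_mem[OF \<theta>n G] x by simp
    then show ?thesis by (simp add: g_def flip: x'_def)
  qed
  have gn: "g \<in> nat_trans k U ?S W"
  proof (rule nat_transI)
    fix G assume G: "G \<in> U"
    interpret ME: module k "obj E G" by (rule A_of_module[OF E G])
    show "g G \<in> module_hom k (obj ?S G) (obj W G)"
    proof (rule module_homI)
      fix z assume "z \<in> carrier (obj ?S G)"
      then obtain x where x: "x \<in> carrier (obj E G)" "z = \<eta> G x" by (auto simp: N_def)
      show "g G z \<in> carrier (obj W G)" using x g[OF G] nat_trans_mem[OF \<theta>n G] by simp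
      show "g G (c \<odot>\<^bsub>obj ?S G\<^esub> z) = c \<odot>\<^bsub>obj W G\<^esub> g G z" if c: "c \<in> carrier k" for c
        using g[OF G ME.smult_closed[OF c x(1)]] g[OF G x(1)] x c
          module_hom_smult[OF nat_trans_hom[OF \<eta> G] c x(1)] module_hom_smult[OF nat_trans_hom[OF \<theta>n G] c x(1)] by simp
      fix w assume "w \<in> carrier (obj ?S G)"
      then obtain y where y: "y \<in> carrier (obj E G)" "w = \<eta> G y" by (auto simp: N_def)
      show "g G (z \<oplus>\<^bsub>obj ?S G\<^esub> w) = g G z \<oplus>\<^bsub>obj W G\<^esub> g G w"
        using g[OF G ME.M.a_closed[OF x(1) y(1)]] g[OF G x(1)] g[OF G y(1)] x y
          module_hom_add[OF nat_trans_hom[OF \<eta> G] x(1) y(1)] module_hom_add[OF nat_trans_hom[OF \<theta>n G] x(1) y(1)] by simp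
    qed
    fix H \<alpha> z assume H: "H \<in> U" "\<alpha> \<in> Hom G H" and "z \<in> carrier (obj ?S H)"
    then obtain x where x: "x \<in> carrier (obj E H)" "z = \<eta> H x" by (auto simp: N_def)
    show "g G (act ?S G H \<alpha> z) = act W G H \<alpha> (g H z)"
      using x g[OF H(1)] g[OF G A_of_act_mem[OF E G H x(1)]] nat_trans_act[OF \<eta> G H x(1)] nat_trans_act[OF \<theta>n G H x(1)]
      by simp
  qed
  have "g G ` N G = carrier (obj W G)" if G: "G \<in> U" for G
  proof -
    have "g G ` N G = \<theta> G ` carrier (obj E G)" using g[OF G] by (auto simp: N_def image_image)
    then show ?thesis using \<theta> G by (simp add: psh_epi_def)
  qed
  then have "g \<in> psh_epi k U ?S W" using gn by (simp add: psh_epi_def)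
  then show ?thesis by (rule serre_epi[OF D noeth ND W])
qed

text \<open>A zero functor is a subquotient of any member, by way of the zero map.\<close>

lemma serre_zero:
  assumes D: "serre_subcat k U D" and noeth: "noetherian k U" and X: "X \<in> Ac_of k U"
    and 0: "\<And>G. G \<in> U \<Longrightarrow> carrier (obj X G) = {\<zero>\<^bsub>obj X G\<^esub>}"
  shows "X \<in> D"
proof -
  obtain Z where Z: "Z \<in> D" using D by (auto simp: serre_subcat_def)
  then have Zc: "Z \<in> Ac_of k U" and ZA: "Z \<in> A_of k U" using D by (auto simp: serre_subcat_def Ac_of_def)
  have XA: "X \<in> A_of k U" using X by (auto simp: Ac_of_def)
  have "(\<lambda>G _. \<zero>\<^bsub>obj Z G\<^esub>) \<in> nat_trans k U X Z"
  proof (rule nat_transI)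
    fix G assume G: "G \<in> U"
    interpret module k "obj Z G" by (rule A_of_module[OF ZA G])
    show "(\<lambda>_. \<zero>\<^bsub>obj Z G\<^esub>) \<in> module_hom k (obj X G) (obj Z G)" by (rule module_homI) auto
    show "\<zero>\<^bsub>obj Z G\<^esub> = act Z G H \<alpha> \<zero>\<^bsub>obj Z H\<^esub>" if "H \<in> U" "\<alpha> \<in> Hom G H" for H \<alpha>
      using module_hom_zero[OF A_of_module[OF ZA that(1)] A_of_module[OF ZA G] A_of_act_hom[OF ZA G that]] ..
  qed
  moreover have "(\<lambda>_ x. x) \<in> psh_epi k U X X" using nat_trans_ident by (simp add: psh_epi_def)
  ultimately show ?thesis by (rule serre_subquotient[OF D noeth Z XA XA]) (use 0 in auto)
qed

text \<open>An object is filtered by the subobjects generated by the initial segments of a list of generators, with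
  cyclic subquotients.\<close>

lemma serre_filtration:
  assumes D: "serre_subcat k U D" and noeth: "noetherian k U"
    and sub: "\<And>X N. X \<in> Ac_of k U \<Longrightarrow> P X \<Longrightarrow> is_subfunctor k U X N \<Longrightarrow> P (sub_psh X N)"
    and quot: "\<And>X N r. X \<in> Ac_of k U \<Longrightarrow> P X \<Longrightarrow> is_subfunctor k U X N \<Longrightarrow> coset_map X N r \<Longrightarrow> P (quot_psh X r)"
    and cyclic: "\<And>X G x. X \<in> Ac_of k U \<Longrightarrow> P X \<Longrightarrow> G \<in> U \<Longrightarrow> x \<in> carrier (obj X G) \<Longrightarrow>
        generates X {(G, x)} (\<lambda>G. carrier (obj X G)) \<Longrightarrow> X \<in> D"
    and X: "X \<in> Ac_of k U" "P X"
  shows "X \<in> (D :: ('a, 'k, 'v) presheaf set)"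
proof -
  \<comment> \<open>The functor varies with the set of generators, because the induction step passes
    to the subobject generated by \<open>S\<close>.\<close>
  have "X \<in> D" if "finite S" "X \<in> Ac_of k U" "P X" "generates X S (\<lambda>G. carrier (obj X G))" for S and X :: "('a, 'k, 'v) presheaf"
    using that
  proof (induction S arbitrary: X)
    case empty
    have XA: "X \<in> A_of k U" using empty by (auto simp: Ac_of_def)
    have "carrier (obj X G) = {\<zero>\<^bsub>obj X G\<^esub>}" if G: "G \<in> U" for G
    proof (intro equalityI subsetI)
      show "v \<in> {\<zero>\<^bsub>obj X G\<^esub>}" if "v \<in> carrier (obj X G)" for v
        by (rule generatesD[OF empty(3) subfunctor_zero[OF XA] _ G that]) simp
      show "v \<in> carrier (obj X G)" if "v \<in> {\<zero>\<^bsub>obj X G\<^esub>}" for v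
        using that submodule.zero_closed[OF submodule_carrier[OF A_of_module[OF XA G]]] by simp
    qed
    then show ?case by (rule serre_zero[OF D noeth empty(1)])
  next
    case (insert p S)
    note Xc = insert.prems(1) and PX = insert.prems(2) and gen = insert.prems(3)
    have XA: "X \<in> A_of k U" using Xc by (auto simp: Ac_of_def)
    have mem: "H \<in> U \<and> z \<in> carrier (obj X H)" if "(H, z) \<in> insert p S" for H z
      using generates_mem[OF gen that] .
    define N where "N = gen_sub X S"
    have N: "is_subfunctor k U X N" unfolding N_def by (rule gen_sub_subfunctor[OF XA]) (use mem in blast)
    have "generates X S N" unfolding N_def by (rule generates_gen_sub) (use mem in blast)
    then have gN: "generates (sub_psh X N) S (\<lambda>G. carrier (obj (sub_psh X N) G))"
      using generates_sub_psh[OF XA N] by simp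
    have 1: "sub_psh X N \<in> D"
      by (rule insert.IH[OF sub_psh_Ac[OF noeth Xc N] sub[OF Xc PX N] gN])
    obtain r :: "'a monoid \<Rightarrow> 'v \<Rightarrow> 'v" where r: "coset_map X N r" using ex_coset_map[OF N] by blast
    note rn = quot_psh_nat_trans[OF XA N r]
  let ?Q = "quot_psh X r"
    obtain G x where p: "p = (G, x)" by (cases p)
    \<comment> \<open>The generators in \<open>S\<close> become zero in the quotient, so the image
      of the remaining one generates it.\<close>
    have "generates ?Q {(G, r G x)} (\<lambda>G. carrier (obj ?Q G))"
    proof (rule generatesI)
      show "H \<in> U \<and> z \<in> carrier (obj ?Q H)" if "(H, z) \<in> {(G, r G x)}" for H z
        using that mem[of G x] p by auto
      fix Q H z assume Q: "is_subfunctor k U ?Q Q" "\<And>H z. (H, z) \<in> {(G, r G x)} \<Longrightarrow> z \<in> Q H"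
        and H: "H \<in> U" and "z \<in> carrier (obj ?Q H)"
      then obtain v where v: "v \<in> carrier (obj X H)" "z = r H v" by auto
      have V: "is_subfunctor k U X (\<lambda>H. {v \<in> carrier (obj X H). r H v \<in> Q H})"
        by (rule subfunctor_vimage[OF XA rn Q(1)])
      have "v \<in> {v \<in> carrier (obj X H). r H v \<in> Q H}"
      proof (rule generatesD[OF gen V _ H v(1)])
        fix K w assume w: "(K, w) \<in> insert p S"
        have K: "K \<in> U" and wc: "w \<in> carrier (obj X K)" using mem[OF w] by auto
        have "r K w \<in> Q K"
        proof (cases "(K, w) = p")
          case True
          then show ?thesis using p Q(2) by simp
        next
          case False
          then have "w \<in> N K" using w by (auto simp: N_def gen_sub_mem)
          then show ?thesis
            using quot_psh_ker[OF XA N r K wc] submodule.zero_closed[OF subfunctor_submodule[OF Q(1) K]] by simp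
        qed
        then show "w \<in> {v \<in> carrier (obj X K). r K v \<in> Q K}" using wc by simp
      qed
      then show "z \<in> Q H" using v(2) by simp
    qed
    then have 2: "?Q \<in> D"
      using cyclic[OF epi_Ac[OF Xc quot_psh_A_of[OF XA N r] quot_psh_epi[OF XA N r]] quot[OF Xc PX N r], of G "r G x"]
        mem[of G x] p by auto
    show ?case using serre_sub_quot[OF D noeth Xc N r] 1 2 by blast
  qed
  moreover obtain S where "finite S" "generates X S (\<lambda>G. carrier (obj X G))"
    using fin_gen_imp_generates X(1) by (auto simp: Ac_of_def)
  ultimately show ?thesis using X by blast
qed

end

section \<open>Coordinates on tensor products\<close>

lemma module_hom_sum:
  assumes M: "module k M" and N: "module k N" and "finite A" and f: "\<And>a. a \<in> A \<Longrightarrow> f a \<in> module_hom k M N"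
  shows "(\<lambda>x. \<Oplus>\<^bsub>N\<^esub>a\<in>A. f a x) \<in> module_hom k M N"
proof (rule module_homI)
  interpret M: module k M by fact
  interpret N: module k N by fact
  have c: "(\<lambda>a. f a x) \<in> A \<rightarrow> carrier N" if "x \<in> carrier M" for x
    using module_hom_mem[OF f that] by auto
  fix x assume x: "x \<in> carrier M"
  show "(\<Oplus>\<^bsub>N\<^esub>a\<in>A. f a x) \<in> carrier N" by (rule N.M.finsum_closed[OF c[OF x]])
  show "(\<Oplus>\<^bsub>N\<^esub>a\<in>A. f a (x \<oplus>\<^bsub>M\<^esub> y)) = (\<Oplus>\<^bsub>N\<^esub>a\<in>A. f a x) \<oplus>\<^bsub>N\<^esub> (\<Oplus>\<^bsub>N\<^esub>a\<in>A. f a y)" if y: "y \<in> carrier M" for y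
  proof -
    have "(\<Oplus>\<^bsub>N\<^esub>a\<in>A. f a (x \<oplus>\<^bsub>M\<^esub> y)) = (\<Oplus>\<^bsub>N\<^esub>a\<in>A. f a x \<oplus>\<^bsub>N\<^esub> f a y)"
      by (rule N.M.add.finprod_cong')
         (auto simp: module_hom_add[OF f x y] intro!: N.M.a_closed funcset_mem[OF c[OF x]] funcset_mem[OF c[OF y]])
    then show ?thesis using N.M.finsum_addf[OF c[OF x] c[OF y]] by simp
  qed
  show "(\<Oplus>\<^bsub>N\<^esub>a\<in>A. f a (t \<odot>\<^bsub>M\<^esub> x)) = t \<odot>\<^bsub>N\<^esub> (\<Oplus>\<^bsub>N\<^esub>a\<in>A. f a x)" if t: "t \<in> carrier k" for t
  proof -
    have "(\<Oplus>\<^bsub>N\<^esub>a\<in>A. f a (t \<odot>\<^bsub>M\<^esub> x)) = (\<Oplus>\<^bsub>N\<^esub>a\<in>A. t \<odot>\<^bsub>N\<^esub> f a x)"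
      by (rule N.M.add.finprod_cong')
         (auto simp: module_hom_smult[OF f t x] intro!: N.smult_closed[OF t] funcset_mem[OF c[OF x]])
    then show ?thesis using N.finsum_smult_ldistr[OF \<open>finite A\<close> t c[OF x]] by simp
  qed
qed

lemma mem_a_r_coset_iff:
  assumes "submodule k K F" "x \<in> carrier F" "y \<in> carrier F"
  shows "y \<in> K +>\<^bsub>F\<^esub> x \<longleftrightarrow> y \<ominus>\<^bsub>F\<^esub> x \<in> K"
proof
  interpret K: submodule k K F by fact
  interpret F: module k F by (rule K.module)
  { assume "y \<in> K +>\<^bsub>F\<^esub> x"
    then obtain h where h: "h \<in> K" "y = h \<oplus>\<^bsub>F\<^esub> x" by (auto simp: a_r_coset_def')
    then have "h \<in> carrier F" using K.subset by auto
    then have "y \<ominus>\<^bsub>F\<^esub> x = h"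
      using module_add_minus_cancel[OF F.module_axioms assms(2)] assms(2) h(2) F.M.a_comm by simp
    then show "y \<ominus>\<^bsub>F\<^esub> x \<in> K" using h by simp }
  { assume "y \<ominus>\<^bsub>F\<^esub> x \<in> K"
    moreover have "y = (y \<ominus>\<^bsub>F\<^esub> x) \<oplus>\<^bsub>F\<^esub> x"
      using assms(2,3) by (simp add: a_minus_def F.M.a_assoc F.M.l_neg)
    ultimately show "y \<in> K +>\<^bsub>F\<^esub> x" by (auto simp: a_r_coset_def') }
qed

lemma a_r_coset_eq_class:
  assumes K: "submodule k K F" and x: "x \<in> carrier F"
  shows "K +>\<^bsub>F\<^esub> x = {y \<in> carrier F. y \<ominus>\<^bsub>F\<^esub> x \<in> K}"
proof -
  interpret K: submodule k K F by fact
  interpret F: module k F by (rule K.module)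
  have "K +>\<^bsub>F\<^esub> x \<subseteq> carrier F" using K.subset x by (auto simp: a_r_coset_def')
  then show ?thesis using mem_a_r_coset_iff[OF K x] by auto
qed

text \<open>For \<open>N\<close> with a finite basis \<open>b\<close> and coordinates \<open>\<iota>\<close>, the tensor product \<open>M \<otimes> N\<close> is the sum of copies of
  \<open>M\<close>; its coordinates are the linear extensions of \<open>(m, n) \<mapsto> \<iota>(n)\<^sub>\<beta> m\<close>.\<close>

definition tensor_coord :: "'k ring \<Rightarrow> ('k, 'v) module \<Rightarrow> ('w \<Rightarrow> 's \<Rightarrow> 'k) \<Rightarrow> 's \<Rightarrow> ('v \<times> 'w \<Rightarrow> 'k) \<Rightarrow> 'v" where
  "tensor_coord k M \<iota> \<beta> = lin_ext k M (\<lambda>(m, n). \<iota> n \<beta> \<odot>\<^bsub>M\<^esub> m)"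

context
  fixes k :: "'k ring" and M :: "('k, 'v) module" and N :: "('k, 'w) module"
  assumes k: "cring k" and M: "module k M" and N: "module k N"
begin

interpretation k: cring k by (rule k)
interpretation M: module k M by (rule M)
interpretation N: module k N by (rule N)

abbreviation (input) "free_pairs \<equiv> free_module k (carrier M \<times> carrier N)"

interpretation F: module k "free_module k (carrier M \<times> carrier N)" by (rule free_module_module[OF k])

lemma bilinear_rels_cases:
  assumes "x \<in> bilinear_rels k M N"
  obtains
    (left) m m' n where "m \<in> carrier M" "m' \<in> carrier M" "n \<in> carrier N"
      "x = free_basis k (m \<oplus>\<^bsub>M\<^esub> m', n) \<ominus>\<^bsub>free_pairs\<^esub> (free_basis k (m, n) \<oplus>\<^bsub>free_pairs\<^esub> free_basis k (m', n))"
  | (right) m n n' where "m \<in> carrier M" "n \<in> carrier N" "n' \<in> carrier N"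
      "x = free_basis k (m, n \<oplus>\<^bsub>N\<^esub> n') \<ominus>\<^bsub>free_pairs\<^esub> (free_basis k (m, n) \<oplus>\<^bsub>free_pairs\<^esub> free_basis k (m, n'))"
  | (lscale) c m n where "c \<in> carrier k" "m \<in> carrier M" "n \<in> carrier N"
      "x = free_basis k (c \<odot>\<^bsub>M\<^esub> m, n) \<ominus>\<^bsub>free_pairs\<^esub> (c \<odot>\<^bsub>free_pairs\<^esub> free_basis k (m, n))"
  | (rscale) c m n where "c \<in> carrier k" "m \<in> carrier M" "n \<in> carrier N"
      "x = free_basis k (m, c \<odot>\<^bsub>N\<^esub> n) \<ominus>\<^bsub>free_pairs\<^esub> (c \<odot>\<^bsub>free_pairs\<^esub> free_basis k (m, n))"
  using assms unfolding bilinear_rels_def Let_def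
  by (elim UnE CollectE exE conjE) (rule left right lscale rscale; assumption)+

lemma basis_mem: "m \<in> carrier M \<Longrightarrow> n \<in> carrier N \<Longrightarrow> free_basis k (m, n) \<in> carrier free_pairs"
  by (rule free_basis_mem[OF k]) simp

lemma bilinear_rels_carrier: "bilinear_rels k M N \<subseteq> carrier free_pairs"
proof
  fix x assume "x \<in> bilinear_rels k M N"
  then show "x \<in> carrier free_pairs"
    by (cases rule: bilinear_rels_cases)
       (simp_all only:, (intro F.M.minus_closed F.M.a_closed F.smult_closed basis_mem M.M.a_closed N.M.a_closed
         M.smult_closed N.smult_closed; assumption)+)
qed

lemma tensor_ker_submodule: "submodule k (tensor_ker k M N) free_pairs"
  unfolding tensor_ker_def by (rule F.span_is_submodule[OF bilinear_rels_carrier])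

lemma bilinear_rels_subset_ker: "bilinear_rels k M N \<subseteq> tensor_ker k M N"
  unfolding tensor_ker_def by (rule F.in_own_span[OF bilinear_rels_carrier])

lemma tensor_ker_least: "submodule k W free_pairs \<Longrightarrow> bilinear_rels k M N \<subseteq> W \<Longrightarrow> tensor_ker k M N \<subseteq> W"
  unfolding tensor_ker_def by (rule F.span_is_subset)

text \<open>The kernel of \<open>h\<close> is a submodule containing the relations whose span is
  \<open>tensor_ker\<close>. This is the universal property of the tensor product, for a bilinear
  map given by its linear extension \<open>h\<close>.\<close>

lemma tensor_ker_hom_zero:
  assumes Q: "module k Q" and h: "h \<in> module_hom k free_pairs Q"
    and left: "\<And>m m' n. m \<in> carrier M \<Longrightarrow> m' \<in> carrier M \<Longrightarrow> n \<in> carrier N \<Longrightarrow>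
        h (free_basis k (m \<oplus>\<^bsub>M\<^esub> m', n)) = h (free_basis k (m, n)) \<oplus>\<^bsub>Q\<^esub> h (free_basis k (m', n))"
    and right: "\<And>m n n'. m \<in> carrier M \<Longrightarrow> n \<in> carrier N \<Longrightarrow> n' \<in> carrier N \<Longrightarrow>
        h (free_basis k (m, n \<oplus>\<^bsub>N\<^esub> n')) = h (free_basis k (m, n)) \<oplus>\<^bsub>Q\<^esub> h (free_basis k (m, n'))"
    and lscale: "\<And>c m n. c \<in> carrier k \<Longrightarrow> m \<in> carrier M \<Longrightarrow> n \<in> carrier N \<Longrightarrow>
        h (free_basis k (c \<odot>\<^bsub>M\<^esub> m, n)) = c \<odot>\<^bsub>Q\<^esub> h (free_basis k (m, n))"
    and rscale: "\<And>c m n. c \<in> carrier k \<Longrightarrow> m \<in> carrier M \<Longrightarrow> n \<in> carrier N \<Longrightarrow>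
        h (free_basis k (m, c \<odot>\<^bsub>N\<^esub> n)) = c \<odot>\<^bsub>Q\<^esub> h (free_basis k (m, n))"
    and f: "f \<in> tensor_ker k M N"
  shows "h f = \<zero>\<^bsub>Q\<^esub>"
proof -
  interpret Q: module k Q by (rule Q)
  note hm = module_hom_minus[OF F.module_axioms Q h]
  note zero = module_minus_eq_zero_iff[OF Q module_hom_mem[OF h] module_hom_mem[OF h]]
  have eq: "h (u \<ominus>\<^bsub>free_pairs\<^esub> v) = \<zero>\<^bsub>Q\<^esub>" if "u \<in> carrier free_pairs" "v \<in> carrier free_pairs" "h u = h v" for u v
    using hm[OF that(1,2)] zero[OF that(1,2)] that(3) by simp
  have "tensor_ker k M N \<subseteq> {f \<in> carrier free_pairs. h f \<in> {\<zero>\<^bsub>Q\<^esub>}}"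
  proof (rule tensor_ker_least[OF submodule_vimage[OF F.module_axioms h submodule_zero[OF Q]]], rule subsetI)
    fix x assume x: "x \<in> bilinear_rels k M N"
    then have "h x = \<zero>\<^bsub>Q\<^esub>"
    proof (cases rule: bilinear_rels_cases)
      case (left m m' n)
      then show ?thesis
        using assms(3)[OF left(1-3)] module_hom_add[OF h basis_mem[OF left(1,3)] basis_mem[OF left(2,3)]]
        by (simp only: left(4)) (rule eq; (intro basis_mem F.M.a_closed M.M.a_closed)?; simp only:)
    next
      case (right m n n')
      then show ?thesis
        using assms(4)[OF right(1-3)] module_hom_add[OF h basis_mem[OF right(1,2)] basis_mem[OF right(1,3)]]
        by (simp only: right(4)) (rule eq; (intro basis_mem F.M.a_closed N.M.a_closed)?; simp only:)
    next
      case (lscale c m n)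
      then show ?thesis
        using assms(5)[OF lscale(1-3)] module_hom_smult[OF h lscale(1) basis_mem[OF lscale(2,3)]]
        by (simp only: lscale(4)) (rule eq; (intro basis_mem F.smult_closed M.smult_closed)?; simp only:)
    next
      case (rscale c m n)
      then show ?thesis
        using assms(6)[OF rscale(1-3)] module_hom_smult[OF h rscale(1) basis_mem[OF rscale(2,3)]]
        by (simp only: rscale(4)) (rule eq; (intro basis_mem F.smult_closed N.smult_closed)?; simp only:)
    qed
    then show "x \<in> {f \<in> carrier free_pairs. h f \<in> {\<zero>\<^bsub>Q\<^esub>}}" using x bilinear_rels_carrier by blast
  qed
  then show ?thesis using f by blast
qed

context
  fixes B :: "'s set" and \<iota> :: "'w \<Rightarrow> 's \<Rightarrow> 'k" and b :: "'s \<Rightarrow> 'w"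
  assumes B: "finite B" and \<iota>: "\<iota> \<in> module_hom k N (free_module k B)" and inj: "inj_on \<iota> (carrier N)"
    and b: "\<And>\<beta>. \<beta> \<in> B \<Longrightarrow> b \<beta> \<in> carrier N" and \<iota>b: "\<And>\<beta>. \<beta> \<in> B \<Longrightarrow> \<iota> (b \<beta>) = free_basis k \<beta>"
begin

lemma coord_mem: "n \<in> carrier N \<Longrightarrow> \<iota> n \<beta> \<in> carrier k"
  using free_module_value[OF k module_hom_mem[OF \<iota>]] .

lemma tensor_coord_hom: "tensor_coord k M \<iota> \<beta> \<in> module_hom k free_pairs M"
  unfolding tensor_coord_def by (rule lin_ext_hom[OF k M]) (auto simp: coord_mem)

lemma tensor_coord_basis:
  "m \<in> carrier M \<Longrightarrow> n \<in> carrier N \<Longrightarrow> tensor_coord k M \<iota> \<beta> (free_basis k (m, n)) = \<iota> n \<beta> \<odot>\<^bsub>M\<^esub> m"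
  unfolding tensor_coord_def by (subst lin_ext_basis[OF k M, of _ "carrier M \<times> carrier N"]) (auto simp: coord_mem)

text \<open>\<open>n\<close> and its expansion in the basis \<open>b\<close> have the same
  coordinates, so they agree by injectivity of \<iota>; then \<tau> is applied.\<close>

lemma coord_expansion:
  assumes Q: "module k Q" and \<tau>: "\<tau> \<in> module_hom k N Q" and n: "n \<in> carrier N"
  shows "\<tau> n = (\<Oplus>\<^bsub>Q\<^esub>\<beta>\<in>B. \<iota> n \<beta> \<odot>\<^bsub>Q\<^esub> \<tau> (b \<beta>))"
proof -
  interpret Q: module k Q by (rule Q)
  have bB: "b \<in> B \<rightarrow> carrier N" using b by auto
  note l = lin_ext_hom[OF k N bB]
  have \<iota>n: "\<iota> n \<in> carrier (free_module k B)" using module_hom_mem[OF \<iota> n] .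
  have "\<iota> (lin_ext k N b (\<iota> n)) = \<iota> n"
  proof (rule free_module_hom_eqI[OF k free_module_module[OF k], of _ B B "\<lambda>f. f"])
    show "(\<lambda>f. \<iota> (lin_ext k N b f)) \<in> module_hom k (free_module k B) (free_module k B)"
      by (rule module_hom_compose[OF l \<iota>])
    show "\<iota> (lin_ext k N b (free_basis k s)) = free_basis k s" if "s \<in> B" for s
      using lin_ext_basis[OF k N bB that] \<iota>b[OF that] by simp
  qed (auto simp: module_hom_def \<iota>n)
  then have "n = lin_ext k N b (\<iota> n)" using inj n module_hom_mem[OF l \<iota>n] by (metis inj_onD)
  also have "\<dots> = (\<Oplus>\<^bsub>N\<^esub>\<beta>\<in>B. \<iota> n \<beta> \<odot>\<^bsub>N\<^esub> b \<beta>)"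
    by (rule lin_ext_superset[OF k N bB \<iota>n B free_module_supp[OF \<iota>n]]) simp
  finally have "\<tau> n = \<tau> (\<Oplus>\<^bsub>N\<^esub>\<beta>\<in>B. \<iota> n \<beta> \<odot>\<^bsub>N\<^esub> b \<beta>)" by (rule arg_cong)
  also have "\<dots> = (\<Oplus>\<^bsub>Q\<^esub>\<beta>\<in>B. \<tau> (\<iota> n \<beta> \<odot>\<^bsub>N\<^esub> b \<beta>))"
    by (rule module_hom_finsum[OF N Q \<tau> B]) (auto simp: coord_mem[OF n] b)
  also have "\<dots> = (\<Oplus>\<^bsub>Q\<^esub>\<beta>\<in>B. \<iota> n \<beta> \<odot>\<^bsub>Q\<^esub> \<tau> (b \<beta>))"
    by (rule Q.M.add.finprod_cong')
       (auto simp: module_hom_smult[OF \<tau> coord_mem[OF n] b] coord_mem[OF n] intro!: Q.smult_closed module_hom_mem[OF \<tau>] b)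
  finally show ?thesis .
qed

lemma tensor_coord_zero:
  assumes f: "f \<in> tensor_ker k M N"
  shows "tensor_coord k M \<iota> \<beta> f = \<zero>\<^bsub>M\<^esub>"
proof (rule tensor_ker_hom_zero[OF M tensor_coord_hom _ _ _ _ f])
  fix m m' n assume "m \<in> carrier M" "m' \<in> carrier M" "n \<in> carrier N"
  then show "tensor_coord k M \<iota> \<beta> (free_basis k (m \<oplus>\<^bsub>M\<^esub> m', n)) =
      tensor_coord k M \<iota> \<beta> (free_basis k (m, n)) \<oplus>\<^bsub>M\<^esub> tensor_coord k M \<iota> \<beta> (free_basis k (m', n))"
    by (simp add: tensor_coord_basis M.smult_r_distr coord_mem)
next
  fix m n n' assume "m \<in> carrier M" "n \<in> carrier N" "n' \<in> carrier N"
  then show "tensor_coord k M \<iota> \<beta> (free_basis k (m, n \<oplus>\<^bsub>N\<^esub> n')) =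
      tensor_coord k M \<iota> \<beta> (free_basis k (m, n)) \<oplus>\<^bsub>M\<^esub> tensor_coord k M \<iota> \<beta> (free_basis k (m, n'))"
    by (simp add: tensor_coord_basis M.smult_l_distr coord_mem module_hom_add[OF \<iota>])
next
  fix c m n assume "c \<in> carrier k" "m \<in> carrier M" "n \<in> carrier N"
  then show "tensor_coord k M \<iota> \<beta> (free_basis k (c \<odot>\<^bsub>M\<^esub> m, n)) = c \<odot>\<^bsub>M\<^esub> tensor_coord k M \<iota> \<beta> (free_basis k (m, n))"
    by (simp add: tensor_coord_basis coord_mem k.m_comm flip: M.smult_assoc1)
next
  fix c m n assume "c \<in> carrier k" "m \<in> carrier M" "n \<in> carrier N"
  then show "tensor_coord k M \<iota> \<beta> (free_basis k (m, c \<odot>\<^bsub>N\<^esub> n)) = c \<odot>\<^bsub>M\<^esub> tensor_coord k M \<iota> \<beta> (free_basis k (m, n))"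
    by (simp add: tensor_coord_basis coord_mem module_hom_smult[OF \<iota>] M.smult_assoc1)
qed

text \<open>The point is that vanishing coordinates force membership. Modulo the relations,
  \<open>f\<close> is the sum of the pure tensors formed by its coordinates and the basis vectors of
  \<open>N\<close>; if all coordinates are zero, so is this sum.\<close>

lemma tensor_ker_iff:
  assumes f: "f \<in> carrier free_pairs"
  shows "f \<in> tensor_ker k M N \<longleftrightarrow> (\<forall>\<beta>\<in>B. tensor_coord k M \<iota> \<beta> f = \<zero>\<^bsub>M\<^esub>)"
proof
  assume 0: "\<forall>\<beta>\<in>B. tensor_coord k M \<iota> \<beta> f = \<zero>\<^bsub>M\<^esub>"
  let ?K = "tensor_ker k M N"
  let ?t = "tensor_coord k M \<iota>"
  note K = tensor_ker_submodule
  obtain q :: "('v \<times> 'w \<Rightarrow> 'k) \<Rightarrow> ('v \<times> 'w \<Rightarrow> 'k)" where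
    q: "\<And>x y. x \<in> carrier free_pairs \<Longrightarrow> y \<in> carrier free_pairs \<Longrightarrow> q x = q y \<longleftrightarrow> x \<ominus>\<^bsub>free_pairs\<^esub> y \<in> ?K"
    using submodule_coset_rep[OF K] by metis
  define Q where "Q = push_module free_pairs q"
  have Q: "module k Q" unfolding Q_def by (rule push_module_module[OF K q])
  interpret Q: module k Q by (rule Q)
  have qh: "q \<in> module_hom k free_pairs Q" unfolding Q_def by (rule push_module_hom[OF K q])
  have rel: "q x = q y" if "x \<in> carrier free_pairs" "y \<in> carrier free_pairs" "x \<ominus>\<^bsub>free_pairs\<^esub> y \<in> bilinear_rels k M N" for x y
    using q[OF that(1,2)] that(3) bilinear_rels_subset_ker by blast
  have \<sigma>: "(\<lambda>m. q (free_basis k (m, n))) \<in> module_hom k M Q" if n: "n \<in> carrier N" for n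
  proof (rule module_homI)
    fix m assume m: "m \<in> carrier M"
    show "q (free_basis k (m, n)) \<in> carrier Q" using module_hom_mem[OF qh basis_mem[OF m n]] .
    show "q (free_basis k (m \<oplus>\<^bsub>M\<^esub> m', n)) = q (free_basis k (m, n)) \<oplus>\<^bsub>Q\<^esub> q (free_basis k (m', n))"
      if m': "m' \<in> carrier M" for m'
      unfolding module_hom_add[OF qh basis_mem[OF m n] basis_mem[OF m' n], symmetric]
    proof (rule rel)
      show "free_basis k (m \<oplus>\<^bsub>M\<^esub> m', n) \<ominus>\<^bsub>free_pairs\<^esub> (free_basis k (m, n) \<oplus>\<^bsub>free_pairs\<^esub> free_basis k (m', n)) \<in> bilinear_rels k M N"
        unfolding bilinear_rels_def Let_def using m m' n by blast
    qed (intro basis_mem F.M.a_closed M.M.a_closed m m' n)+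
    show "q (free_basis k (c \<odot>\<^bsub>M\<^esub> m, n)) = c \<odot>\<^bsub>Q\<^esub> q (free_basis k (m, n))" if c: "c \<in> carrier k" for c
      unfolding module_hom_smult[OF qh c basis_mem[OF m n], symmetric]
    proof (rule rel)
      show "free_basis k (c \<odot>\<^bsub>M\<^esub> m, n) \<ominus>\<^bsub>free_pairs\<^esub> (c \<odot>\<^bsub>free_pairs\<^esub> free_basis k (m, n)) \<in> bilinear_rels k M N"
        unfolding bilinear_rels_def Let_def using m c n by blast
    qed (intro basis_mem F.smult_closed M.smult_closed m c n)+
  qed
  have \<tau>: "(\<lambda>n. q (free_basis k (m, n))) \<in> module_hom k N Q" if m: "m \<in> carrier M" for m
  proof (rule module_homI)
    fix n assume n: "n \<in> carrier N"
    show "q (free_basis k (m, n)) \<in> carrier Q" using module_hom_mem[OF qh basis_mem[OF m n]] .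
    show "q (free_basis k (m, n \<oplus>\<^bsub>N\<^esub> n')) = q (free_basis k (m, n)) \<oplus>\<^bsub>Q\<^esub> q (free_basis k (m, n'))"
      if n': "n' \<in> carrier N" for n'
      unfolding module_hom_add[OF qh basis_mem[OF m n] basis_mem[OF m n'], symmetric]
    proof (rule rel)
      show "free_basis k (m, n \<oplus>\<^bsub>N\<^esub> n') \<ominus>\<^bsub>free_pairs\<^esub> (free_basis k (m, n) \<oplus>\<^bsub>free_pairs\<^esub> free_basis k (m, n')) \<in> bilinear_rels k M N"
        unfolding bilinear_rels_def Let_def using m n n' by blast
    qed (intro basis_mem F.M.a_closed N.M.a_closed m n n')+
    show "q (free_basis k (m, c \<odot>\<^bsub>N\<^esub> n)) = c \<odot>\<^bsub>Q\<^esub> q (free_basis k (m, n))" if c: "c \<in> carrier k" for c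
      unfolding module_hom_smult[OF qh c basis_mem[OF m n], symmetric]
    proof (rule rel)
      show "free_basis k (m, c \<odot>\<^bsub>N\<^esub> n) \<ominus>\<^bsub>free_pairs\<^esub> (c \<odot>\<^bsub>free_pairs\<^esub> free_basis k (m, n)) \<in> bilinear_rels k M N"
        unfolding bilinear_rels_def Let_def using m c n by blast
    qed (intro basis_mem F.smult_closed N.smult_closed m c n)+
  qed
  \<comment> \<open>Both sides are linear in \<open>f\<close>, which reduces the claim to a single
    pair (m, n). There it is the expansion of \<open>n\<close> in the basis, with the scalars moved
    to the other factor.\<close>
  have "q f = (\<Oplus>\<^bsub>Q\<^esub>\<beta>\<in>B. q (free_basis k (?t \<beta> f, b \<beta>)))"
  proof (rule free_module_hom_eqI[OF k Q qh _ _ f])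
    show "(\<lambda>f. \<Oplus>\<^bsub>Q\<^esub>\<beta>\<in>B. q (free_basis k (?t \<beta> f, b \<beta>))) \<in> module_hom k free_pairs Q"
      by (rule module_hom_sum[OF F.module_axioms Q B]) (rule module_hom_compose[OF tensor_coord_hom \<sigma>[OF b]])
    fix p assume "p \<in> carrier M \<times> carrier N"
    then obtain m n where m: "m \<in> carrier M" and n: "n \<in> carrier N" and p: "p = (m, n)" by auto
    have "q (free_basis k (m, n)) = (\<Oplus>\<^bsub>Q\<^esub>\<beta>\<in>B. \<iota> n \<beta> \<odot>\<^bsub>Q\<^esub> q (free_basis k (m, b \<beta>)))"
      by (rule coord_expansion[OF Q \<tau>[OF m] n])
    also have "\<dots> = (\<Oplus>\<^bsub>Q\<^esub>\<beta>\<in>B. q (free_basis k (?t \<beta> (free_basis k p), b \<beta>)))"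
    proof (rule Q.M.add.finprod_cong')
      show "(\<lambda>\<beta>. q (free_basis k (?t \<beta> (free_basis k p), b \<beta>))) \<in> B \<rightarrow> carrier Q"
        unfolding p tensor_coord_basis[OF m n]
        by (intro funcsetI module_hom_mem[OF qh] basis_mem b M.smult_closed m coord_mem n)
      show "\<iota> n \<beta> \<odot>\<^bsub>Q\<^esub> q (free_basis k (m, b \<beta>)) = q (free_basis k (?t \<beta> (free_basis k p), b \<beta>))"
        if "\<beta> \<in> B" for \<beta>
        unfolding p tensor_coord_basis[OF m n] by (rule module_hom_smult[OF \<sigma>[OF b[OF that]] coord_mem[OF n] m, symmetric])
    qed simp
    finally show "q (free_basis k p) = (\<Oplus>\<^bsub>Q\<^esub>\<beta>\<in>B. q (free_basis k (?t \<beta> (free_basis k p), b \<beta>)))"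
      using p by simp
  qed
  also have "\<dots> = (\<Oplus>\<^bsub>Q\<^esub>\<beta>\<in>B. \<zero>\<^bsub>Q\<^esub>)"
    by (rule Q.M.add.finprod_cong') (use 0 module_hom_zero[OF M Q \<sigma>[OF b]] in auto)
  also have "\<dots> = \<zero>\<^bsub>Q\<^esub>" by simp
  finally show "f \<in> ?K" unfolding Q_def using push_module_ker[OF K q f] by simp
qed (simp add: tensor_coord_zero)

lemma tensor_coord_eq_iff:
  assumes f: "f \<in> carrier free_pairs" and g: "g \<in> carrier free_pairs"
  shows "(\<forall>\<beta>\<in>B. tensor_coord k M \<iota> \<beta> f = tensor_coord k M \<iota> \<beta> g) \<longleftrightarrow> f \<ominus>\<^bsub>free_pairs\<^esub> g \<in> tensor_ker k M N"
  unfolding tensor_ker_iff[OF F.M.minus_closed[OF f g]]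
  by (simp add: module_hom_minus[OF F.module_axioms M tensor_coord_hom f g] module_minus_eq_zero_iff[OF M]
      module_hom_mem[OF tensor_coord_hom f] module_hom_mem[OF tensor_coord_hom g])

end

end

text \<open>An infinite type is in bijection with its square, so the coordinates can be packed into
  a single value one after the other.\<close>

lemma ex_inj_PiE:
  assumes inf: "infinite (UNIV :: 'v set)" and "finite I"
  shows "\<exists>c :: ('i \<Rightarrow> 'v) \<Rightarrow> 'v. inj_on c (PiE I (\<lambda>_. UNIV))"
  using assms(2)
proof induction
  case empty
  then show ?case by auto
next
  case (insert i I)
  then obtain c :: "('i \<Rightarrow> 'v) \<Rightarrow> 'v" where c: "inj_on c (PiE I (\<lambda>_. UNIV))" by blast
  obtain p :: "'v \<times> 'v \<Rightarrow> 'v" where p: "bij_betw p (UNIV \<times> UNIV) UNIV"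
    using card_of_Times_same_infinite[OF inf] card_of_ordIso by blast
  have "inj_on (\<lambda>f. p (f i, c (restrict f I))) (PiE (insert i I) (\<lambda>_. UNIV))"
  proof (rule inj_onI)
    fix f g :: "'i \<Rightarrow> 'v"
    assume f: "f \<in> PiE (insert i I) (\<lambda>_. UNIV)" and g: "g \<in> PiE (insert i I) (\<lambda>_. UNIV)"
      and "p (f i, c (restrict f I)) = p (g i, c (restrict g I))"
    then have "(f i, c (restrict f I)) = (g i, c (restrict g I))"
      using inj_onD[OF bij_betw_imp_inj_on[OF p]] by blast
    then have fi: "f i = g i" and "c (restrict f I) = c (restrict g I)" by simp_all
    then have fI: "restrict f I = restrict g I"
      using inj_onD[OF c] by (simp add: PiE_iff)
    have "f x = g x" if "x \<in> I" for x using fun_cong[OF fI, of x] that by simp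
    then have "f x = g x" for x
      using fi PiE_arb[OF f, of x] PiE_arb[OF g, of x] by (cases "x \<in> insert i I") auto
    then show "f = g" by blast
  qed
  then show ?case by blast
qed

text \<open>If two multiples of \<one> agreed, their difference would be a positive multiple of
  \<one> equal to \<zero>.\<close>

lemma (in ring) infinite_carrier_char_0:
  assumes char0: "\<forall>n::nat. n > 0 \<longrightarrow> [n] \<cdot> \<one> \<noteq> \<zero>"
  shows "infinite (carrier R)"
proof -
  have "[m] \<cdot> \<one> \<noteq> [n] \<cdot> \<one>" if "m < n" for m n :: nat
  proof
    assume eq: "[m] \<cdot> \<one> = [n] \<cdot> \<one>"
    have "([m] \<cdot> \<one>) \<oplus> ([(n - m)] \<cdot> \<one>) = ([m] \<cdot> \<one>) \<oplus> \<zero>"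
      using that eq add.nat_pow_mult[of \<one> m "n - m"] by simp
    then have "[(n - m)] \<cdot> \<one> = \<zero>" by (simp del: r_zero)
    then show False using char0 that by simp
  qed
  then have "inj (\<lambda>n::nat. [n] \<cdot> \<one>)" by (metis injI linorder_neqE_nat)
  moreover have "range (\<lambda>n::nat. [n] \<cdot> \<one>) \<subseteq> carrier R" by auto
  ultimately show ?thesis unfolding infinite_iff_countable_subset by blast
qed

lemma vectorspace_smult_eq_zero:
  assumes "field k" "module k M" "c \<in> carrier k" "x \<in> carrier M" "c \<odot>\<^bsub>M\<^esub> x = \<zero>\<^bsub>M\<^esub>" "x \<noteq> \<zero>\<^bsub>M\<^esub>"
  shows "c = \<zero>\<^bsub>k\<^esub>"
proof (rule ccontr)
  interpret k: field k by fact
  interpret module k M by fact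
  assume "c \<noteq> \<zero>\<^bsub>k\<^esub>"
  then have c: "c \<in> Units k" using assms(3) by (simp add: k.field_Units)
  then have "x = (inv\<^bsub>k\<^esub> c \<otimes>\<^bsub>k\<^esub> c) \<odot>\<^bsub>M\<^esub> x" using assms(4) by simp
  also have "\<dots> = inv\<^bsub>k\<^esub> c \<odot>\<^bsub>M\<^esub> (c \<odot>\<^bsub>M\<^esub> x)"
    using c assms(3,4) by (intro smult_assoc1) auto
  also have "\<dots> = \<zero>\<^bsub>M\<^esub>" using c assms(5) by simp
  finally show False using assms(6) by simp
qed

section \<open>Inverting copies, and tensor products of functors as quotients\<close>

context presheaves
begin

text \<open>Copying along an injection is an isomorphism. The direction from the copy to the
  original is the one that \<open>psh_iso\<close> asks for in \<open>serre_plus_n\<close>.\<close>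

lemma quot_psh_inv_nat_trans:
  assumes P: "P \<in> A_of k U" and inj: "\<And>G. G \<in> U \<Longrightarrow> inj_on (r G) (carrier (obj P G))"
  shows "(\<lambda>G. inv_into (carrier (obj P G)) (r G)) \<in> nat_trans k U (quot_psh P r) P"
proof (rule nat_transI)
  let ?Q = "quot_psh P r"
  let ?i = "\<lambda>G. inv_into (carrier (obj P G)) (r G)"
  note r = inj_coset_map[OF P inj] and Z = subfunctor_zero[OF P]
  note inv = inv_into_f_f[OF inj]
  fix G assume G: "G \<in> U"
  interpret module k "obj P G" by (rule A_of_module[OF P G])
  note hom = quot_psh_hom[OF P Z r G]
  show "?i G \<in> module_hom k (obj ?Q G) (obj P G)"
  proof (rule module_homI)
    fix z assume "z \<in> carrier (obj ?Q G)"
    then obtain x where x: "x \<in> carrier (obj P G)" "z = r G x" by auto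
    show "?i G z \<in> carrier (obj P G)" using x inv[OF G x(1)] by simp
    show "?i G (c \<odot>\<^bsub>obj ?Q G\<^esub> z) = c \<odot>\<^bsub>obj P G\<^esub> ?i G z"
      if c: "c \<in> carrier k" for c
      using x inv[OF G x(1)] inv[OF G smult_closed[OF c x(1)]] module_hom_smult[OF hom c x(1)] by simp
    fix w assume "w \<in> carrier (obj ?Q G)"
    then obtain y where y: "y \<in> carrier (obj P G)" "w = r G y" by auto
    show "?i G (z \<oplus>\<^bsub>obj ?Q G\<^esub> w) =
        ?i G z \<oplus>\<^bsub>obj P G\<^esub> ?i G w"
      using x y inv[OF G x(1)] inv[OF G y(1)] inv[OF G M.a_closed[OF x(1) y(1)]] module_hom_add[OF hom x(1) y(1)] by simp
  qed
  fix H \<alpha> z assume H: "H \<in> U" "\<alpha> \<in> Hom G H" and "z \<in> carrier (obj ?Q H)"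
  then obtain x where x: "x \<in> carrier (obj P H)" "z = r H x" by auto
  show "?i G (act ?Q G H \<alpha> z) = act P G H \<alpha> (?i H z)"
    using x inv[OF H(1) x(1)] inv[OF G A_of_act_mem[OF P G H x(1)]] quot_psh_act[OF P Z r G H x(1)] by simp
qed

text \<open>The tensor product before the bilinear relations are imposed. As a functor in its own
  right it can be divided by them with any labels for the cosets; \<open>tensor_psh\<close>
  corresponds to labelling each coset by itself.\<close>

definition tensor_free_psh :: "('a, 'k, 'v) presheaf \<Rightarrow> ('a, 'k, 'w) presheaf \<Rightarrow> ('a, 'k, 'v \<times> 'w \<Rightarrow> 'k) presheaf" where
  "tensor_free_psh Y E = \<lparr>obj = (\<lambda>H. free_module k (carrier (obj Y H) \<times> carrier (obj E H))),
     act = (\<lambda>G H \<alpha>. free_map k (map_prod (act Y G H \<alpha>) (act E G H \<alpha>)))\<rparr>"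

lemma tensor_free_psh_simps:
  "obj (tensor_free_psh Y E) H = free_module k (carrier (obj Y H) \<times> carrier (obj E H))"
  "act (tensor_free_psh Y E) G H \<alpha> = free_map k (map_prod (act Y G H \<alpha>) (act E G H \<alpha>))"
  by (simp_all add: tensor_free_psh_def)

context
  fixes Y :: "('a, 'k, 'v) presheaf" and E :: "('a, 'k, 'w) presheaf"
  assumes Y: "Y \<in> A_of k U" and E: "E \<in> A_of k U"
begin

lemma map_prod_act_funcset:
  "G \<in> U \<Longrightarrow> H \<in> U \<Longrightarrow> \<alpha> \<in> Hom G H \<Longrightarrow>
    map_prod (act Y G H \<alpha>) (act E G H \<alpha>) \<in> carrier (obj Y H) \<times> carrier (obj E H) \<rightarrow> carrier (obj Y G) \<times> carrier (obj E G)"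
  using A_of_act_mem[OF Y] A_of_act_mem[OF E] by auto

lemma tensor_free_psh_A_of: "tensor_free_psh Y E \<in> A_of k U"
proof (rule A_ofI)
  let ?T = "tensor_free_psh Y E"
  show "act ?T G G (id_cls G) x = x" if "G \<in> U" "x \<in> carrier (obj ?T G)" for G x
    unfolding tensor_free_psh_simps
    by (rule free_map_ident[OF cring_k, of "carrier (obj Y G) \<times> carrier (obj E G)"])
       (use that in \<open>auto simp: tensor_free_psh_simps A_of_id[OF Y] A_of_id[OF E]\<close>)
  show "act ?T G K (comp_cls G \<beta> \<alpha>) x = act ?T G H \<alpha> (act ?T H K \<beta> x)"
    if GHK: "G \<in> U" "H \<in> U" "K \<in> U" "\<alpha> \<in> Hom G H" "\<beta> \<in> Hom H K" and x: "x \<in> carrier (obj ?T K)" for G H K \<alpha> \<beta> x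
    unfolding tensor_free_psh_simps
    by (rule free_map_compose[OF cring_k map_prod_act_funcset[OF GHK(2,3,5)] map_prod_act_funcset[OF GHK(1,2,4)]])
       (use x in \<open>auto simp: tensor_free_psh_simps A_of_comp[OF Y GHK] A_of_comp[OF E GHK]\<close>)
qed (simp_all add: tensor_free_psh_simps free_module_module[OF cring_k] free_map_hom[OF cring_k map_prod_act_funcset])

text \<open>The action is linear in both factors, so it sends each of the four kinds of bilinear
  relation to one of the same kind.\<close>

lemma tensor_ker_subfunctor: "is_subfunctor k U (tensor_free_psh Y E) (\<lambda>H. tensor_ker k (obj Y H) (obj E H))"
proof (rule subfunctorI)
  show "submodule k (tensor_ker k (obj Y G) (obj E G)) (obj (tensor_free_psh Y E) G)" if "G \<in> U" for G
    unfolding tensor_free_psh_simps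
    by (rule tensor_ker_submodule[OF cring_k A_of_module[OF Y that] A_of_module[OF E that]])
  fix G H \<alpha> x assume GH: "G \<in> U" "H \<in> U" "\<alpha> \<in> Hom G H" and x: "x \<in> tensor_ker k (obj Y H) (obj E H)"
  let ?\<phi> = "act Y G H \<alpha>" and ?\<psi> = "act E G H \<alpha>"
  let ?f = "free_map k (map_prod ?\<phi> ?\<psi>)"
  let ?F = "free_module k (carrier (obj Y H) \<times> carrier (obj E H))"
  let ?F' = "free_module k (carrier (obj Y G) \<times> carrier (obj E G))"
  let ?K' = "tensor_ker k (obj Y G) (obj E G)"
  note YH = A_of_module[OF Y GH(2)] and EH = A_of_module[OF E GH(2)]
  note YG = A_of_module[OF Y GH(1)] and EG = A_of_module[OF E GH(1)]
  interpret YH: module k "obj Y H" by (rule YH)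
  interpret EH: module k "obj E H" by (rule EH)
  interpret F: module k ?F by (rule free_module_module[OF cring_k])
  interpret F': module k ?F' by (rule free_module_module[OF cring_k])
  have f: "?f \<in> module_hom k ?F ?F'" by (rule free_map_hom[OF cring_k map_prod_act_funcset[OF GH]])
  have \<phi>: "?\<phi> \<in> module_hom k (obj Y H) (obj Y G)" and \<psi>: "?\<psi> \<in> module_hom k (obj E H) (obj E G)"
    using A_of_act_hom[OF Y GH] A_of_act_hom[OF E GH] .
  have fb: "?f (free_basis k (m, n)) = free_basis k (?\<phi> m, ?\<psi> n)"
    if "m \<in> carrier (obj Y H)" "n \<in> carrier (obj E H)" for m n
    using free_map_basis[OF cring_k, of "map_prod ?\<phi> ?\<psi>" "(m, n)" "carrier (obj Y G) \<times> carrier (obj E G)"]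
      module_hom_mem[OF \<phi> that(1)] module_hom_mem[OF \<psi> that(2)] by simp
  note bm = basis_mem[OF cring_k YH EH]
  note rels = bilinear_rels_subset_ker[OF cring_k YG EG]
  have "tensor_ker k (obj Y H) (obj E H) \<subseteq> {x \<in> carrier ?F. ?f x \<in> ?K'}"
  proof (rule tensor_ker_least[OF cring_k YH EH submodule_vimage[OF F.module_axioms f tensor_ker_submodule[OF cring_k YG EG]]], rule subsetI)
    fix x assume x: "x \<in> bilinear_rels k (obj Y H) (obj E H)"
    then have xc: "x \<in> carrier ?F" using bilinear_rels_carrier[OF cring_k YH EH] by blast
    note hm = module_hom_minus[OF F.module_axioms F'.module_axioms f]
    from x have "?f x \<in> bilinear_rels k (obj Y G) (obj E G)"
    proof (cases rule: bilinear_rels_cases[OF cring_k YH EH, consumes 1, case_names left right lscale rscale])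
      case (left m m' n)
      have "?f x = free_basis k (?\<phi> m \<oplus>\<^bsub>obj Y G\<^esub> ?\<phi> m', ?\<psi> n) \<ominus>\<^bsub>?F'\<^esub> (free_basis k (?\<phi> m, ?\<psi> n) \<oplus>\<^bsub>?F'\<^esub> free_basis k (?\<phi> m', ?\<psi> n))"
        unfolding left(4) hm[OF bm[OF YH.M.a_closed[OF left(1,2)] left(3)] F.M.a_closed[OF bm[OF left(1,3)] bm[OF left(2,3)]]]
          module_hom_add[OF f bm[OF left(1,3)] bm[OF left(2,3)]] fb[OF YH.M.a_closed[OF left(1,2)] left(3)]
          fb[OF left(1,3)] fb[OF left(2,3)] module_hom_add[OF \<phi> left(1,2)] by (rule refl)
      then show ?thesis unfolding bilinear_rels_def Let_def
        using module_hom_mem[OF \<phi> left(1)] module_hom_mem[OF \<phi> left(2)] module_hom_mem[OF \<psi> left(3)] by blast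
    next
      case (right m n n')
      have "?f x = free_basis k (?\<phi> m, ?\<psi> n \<oplus>\<^bsub>obj E G\<^esub> ?\<psi> n') \<ominus>\<^bsub>?F'\<^esub> (free_basis k (?\<phi> m, ?\<psi> n) \<oplus>\<^bsub>?F'\<^esub> free_basis k (?\<phi> m, ?\<psi> n'))"
        unfolding right(4) hm[OF bm[OF right(1) EH.M.a_closed[OF right(2,3)]] F.M.a_closed[OF bm[OF right(1,2)] bm[OF right(1,3)]]]
          module_hom_add[OF f bm[OF right(1,2)] bm[OF right(1,3)]] fb[OF right(1) EH.M.a_closed[OF right(2,3)]]
          fb[OF right(1,2)] fb[OF right(1,3)] module_hom_add[OF \<psi> right(2,3)] by (rule refl)
      then show ?thesis unfolding bilinear_rels_def Let_def
        using module_hom_mem[OF \<phi> right(1)] module_hom_mem[OF \<psi> right(2)] module_hom_mem[OF \<psi> right(3)] by blast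
    next
      case (lscale c m n)
      have "?f x = free_basis k (c \<odot>\<^bsub>obj Y G\<^esub> ?\<phi> m, ?\<psi> n) \<ominus>\<^bsub>?F'\<^esub> (c \<odot>\<^bsub>?F'\<^esub> free_basis k (?\<phi> m, ?\<psi> n))"
        unfolding lscale(4) hm[OF bm[OF YH.smult_closed[OF lscale(1,2)] lscale(3)] F.smult_closed[OF lscale(1) bm[OF lscale(2,3)]]]
          module_hom_smult[OF f lscale(1) bm[OF lscale(2,3)]] fb[OF YH.smult_closed[OF lscale(1,2)] lscale(3)]
          fb[OF lscale(2,3)] module_hom_smult[OF \<phi> lscale(1,2)] by (rule refl)
      then show ?thesis unfolding bilinear_rels_def Let_def
        using lscale(1) module_hom_mem[OF \<phi> lscale(2)] module_hom_mem[OF \<psi> lscale(3)] by blast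
    next
      case (rscale c m n)
      have "?f x = free_basis k (?\<phi> m, c \<odot>\<^bsub>obj E G\<^esub> ?\<psi> n) \<ominus>\<^bsub>?F'\<^esub> (c \<odot>\<^bsub>?F'\<^esub> free_basis k (?\<phi> m, ?\<psi> n))"
        unfolding rscale(4) hm[OF bm[OF rscale(2) EH.smult_closed[OF rscale(1,3)]] F.smult_closed[OF rscale(1) bm[OF rscale(2,3)]]]
          module_hom_smult[OF f rscale(1) bm[OF rscale(2,3)]] fb[OF rscale(2) EH.smult_closed[OF rscale(1,3)]]
          fb[OF rscale(2,3)] module_hom_smult[OF \<psi> rscale(1,3)] by (rule refl)
      then show ?thesis unfolding bilinear_rels_def Let_def
        using rscale(1) module_hom_mem[OF \<phi> rscale(2)] module_hom_mem[OF \<psi> rscale(3)] by blast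
    qed
    then show "x \<in> {x \<in> carrier ?F. ?f x \<in> ?K'}" using xc rels by blast
  qed
  then show "act (tensor_free_psh Y E) G H \<alpha> x \<in> ?K'" using x by (auto simp: tensor_free_psh_simps)
qed

text \<open>The fibre of \<open>r\<close> over a label is the coset with that label, and passing to
  the fibre is the isomorphism. The tensor product may thus be represented by any labelling of the
  cosets, in whatever type.\<close>

lemma quot_tensor_free_psh_iso:
  assumes r: "coset_map (tensor_free_psh Y E) (\<lambda>H. tensor_ker k (obj Y H) (obj E H)) r"
  shows "psh_iso k U (quot_psh (tensor_free_psh Y E) r) (tensor_psh k Y E)"
proof -
  let ?P = "tensor_free_psh Y E" and ?K = "\<lambda>H. tensor_ker k (obj Y H) (obj E H)"
  let ?Z = "quot_psh ?P r"
  let ?c = "\<lambda>H f. ?K H +>\<^bsub>obj ?P H\<^esub> f"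
  let ?T = "tensor_psh k Y E"
  note PA = tensor_free_psh_A_of and K = tensor_ker_subfunctor
  note rhom = quot_psh_hom[OF PA K r] and Ksub = subfunctor_submodule[OF K]
  define \<eta> where "\<eta> = (\<lambda>H z. {f \<in> carrier (obj ?P H). r H f = z})"
  have \<eta>: "\<eta> H (r H f) = ?c H f" if "H \<in> U" "f \<in> carrier (obj ?P H)" for H f
    unfolding a_r_coset_eq_class[OF Ksub[OF that(1)] that(2)] \<eta>_def using coset_mapD[OF r that(1) _ that(2)] by blast
  have coset_eq: "?c H f = ?c H g"
    if "H \<in> U" "f \<in> carrier (obj ?P H)" "g \<in> carrier (obj ?P H)" "f \<ominus>\<^bsub>obj ?P H\<^esub> g \<in> ?K H" for H f g
    using \<eta>[OF that(1,2)] \<eta>[OF that(1,3)] coset_mapD[OF r that(1-3)] that(4) by simp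
  have T: "carrier (obj ?T H) = (\<lambda>f. ?c H f) ` carrier (obj ?P H)"
    "A \<oplus>\<^bsub>obj ?T H\<^esub> B = A <+>\<^bsub>obj ?P H\<^esub> B"
    "c \<odot>\<^bsub>obj ?T H\<^esub> A = (\<Union>x\<in>A. ?c H (c \<odot>\<^bsub>obj ?P H\<^esub> x))"
    "act ?T G H \<alpha> A = (\<Union>f\<in>A. ?c G (act ?P G H \<alpha> f))" for H A B c G \<alpha>
    by (auto simp: tensor_psh_def tensor_module_def quot_module_def tensor_free_psh_simps A_RCOSETS_def' tensor_map_def)
  have self: "f \<in> ?c H f" if "H \<in> U" "f \<in> carrier (obj ?P H)" for H f
    using \<eta>[OF that] that(2) by (auto simp: \<eta>_def)
  have elem: "g \<in> carrier (obj ?P H) \<and> g \<ominus>\<^bsub>obj ?P H\<^esub> f \<in> ?K H"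
    if "H \<in> U" "f \<in> carrier (obj ?P H)" "g \<in> ?c H f" for H f g
    using a_r_coset_eq_class[OF Ksub[OF that(1)] that(2)] that(3) by blast
  have "\<eta> \<in> nat_trans k U ?Z ?T"
  proof (rule nat_transI)
    fix H assume H: "H \<in> U"
    interpret P: module k "obj ?P H" by (rule A_of_module[OF PA H])
    interpret KH: submodule k "?K H" "obj ?P H" by (rule Ksub[OF H])
    show "\<eta> H \<in> module_hom k (obj ?Z H) (obj ?T H)"
    proof (rule module_homI)
      fix z assume "z \<in> carrier (obj ?Z H)"
      then obtain f where f: "f \<in> carrier (obj ?P H)" and z: "z = r H f" by auto
      show "\<eta> H z \<in> carrier (obj ?T H)" unfolding z \<eta>[OF H f] T using f by blast
      show "\<eta> H (c \<odot>\<^bsub>obj ?Z H\<^esub> z) = c \<odot>\<^bsub>obj ?T H\<^esub> \<eta> H z" if c: "c \<in> carrier k" for c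
      proof -
        \<comment> \<open>\<open>tensor_psh\<close> takes a union over all representatives of a
          coset, so each of them has to yield the same result.\<close>
        have "?c H (c \<odot>\<^bsub>obj ?P H\<^esub> g) = ?c H (c \<odot>\<^bsub>obj ?P H\<^esub> f)"
          if g: "g \<in> ?c H f" for g
        proof (rule coset_eq[OF H])
          note gm = elem[OF H f g]
          show "c \<odot>\<^bsub>obj ?P H\<^esub> g \<in> carrier (obj ?P H)" "c \<odot>\<^bsub>obj ?P H\<^esub> f \<in> carrier (obj ?P H)"
            using gm f c by auto
          have "c \<odot>\<^bsub>obj ?P H\<^esub> g \<ominus>\<^bsub>obj ?P H\<^esub> c \<odot>\<^bsub>obj ?P H\<^esub> f = c \<odot>\<^bsub>obj ?P H\<^esub> (g \<ominus>\<^bsub>obj ?P H\<^esub> f)"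
            using gm f c by (simp add: a_minus_def P.smult_r_distr P.smult_r_minus)
          then show "c \<odot>\<^bsub>obj ?P H\<^esub> g \<ominus>\<^bsub>obj ?P H\<^esub> c \<odot>\<^bsub>obj ?P H\<^esub> f \<in> ?K H" using gm c by simp
        qed
        then have "c \<odot>\<^bsub>obj ?T H\<^esub> \<eta> H z = ?c H (c \<odot>\<^bsub>obj ?P H\<^esub> f)"
          unfolding z \<eta>[OF H f] T using self[OF H f] by blast
        also have "\<dots> = \<eta> H (c \<odot>\<^bsub>obj ?Z H\<^esub> z)"
          unfolding z module_hom_smult[OF rhom[OF H] c f, symmetric] by (rule \<eta>[OF H P.smult_closed[OF c f], symmetric])
        finally show ?thesis ..
      qed
      fix w assume "w \<in> carrier (obj ?Z H)"
      then obtain g where g: "g \<in> carrier (obj ?P H)" and w: "w = r H g" by auto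
      have "\<eta> H (z \<oplus>\<^bsub>obj ?Z H\<^esub> w) = ?c H (f \<oplus>\<^bsub>obj ?P H\<^esub> g)"
        unfolding z w module_hom_add[OF rhom[OF H] f g, symmetric] by (rule \<eta>[OF H P.M.a_closed[OF f g]])
      also have "\<dots> = \<eta> H z <+>\<^bsub>obj ?P H\<^esub> \<eta> H w"
        unfolding z w \<eta>[OF H f] \<eta>[OF H g]
      proof (intro equalityI subsetI)
        fix u assume "u \<in> ?c H (f \<oplus>\<^bsub>obj ?P H\<^esub> g)"
        then obtain h where h: "h \<in> ?K H" and u: "u = h \<oplus>\<^bsub>obj ?P H\<^esub> (f \<oplus>\<^bsub>obj ?P H\<^esub> g)" by (auto simp: a_r_coset_def')
        have "u = (h \<oplus>\<^bsub>obj ?P H\<^esub> f) \<oplus>\<^bsub>obj ?P H\<^esub> g"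
          unfolding u using P.M.a_assoc[OF subsetD[OF KH.subset h] f g] by simp
        moreover have "h \<oplus>\<^bsub>obj ?P H\<^esub> f \<in> ?c H f" using h by (auto simp: a_r_coset_def')
        ultimately show "u \<in> (?c H f) <+>\<^bsub>obj ?P H\<^esub> (?c H g)"
          using self[OF H g] unfolding set_add_def' by blast
      next
        fix u assume "u \<in> (?c H f) <+>\<^bsub>obj ?P H\<^esub> (?c H g)"
        then obtain h h' where h: "h \<in> ?K H" "h' \<in> ?K H" and u: "u = (h \<oplus>\<^bsub>obj ?P H\<^esub> f) \<oplus>\<^bsub>obj ?P H\<^esub> (h' \<oplus>\<^bsub>obj ?P H\<^esub> g)"
          unfolding set_add_def' a_r_coset_def' by blast
        have "h \<in> carrier (obj ?P H)" "h' \<in> carrier (obj ?P H)" using h KH.subset by auto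
        then have "u = (h \<oplus>\<^bsub>obj ?P H\<^esub> h') \<oplus>\<^bsub>obj ?P H\<^esub> (f \<oplus>\<^bsub>obj ?P H\<^esub> g)"
          using f g by (simp only: u P.M.a_ac P.M.a_closed)
        then show "u \<in> ?c H (f \<oplus>\<^bsub>obj ?P H\<^esub> g)"
          unfolding a_r_coset_def' using KH.m_closed[OF h] by blast
      qed
      finally show "\<eta> H (z \<oplus>\<^bsub>obj ?Z H\<^esub> w) = \<eta> H z \<oplus>\<^bsub>obj ?T H\<^esub> \<eta> H w" by (simp only: T)
    qed
    fix G \<alpha> z assume G: "G \<in> U" "\<alpha> \<in> Hom G H" and "z \<in> carrier (obj ?Z H)"
    then obtain f where f: "f \<in> carrier (obj ?P H)" and z: "z = r H f" by auto
    note GH = G(1) H G(2)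
    have "?c G (act ?P G H \<alpha> g) = ?c G (act ?P G H \<alpha> f)"
      if g: "g \<in> ?c H f" for g
    proof (rule coset_eq[OF G(1)])
      note gm = elem[OF H f g]
      show "act ?P G H \<alpha> g \<in> carrier (obj ?P G)" "act ?P G H \<alpha> f \<in> carrier (obj ?P G)"
        using A_of_act_mem[OF PA GH] gm f by auto
      show "act ?P G H \<alpha> g \<ominus>\<^bsub>obj ?P G\<^esub> act ?P G H \<alpha> f \<in> ?K G"
        using subfunctor_act[OF K GH conjunct2[OF gm]]
          module_hom_minus[OF A_of_module[OF PA H] A_of_module[OF PA G(1)] A_of_act_hom[OF PA GH] conjunct1[OF gm] f] by simp
    qed
    then have "act ?T G H \<alpha> (\<eta> H z) = ?c G (act ?P G H \<alpha> f)"
      unfolding z \<eta>[OF H f] T using self[OF H f] by blast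
    also have "\<dots> = \<eta> G (act ?Z G H \<alpha> z)"
      unfolding z quot_psh_act[OF PA K r GH f] by (rule \<eta>[OF G(1) A_of_act_mem[OF PA GH f], symmetric])
    finally show "\<eta> G (act ?Z G H \<alpha> z) = act ?T G H \<alpha> (\<eta> H z)" ..
  qed
  moreover have "bij_betw (\<eta> H) (carrier (obj ?Z H)) (carrier (obj ?T H))" if H: "H \<in> U" for H
  proof (rule bij_betw_imageI)
    show "inj_on (\<eta> H) (carrier (obj ?Z H))" by (rule inj_onI) (auto simp: \<eta>_def)
    show "\<eta> H ` carrier (obj ?Z H) = carrier (obj ?T H)"
      unfolding T carrier_quot_psh image_image using \<eta>[OF H] by simp
  qed
  ultimately show ?thesis unfolding psh_iso_def by blast
qed

end

section \<open>The support theorem\<close>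

lemma generates_epi:
  assumes X: "X \<in> A_of k U" and S: "generates X S (\<lambda>G. carrier (obj X G))" and \<eta>: "\<eta> \<in> psh_epi k U X Y"
  shows "generates Y ((\<lambda>(G, x). (G, \<eta> G x)) ` S) (\<lambda>G. carrier (obj Y G))"
proof (rule generatesI)
  have nt: "\<eta> \<in> nat_trans k U X Y" and sur: "\<And>H. H \<in> U \<Longrightarrow> \<eta> H ` carrier (obj X H) = carrier (obj Y H)"
    using \<eta> by (simp_all add: psh_epi_def)
  show "G \<in> U \<and> y \<in> carrier (obj Y G)" if "(G, y) \<in> (\<lambda>(G, x). (G, \<eta> G x)) ` S" for G y
    using that generates_mem[OF S] nat_trans_mem[OF nt] by auto
  fix Q H y assume Q: "is_subfunctor k U Y Q" "\<And>G y. (G, y) \<in> (\<lambda>(G, x). (G, \<eta> G x)) ` S \<Longrightarrow> y \<in> Q G"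
    and H: "H \<in> U" and "y \<in> carrier (obj Y H)"
  then obtain x where x: "x \<in> carrier (obj X H)" "y = \<eta> H x" using sur[OF H] by blast
  have "x \<in> {x \<in> carrier (obj X H). \<eta> H x \<in> Q H}"
    by (rule generatesD[OF S subfunctor_vimage[OF X nt Q(1)] _ H x(1)])
       (use Q(2) generates_mem[OF S] in force)
  then show "y \<in> Q H" using x by simp
qed

text \<open>The image is a subfunctor that contains the generator \<open>x\<close>.\<close>

lemma yoneda_epi:
  assumes X: "X \<in> A_of k U" and gen: "generates X {(G, x)} (\<lambda>G. carrier (obj X G))"
  shows "yoneda X G x \<in> psh_epi k U (e_psh k G) X"
proof -
  have G: "G \<in> U" and x: "x \<in> carrier (obj X G)" using generates_mem[OF gen, of G x] by auto
  note nt = yoneda_nat_trans[OF X G x] and eA = e_psh_A_of[OF G]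
  note im = subfunctor_image[OF X nt subfunctor_carrier[OF eA]]
  have "free_basis k (id_cls G) \<in> carrier (obj (e_psh k G) G)"
    by (simp add: e_psh_simps free_basis_mem[OF cring_k id_cls_Hom])
  then have "x \<in> yoneda X G x G ` carrier (obj (e_psh k G) G)"
    using yoneda_ident[OF X G x] by force
  then have "carrier (obj X H) \<subseteq> yoneda X G x H ` carrier (obj (e_psh k G) H)" if "H \<in> U" for H
    using generatesD[OF gen im _ that] by blast
  then show ?thesis using nt nat_trans_mem[OF nt] unfolding psh_epi_def by blast
qed

text \<open>The bound on the order makes \<alpha> an isomorphism, so its action has a left
  inverse.\<close>

lemma act_eq_zero:
  assumes X: "X \<in> A_of k U" and G: "G \<in> U" and H: "H \<in> U" and \<alpha>: "\<alpha> \<in> Hom H G" and o: "order H \<le> order G"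
    and x: "x \<in> carrier (obj X G)" "act X H G \<alpha> x = \<zero>\<^bsub>obj X H\<^esub>"
  shows "x = \<zero>\<^bsub>obj X G\<^esub>"
proof -
  obtain \<beta> where \<beta>: "\<beta> \<in> Hom G H" "comp_cls G \<alpha> \<beta> = id_cls G"
    using Hom_inverse[OF group_U[OF H] finite_U[OF H] group_U[OF G] \<alpha> o] by blast
  have "x = act X G H \<beta> (act X H G \<alpha> x)"
    using A_of_comp[OF X G H G \<beta>(1) \<alpha> x(1)] A_of_id[OF X G x(1)] \<beta>(2) by simp
  also have "\<dots> = \<zero>\<^bsub>obj X G\<^esub>"
    unfolding x(2) by (rule module_hom_zero[OF A_of_module[OF X H] A_of_module[OF X G] A_of_act_hom[OF X G H \<beta>(1)]])
  finally show ?thesis .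
qed

lemma nonzero_iso:
  assumes X: "X \<in> A_of k U" and G: "G \<in> U" and H: "H \<in> U" and iso: "H \<cong> G"
    and ne: "carrier (obj X G) \<noteq> {\<zero>\<^bsub>obj X G\<^esub>}"
  shows "carrier (obj X H) \<noteq> {\<zero>\<^bsub>obj X H\<^esub>}"
proof
  assume 0: "carrier (obj X H) = {\<zero>\<^bsub>obj X H\<^esub>}"
  obtain \<alpha> where \<alpha>: "\<alpha> \<in> Hom H G" using is_iso_Hom[OF iso] by blast
  have "x = \<zero>\<^bsub>obj X G\<^esub>" if "x \<in> carrier (obj X G)" for x
    using act_eq_zero[OF X G H \<alpha> _ that] A_of_act_mem[OF X H G \<alpha> that] is_iso_order[OF iso] 0 by auto
  then show False using ne submodule.zero_closed[OF submodule_carrier[OF A_of_module[OF X G]]] by blast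
qed

text \<open>\<open>supp\<close> asks for some representative of the class; since vanishing is
  invariant under isomorphism of groups, every representative decides.\<close>

lemma supp_iff:
  assumes X: "X \<in> A_of k U" and G: "G \<in> U"
  shows "iso_class U G \<in> supp U X \<longleftrightarrow> carrier (obj X G) \<noteq> {\<zero>\<^bsub>obj X G\<^esub>}"
proof
  assume "iso_class U G \<in> supp U X"
  then obtain H where H: "H \<in> U" "iso_class U G = iso_class U H" "carrier (obj X H) \<noteq> {\<zero>\<^bsub>obj X H\<^esub>}"
    by (auto simp: supp_def)
  have "H \<in> iso_class U H" using H(1) by (simp add: iso_class_def iso_refl)
  then have "G \<cong> H" using H(2) by (metis (no_types, lifting) iso_class_def mem_Collect_eq)
  then show "carrier (obj X G) \<noteq> {\<zero>\<^bsub>obj X G\<^esub>}" using nonzero_iso[OF X H(1) G _ H(3)] by blast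
qed (use G in \<open>auto simp: supp_def pi0_def\<close>)

text \<open>The functor \<open>e\<^sub>G\<close> takes finite-dimensional values, so it has a copy with values in \<open>'v\<close> as soon as \<open>'v\<close>
  contains a copy of the infinite field.\<close>

lemma ex_e_psh_copy:
  assumes inf: "infinite (UNIV :: 'v set)" and j: "inj_on (j :: 'k \<Rightarrow> 'v) (carrier k)" and G: "G \<in> U"
  shows "\<exists>r :: 'a monoid \<Rightarrow> (('a \<Rightarrow> 'a) set \<Rightarrow> 'k) \<Rightarrow> 'v. \<forall>H\<in>U. inj_on (r H) (carrier (obj (e_psh k G) H))"
proof (rule bchoice, rule ballI)
  fix H assume H: "H \<in> U"
  have "finite (Hom H G)" using finite_Hom finite_U group_U G H by blast
  then obtain c :: "(('a \<Rightarrow> 'a) set \<Rightarrow> 'v) \<Rightarrow> 'v" where c: "inj_on c (PiE (Hom H G) (\<lambda>_. UNIV))"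
    using ex_inj_PiE[OF inf] by blast
  let ?F = "free_module k (Hom H G)"
  have "inj_on (\<lambda>f. c (\<lambda>\<beta>\<in>Hom H G. j (f \<beta>))) (carrier ?F)"
  proof (rule inj_onI)
    fix f g assume f: "f \<in> carrier ?F" and g: "g \<in> carrier ?F"
      and "c (\<lambda>\<beta>\<in>Hom H G. j (f \<beta>)) = c (\<lambda>\<beta>\<in>Hom H G. j (g \<beta>))"
    then have "(\<lambda>\<beta>\<in>Hom H G. j (f \<beta>)) = (\<lambda>\<beta>\<in>Hom H G. j (g \<beta>))"
      using inj_onD[OF c] by simp
    then have "j (f \<beta>) = j (g \<beta>)" if "\<beta> \<in> Hom H G" for \<beta> using that by (metis restrict_apply')
    then have "f \<beta> = g \<beta>" if "\<beta> \<in> Hom H G" for \<beta>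
      using inj_onD[OF j] that free_module_value[OF cring_k f] free_module_value[OF cring_k g] by blast
    then show "f = g"
      using free_moduleD(2)[OF f] free_moduleD(2)[OF g] by (metis ext)
  qed
  then show "\<exists>r :: _ \<Rightarrow> 'v. inj_on r (carrier (obj (e_psh k G) H))"
    unfolding e_psh_simps by (rule exI[where x = "\<lambda>f. c (\<lambda>\<beta>\<in>Hom H G. j (f \<beta>))"])
qed

text \<open>The map \<open>e\<^sub>G \<rightarrow> Y \<otimes> e\<^sub>G\<close> given by \<open>id \<mapsto> y \<otimes> id\<close> is injective on all groups not larger than \<open>G\<close>: there \<open>e\<^sub>G\<close> is
  spanned by isomorphisms \<open>\<beta>\<close>, which go to \<open>\<beta>\<^sup>*y \<otimes> \<beta>\<close>. Hence every quotient of \<open>e\<^sub>G\<close> that vanishes on larger groups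
  is a subquotient of \<open>Y \<otimes> e\<^sub>G\<close>.\<close>

lemma serre_ideal_bottom:
  fixes D :: "('a, 'k, 'v) presheaf set"
  assumes D: "serre_ideal k U D" and noeth: "noetherian k U" and Y: "Y \<in> D"
    and inf: "infinite (UNIV :: 'v set)"
    and G: "G \<in> U" and y: "y \<in> carrier (obj Y G)" "y \<noteq> \<zero>\<^bsub>obj Y G\<^esub>"
    and re: "\<And>H. H \<in> U \<Longrightarrow> inj_on (re H :: _ \<Rightarrow> 'v) (carrier (obj (e_psh k G) H))"
    and C: "C \<in> A_of k U" and gen: "generates C {(G, x)} (\<lambda>G. carrier (obj C G))"
    and C0: "\<And>H. H \<in> U \<Longrightarrow> order G < order H \<Longrightarrow> carrier (obj C H) = {\<zero>\<^bsub>obj C H\<^esub>}"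
  shows "C \<in> D"
proof -
  let ?e = "e_psh k G"
  have ss: "serre_subcat k U D" using D by (simp add: serre_ideal_def)
  have YA: "Y \<in> A_of k U" using ss Y by (auto simp: serre_subcat_def Ac_of_def)
  note eA = e_psh_A_of[OF G]
  note rem = inj_coset_map[OF eA re] and e0 = subfunctor_zero[OF eA]
  \<comment> \<open>A copy of the representable in \<open>'v\<close>, to which the ideal property of
    \<open>D\<close> can be applied together with \<open>Y\<close>.\<close>
  define E where "E = quot_psh ?e re"
  have EA: "E \<in> A_of k U" unfolding E_def by (rule quot_psh_A_of[OF eA e0 rem])
  have "fin_gen k U E" unfolding E_def by (rule fin_gen_epi[OF fin_gen_e_psh[OF G] quot_psh_epi[OF eA e0 rem]])
  then have Ec: "E \<in> Ac_of k U" using EA by (simp add: Ac_of_def)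
  \<comment> \<open>The map from the copy back to the representable. Its values are coordinates on
    \<open>E\<close>, with \<open>b\<close> below as the corresponding basis.\<close>
  define \<iota> where "\<iota> = (\<lambda>H. inv_into (carrier (obj ?e H)) (re H))"
  have \<iota>: "\<iota> \<in> nat_trans k U E ?e"
    unfolding \<iota>_def E_def by (rule quot_psh_inv_nat_trans[OF eA re])
  define b where "b = (\<lambda>H \<beta>. re H (free_basis k \<beta>))"
  have basis: "free_basis k \<beta> \<in> carrier (obj ?e H)" if "\<beta> \<in> Hom H G" for H \<beta>
    using free_basis_mem[OF cring_k that] by (simp add: e_psh_simps)
  have b: "b H \<beta> \<in> carrier (obj E H)" if "H \<in> U" "\<beta> \<in> Hom H G" for H \<beta>
    using basis[OF that(2)] by (simp add: b_def E_def)
  have \<iota>b: "\<iota> H (b H \<beta>) = free_basis k \<beta>" if "H \<in> U" "\<beta> \<in> Hom H G" for H \<beta>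
    unfolding b_def \<iota>_def by (rule inv_into_f_f[OF re[OF that(1)] basis[OF that(2)]])
  have \<iota>hom: "\<iota> H \<in> module_hom k (obj E H) (free_module k (Hom H G))" if "H \<in> U" for H
    using nat_trans_hom[OF \<iota> that] by (simp add: e_psh_simps)
  have \<iota>inj: "inj_on (\<iota> H) (carrier (obj E H))" for H
    unfolding \<iota>_def E_def carrier_quot_psh by (rule inj_on_inv_into) simp
  have fin: "finite (Hom H G)" if "H \<in> U" for H using finite_Hom finite_U group_U G that by blast
  let ?P = "tensor_free_psh Y E" and ?K = "\<lambda>H. tensor_ker k (obj Y H) (obj E H)"
  note PA = tensor_free_psh_A_of[OF YA EA] and K = tensor_ker_subfunctor[OF YA EA]
  define \<psi> where "\<psi> = (\<lambda>H. tensor_coord k (obj Y H) (\<iota> H))"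
  have coords: "cring k" "module k (obj Y H)" "module k (obj E H)" "finite (Hom H G)"
    "\<iota> H \<in> module_hom k (obj E H) (free_module k (Hom H G))" "inj_on (\<iota> H) (carrier (obj E H))"
    "\<And>\<beta>. \<beta> \<in> Hom H G \<Longrightarrow> b H \<beta> \<in> carrier (obj E H)"
    "\<And>\<beta>. \<beta> \<in> Hom H G \<Longrightarrow> \<iota> H (b H \<beta>) = free_basis k \<beta>" if "H \<in> U" for H
    by (rule cring_k A_of_module[OF YA that] A_of_module[OF EA that] fin[OF that] \<iota>hom[OF that] \<iota>inj
        b[OF that] \<iota>b[OF that]; assumption)+
  have \<psi>hom: "\<psi> H \<beta> \<in> module_hom k (obj ?P H) (obj Y H)" if "H \<in> U" for H \<beta>
    unfolding \<psi>_def tensor_free_psh_simps by (rule tensor_coord_hom[OF coords[OF that]])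
  have "\<forall>H\<in>U. \<exists>c :: (('a \<Rightarrow> 'a) set \<Rightarrow> 'v) \<Rightarrow> 'v. inj_on c (PiE (Hom H G) (\<lambda>_. UNIV))"
    by (intro ballI ex_inj_PiE[OF inf fin])
  then obtain c :: "'a monoid \<Rightarrow> (('a \<Rightarrow> 'a) set \<Rightarrow> 'v) \<Rightarrow> 'v" where
    c: "\<And>H. H \<in> U \<Longrightarrow> inj_on (c H) (PiE (Hom H G) (\<lambda>_. UNIV))" by metis
  \<comment> \<open>All coordinates of a tensor packed into one element of \<open>'v\<close>. Equal
    labels mean equal coordinates, hence congruence modulo the relations, so the quotient along
    \<open>r\<close> is a copy of the tensor product of \<open>Y\<close> and \<open>E\<close> in
    \<open>'v\<close>.\<close>
  define r where "r = (\<lambda>H f. c H (\<lambda>\<beta>\<in>Hom H G. \<psi> H \<beta> f))"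
  have r: "coset_map ?P ?K r"
    unfolding coset_map_def
  proof (intro ballI)
    fix H f g assume H: "H \<in> U" and f: "f \<in> carrier (obj ?P H)" and g: "g \<in> carrier (obj ?P H)"
    have "r H f = r H g \<longleftrightarrow> (\<lambda>\<beta>\<in>Hom H G. \<psi> H \<beta> f) = (\<lambda>\<beta>\<in>Hom H G. \<psi> H \<beta> g)"
      unfolding r_def by (rule inj_on_eq_iff[OF c[OF H]]) auto
    also have "\<dots> \<longleftrightarrow> (\<forall>\<beta>\<in>Hom H G. \<psi> H \<beta> f = \<psi> H \<beta> g)"
      unfolding fun_eq_iff restrict_def by (intro iffI ballI allI) (metis, simp)
    also have "\<dots> \<longleftrightarrow> f \<ominus>\<^bsub>obj ?P H\<^esub> g \<in> ?K H"
      unfolding \<psi>_def tensor_free_psh_simps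
      by (rule tensor_coord_eq_iff[OF coords[OF H]]) (use f g in \<open>simp_all add: tensor_free_psh_simps\<close>)
    finally show "r H f = r H g \<longleftrightarrow> f \<ominus>\<^bsub>obj ?P H\<^esub> g \<in> ?K H" .
  qed
  define Z where "Z = quot_psh ?P r"
  have ZA: "Z \<in> A_of k U" unfolding Z_def by (rule quot_psh_A_of[OF PA K r])
  have "psh_iso k U Z (tensor_psh k Y E)" unfolding Z_def by (rule quot_tensor_free_psh_iso[OF YA EA r])
  then have ZD: "Z \<in> D" using D Y Ec ZA unfolding serre_ideal_def by blast
  have rn: "r \<in> nat_trans k U ?P Z" unfolding Z_def by (rule quot_psh_nat_trans[OF PA K r])
  \<comment> \<open>The pure tensor of the pullback of \<open>y\<close> along \<beta> with the basis
    vector \<beta>. It is obtained from the tensor \<open>t0\<close> of \<open>y\<close> with the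
    identity by the action of \<beta>, and its only possibly nonzero coordinate is the one at
    \<beta>.\<close>
  define t where "t = (\<lambda>H \<beta>. free_basis k (act Y H G \<beta> y, b H \<beta>))"
  have t: "t H \<beta> \<in> carrier (obj ?P H)" if "H \<in> U" "\<beta> \<in> Hom H G" for H \<beta>
    unfolding t_def tensor_free_psh_simps
    by (rule free_basis_mem[OF cring_k]) (use A_of_act_mem[OF YA that(1) G that(2) y(1)] b[OF that] in simp)
  define t0 where "t0 = t G (id_cls G)"
  have t0: "t0 \<in> carrier (obj ?P G)" unfolding t0_def by (rule t[OF G id_cls_Hom])
  have act_t0: "act ?P H G \<beta> t0 = t H \<beta>" if H: "H \<in> U" and \<beta>: "\<beta> \<in> Hom H G" for H \<beta>
  proof -
    have "act E H G \<beta> (b G (id_cls G)) = re H (act ?e H G \<beta> (free_basis k (id_cls G)))"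
      unfolding b_def E_def by (rule quot_psh_act[OF eA e0 rem H G \<beta> basis[OF id_cls_Hom]])
    also have "act ?e H G \<beta> (free_basis k (id_cls G)) = free_basis k \<beta>"
      using free_map_basis[OF cring_k, of "\<lambda>\<beta>'. comp_cls H \<beta>' \<beta>" "id_cls G" "Hom H G"] comp_id_cls_U(2)[OF H G \<beta>] \<beta>
      by (simp add: e_psh_simps)
    finally have "act E H G \<beta> (b G (id_cls G)) = b H \<beta>" by (simp add: b_def)
    then show ?thesis
      using free_map_basis[OF cring_k, of "map_prod (act Y H G \<beta>) (act E H G \<beta>)" "(act Y G G (id_cls G) y, b G (id_cls G))"
          "carrier (obj Y H) \<times> carrier (obj E H)"] A_of_id[OF YA G y(1)] A_of_act_mem[OF YA H G \<beta> y(1)] b[OF H \<beta>]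
      by (simp add: t0_def t_def tensor_free_psh_simps)
  qed
  define z where "z = r G t0"
  have z: "z \<in> carrier (obj Z G)" unfolding z_def by (rule nat_trans_mem[OF rn G t0])
  have ker: "f = \<zero>\<^bsub>obj ?e H\<^esub>"
    if H: "H \<in> U" and o: "order H \<le> order G" and f: "f \<in> carrier (obj ?e H)"
      and f0: "yoneda Z G z H f = \<zero>\<^bsub>obj Z H\<^esub>" for H f
  proof -
    let ?F = "free_module k (Hom H G)"
    have f': "f \<in> carrier ?F" using f by (simp add: e_psh_simps)
    have tP: "t H \<in> Hom H G \<rightarrow> carrier (obj ?P H)" using t[OF H] by auto
    note l = lin_ext_hom[OF cring_k A_of_module[OF PA H] tP]
    let ?l = "lin_ext k (obj ?P H) (t H)"
    have "yoneda Z G z H f = r H (?l f)"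
    proof (rule free_module_hom_eqI[OF cring_k A_of_module[OF ZA H] yoneda_hom[OF ZA G z H] _ _ f'])
      show "(\<lambda>f. r H (?l f)) \<in> module_hom k ?F (obj Z H)"
        by (rule module_hom_compose[OF l nat_trans_hom[OF rn H]])
      show "yoneda Z G z H (free_basis k \<beta>) = r H (?l (free_basis k \<beta>))" if \<beta>: "\<beta> \<in> Hom H G" for \<beta>
        using yoneda_basis[OF ZA G z H \<beta>] nat_trans_act[OF rn H G \<beta> t0] act_t0[OF H \<beta>]
          lin_ext_basis[OF cring_k A_of_module[OF PA H] tP \<beta>] by (simp add: z_def)
    qed
    then have lK: "?l f \<in> ?K H"
      using f0 quot_psh_ker[OF PA K r H module_hom_mem[OF l f']] by (simp add: Z_def)
    have \<psi>0: "\<psi> H \<beta> (?l f) = \<zero>\<^bsub>obj Y H\<^esub>" for \<beta>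
      unfolding \<psi>_def by (rule tensor_coord_zero[OF coords[OF H] lK])
    have "f \<beta> = \<zero>\<^bsub>k\<^esub>" if \<beta>: "\<beta> \<in> Hom H G" for \<beta>
    proof -
      interpret YH: module k "obj Y H" by (rule A_of_module[OF YA H])
      have yb: "act Y H G \<beta> y \<in> carrier (obj Y H)" by (rule A_of_act_mem[OF YA H G \<beta> y(1)])
      \<comment> \<open>The coordinate at \<beta> isolates \<open>f \<beta>\<close>. Its factor, the
        pullback of \<open>y\<close> along an isomorphism, is nonzero, which forces
        \<open>f \<beta>\<close> to be zero.\<close>
      have "\<psi> H \<beta> (?l f) = f \<beta> \<odot>\<^bsub>obj Y H\<^esub> act Y H G \<beta> y"
      proof (rule free_module_hom_eqI[OF cring_k YH.module_axioms module_hom_compose[OF l \<psi>hom[OF H]] _ _ f'])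
        show "(\<lambda>f. f \<beta> \<odot>\<^bsub>obj Y H\<^esub> act Y H G \<beta> y) \<in> module_hom k ?F (obj Y H)"
          using yb free_module_value[OF cring_k, where S = "Hom H G"]
          by (intro module_homI) (auto simp: YH.smult_l_distr YH.smult_assoc1)
        fix \<gamma> assume \<gamma>: "\<gamma> \<in> Hom H G"
        have yg: "act Y H G \<gamma> y \<in> carrier (obj Y H)" by (rule A_of_act_mem[OF YA H G \<gamma> y(1)])
        have "\<psi> H \<beta> (?l (free_basis k \<gamma>)) = \<psi> H \<beta> (t H \<gamma>)"
          using lin_ext_basis[OF cring_k A_of_module[OF PA H] tP \<gamma>] by simp
        also have "\<dots> = \<iota> H (b H \<gamma>) \<beta> \<odot>\<^bsub>obj Y H\<^esub> act Y H G \<gamma> y"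
          unfolding \<psi>_def t_def by (rule tensor_coord_basis[OF coords[OF H] yg b[OF H \<gamma>]])
        also have "\<dots> = free_basis k \<gamma> \<beta> \<odot>\<^bsub>obj Y H\<^esub> act Y H G \<beta> y"
          unfolding \<iota>b[OF H \<gamma>] using yg yb by (cases "\<gamma> = \<beta>") (simp_all add: free_basis_def)
        finally show "\<psi> H \<beta> (?l (free_basis k \<gamma>)) = free_basis k \<gamma> \<beta> \<odot>\<^bsub>obj Y H\<^esub> act Y H G \<beta> y" .
      qed
      then have "f \<beta> \<odot>\<^bsub>obj Y H\<^esub> act Y H G \<beta> y = \<zero>\<^bsub>obj Y H\<^esub>" using \<psi>0 by simp
      moreover have "act Y H G \<beta> y \<noteq> \<zero>\<^bsub>obj Y H\<^esub>" using act_eq_zero[OF YA G H \<beta> o y(1)] y(2) by blast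
      ultimately show ?thesis
        using vectorspace_smult_eq_zero[OF field_k YH.module_axioms free_module_value[OF cring_k f'] yb] by blast
    qed
    then show ?thesis using free_moduleD(2)[OF f'] by (auto simp: e_psh_simps)
  qed
  show ?thesis
  proof (rule serre_subquotient[OF ss noeth ZD eA C yoneda_nat_trans[OF ZA G z] yoneda_epi[OF C gen]])
    fix H f assume H: "H \<in> U" and f: "f \<in> carrier (obj ?e H)" and f0: "yoneda Z G z H f = \<zero>\<^bsub>obj Z H\<^esub>"
    note \<theta> = yoneda_epi[OF C gen, unfolded psh_epi_def, simplified, THEN conjunct1]
    \<comment> \<open>Up to the order of \<open>G\<close> the map into \<open>Z\<close> is
      injective; beyond it \<open>C\<close> vanishes. So the kernels are included in both
      ranges.\<close>
    show "yoneda C G x H f = \<zero>\<^bsub>obj C H\<^esub>"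
    proof (cases "order H \<le> order G")
      case True
      then show ?thesis using ker[OF H True f f0] nat_trans_zero[OF eA C \<theta> H] by simp
    next
      case False
      then show ?thesis using nat_trans_mem[OF \<theta> H f] C0[OF H] by simp
    qed
  qed
qed

text \<open>The bound is strict and orders are positive, so \<open>j = 0\<close> leaves just the
  inclusion of the support of \<open>X\<close> in that of \<open>Y\<close>. Being a condition on the
  nonzero values, it passes to subobjects and quotients, as \<open>serre_filtration\<close>
  requires.\<close>

definition supported_above :: "('a, 'k, 'v) presheaf \<Rightarrow> nat \<Rightarrow> ('a, 'k, 'v) presheaf \<Rightarrow> bool" where
  "supported_above Y j X \<longleftrightarrow> (\<forall>H\<in>U. carrier (obj X H) \<noteq> {\<zero>\<^bsub>obj X H\<^esub>} \<longrightarrow>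
     j < order H \<and> carrier (obj Y H) \<noteq> {\<zero>\<^bsub>obj Y H\<^esub>})"

lemma supported_above_sub_psh:
  assumes X: "supported_above Y j X" and N: "is_subfunctor k U X N"
  shows "supported_above Y j (sub_psh X N)"
  unfolding supported_above_def
proof (intro ballI impI)
  fix H assume H: "H \<in> U" and "carrier (obj (sub_psh X N) H) \<noteq> {\<zero>\<^bsub>obj (sub_psh X N) H\<^esub>}"
  then have "carrier (obj X H) \<noteq> {\<zero>\<^bsub>obj X H\<^esub>}"
    using subfunctor_mem[OF N H] submodule.zero_closed[OF subfunctor_submodule[OF N H]] by auto
  then show "j < order H \<and> carrier (obj Y H) \<noteq> {\<zero>\<^bsub>obj Y H\<^esub>}"
    using X H by (auto simp: supported_above_def)
qed

lemma supported_above_quot_psh: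
  assumes X: "supported_above Y j X"
  shows "supported_above Y j (quot_psh X r)"
  unfolding supported_above_def
proof (intro ballI impI)
  fix H assume H: "H \<in> U" and "carrier (obj (quot_psh X r) H) \<noteq> {\<zero>\<^bsub>obj (quot_psh X r) H\<^esub>}"
  then have "carrier (obj X H) \<noteq> {\<zero>\<^bsub>obj X H\<^esub>}" by (auto simp: obj_quot_psh)
  then show "j < order H \<and> carrier (obj Y H) \<noteq> {\<zero>\<^bsub>obj Y H\<^esub>}"
    using X H by (auto simp: supported_above_def)
qed

text \<open>The measure is \<open>n - j\<close> with truncated subtraction. If the generator of a
  cyclic object lies over a group of order above \<open>n\<close>, no recursive call is made;
  otherwise the call is made with the order of that group in place of \<open>j\<close>.\<close>

lemma serre_ideal_supported:
  fixes D :: "('a, 'k, 'v) presheaf set"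
  assumes D: "serre_ideal k U D" and noeth: "noetherian k U" and k_inf: "infinite (carrier k)" and YD: "Y \<in> D"
    and large: "\<And>G E. G \<in> U \<Longrightarrow> n < order G \<Longrightarrow> carrier (obj Y G) \<noteq> {\<zero>\<^bsub>obj Y G\<^esub>} \<Longrightarrow> E \<in> A_of k U \<Longrightarrow>
        psh_iso k U E (e_psh k G) \<Longrightarrow> E \<in> D"
    and X: "X \<in> Ac_of k U" "supported_above Y j X"
  shows "X \<in> D"
  using X
proof (induction "n - j" arbitrary: j X rule: less_induct)
  case less
  have ss: "serre_subcat k U D" using D by (simp add: serre_ideal_def)
  then have YA: "Y \<in> A_of k U" using YD by (auto simp: serre_subcat_def Ac_of_def)
  show ?case
  proof (rule serre_filtration[where P = "supported_above Y j", OF ss noeth supported_above_sub_psh supported_above_quot_psh _ less.prems])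
    fix C :: "('a, 'k, 'v) presheaf" and G x
    assume Cc: "C \<in> Ac_of k U" and PC: "supported_above Y j C" and G: "G \<in> U" and x: "x \<in> carrier (obj C G)"
      and gen: "generates C {(G, x)} (\<lambda>G. carrier (obj C G))"
    have CA: "C \<in> A_of k U" using Cc by (simp add: Ac_of_def)
    show "C \<in> D"
    \<comment> \<open>A zero generator does not put \<open>G\<close> into the support of
      \<open>Y\<close>, so this case is settled beforehand.\<close>
    proof (cases "x = \<zero>\<^bsub>obj C G\<^esub>")
      case True
      have "carrier (obj C H) = {\<zero>\<^bsub>obj C H\<^esub>}" if H: "H \<in> U" for H
      proof (intro equalityI subsetI)
        show "v \<in> {\<zero>\<^bsub>obj C H\<^esub>}" if "v \<in> carrier (obj C H)" for v
          by (rule generatesD[OF gen subfunctor_zero[OF CA] _ H that]) (use True in simp)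
        show "v \<in> carrier (obj C H)" if "v \<in> {\<zero>\<^bsub>obj C H\<^esub>}" for v
          using that submodule.zero_closed[OF submodule_carrier[OF A_of_module[OF CA H]]] by simp
      qed
      then show ?thesis by (rule serre_zero[OF ss noeth Cc])
    next
      case False
      then have "carrier (obj C G) \<noteq> {\<zero>\<^bsub>obj C G\<^esub>}" using x by blast
      then have j: "j < order G" and YG: "carrier (obj Y G) \<noteq> {\<zero>\<^bsub>obj Y G\<^esub>}"
        using PC G unfolding supported_above_def by blast+
      interpret YG: module k "obj Y G" by (rule A_of_module[OF YA G])
      obtain y where y: "y \<in> carrier (obj Y G)" "y \<noteq> \<zero>\<^bsub>obj Y G\<^esub>" using YG YG.M.zero_closed by blast
      \<comment> \<open>The line through \<open>y\<close> is a copy of the field inside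
        \<open>'v\<close>. It makes \<open>'v\<close> infinite and leaves room for a copy of the
        representable.\<close>
      have inj: "inj_on (\<lambda>c. c \<odot>\<^bsub>obj Y G\<^esub> y) (carrier k)"
      proof (rule inj_onI)
        fix c d assume c: "c \<in> carrier k" and d: "d \<in> carrier k" and eq: "c \<odot>\<^bsub>obj Y G\<^esub> y = d \<odot>\<^bsub>obj Y G\<^esub> y"
        have "(c \<ominus>\<^bsub>k\<^esub> d) \<odot>\<^bsub>obj Y G\<^esub> y = \<zero>\<^bsub>obj Y G\<^esub>"
          using c d y(1) eq by (simp add: a_minus_def YG.smult_l_distr YG.smult_l_minus YG.M.r_neg)
        then have "c \<ominus>\<^bsub>k\<^esub> d = \<zero>\<^bsub>k\<^esub>"
          using vectorspace_smult_eq_zero[OF field_k YG.module_axioms _ y(1) _ y(2)] c d by blast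
        then show "c = d" using c d by simp
      qed
      then have inf: "infinite (UNIV :: 'v set)"
        using k_inf by (meson finite_imageD infinite_super subset_UNIV)
      obtain re :: "'a monoid \<Rightarrow> (('a \<Rightarrow> 'a) set \<Rightarrow> 'k) \<Rightarrow> 'v" where
        re: "\<And>H. H \<in> U \<Longrightarrow> inj_on (re H) (carrier (obj (e_psh k G) H))"
        using ex_e_psh_copy[OF inf inj G] by blast
      show ?thesis
      proof (cases "n < order G")
        case True
        note eA = e_psh_A_of[OF G]
        note rem = inj_coset_map[OF eA re] and e0 = subfunctor_zero[OF eA]
        let ?E = "quot_psh (e_psh k G) re"
        have EA: "?E \<in> A_of k U" by (rule quot_psh_A_of[OF eA e0 rem])
        have bij: "bij_betw (inv_into (carrier (obj (e_psh k G) H)) (re H)) (carrier (obj ?E H)) (carrier (obj (e_psh k G) H))"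
          if "H \<in> U" for H
          using bij_betw_inv_into[OF bij_betw_imageI[OF re[OF that] refl]] by simp
        have iso: "psh_iso k U ?E (e_psh k G)"
          unfolding psh_iso_def by (intro bexI[OF _ quot_psh_inv_nat_trans[OF eA re]] ballI bij)
        have ED: "?E \<in> D" by (rule large[OF G True YG EA iso])
        have ker: "yoneda C G x H f = \<zero>\<^bsub>obj C H\<^esub>"
          if H: "H \<in> U" and f: "f \<in> carrier (obj (e_psh k G) H)" and "re H f = \<zero>\<^bsub>obj ?E H\<^esub>" for H f
          using that(3) quot_psh_ker[OF eA e0 rem H f] nat_trans_zero[OF eA CA yoneda_nat_trans[OF CA G x] H] by simp
        show ?thesis
          by (rule serre_subquotient[OF ss noeth ED eA CA quot_psh_nat_trans[OF eA e0 rem] yoneda_epi[OF CA gen] ker])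
      next
        case False
        \<comment> \<open>A surjection goes from a group to one of at most the same order, and the
          action runs the opposite way; hence the part on groups larger than \<open>G\<close> is
          stable.\<close>
        define N where "N = (\<lambda>H. if order G < order H then carrier (obj C H) else {\<zero>\<^bsub>obj C H\<^esub>})"
        have N: "is_subfunctor k U C N"
        proof (rule subfunctorI)
          show "submodule k (N H) (obj C H)" if "H \<in> U" for H
            using submodule_carrier[OF A_of_module[OF CA that]] submodule_zero[OF A_of_module[OF CA that]]
            by (simp add: N_def)
          fix H L \<alpha> v assume HL: "H \<in> U" "L \<in> U" "\<alpha> \<in> Hom H L" and v: "v \<in> N L"
          have o: "order L \<le> order H" by (rule Hom_order_le[OF finite_U[OF HL(1)] HL(3)])
          show "act C H L \<alpha> v \<in> N H"
          proof (cases "order G < order L")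
            case True
            then show ?thesis using o v A_of_act_mem[OF CA HL] by (simp add: N_def)
          next
            case False
            then have "v = \<zero>\<^bsub>obj C L\<^esub>" using v by (simp add: N_def)
            then have "act C H L \<alpha> v = \<zero>\<^bsub>obj C H\<^esub>"
              using module_hom_zero[OF A_of_module[OF CA HL(2)] A_of_module[OF CA HL(1)] A_of_act_hom[OF CA HL]] by simp
            then show ?thesis
              using submodule.zero_closed[OF submodule_carrier[OF A_of_module[OF CA HL(1)]]] by (simp add: N_def)
          qed
        qed
        obtain r :: "'a monoid \<Rightarrow> 'v \<Rightarrow> 'v" where r: "coset_map C N r" using ex_coset_map[OF N] by blast
  let ?Q = "quot_psh C r"
        have "supported_above Y (order G) (sub_psh C N)"
          using PC by (auto simp: supported_above_def N_def)
        \<comment> \<open>The order of \<open>G\<close> is greater than \<open>j\<close> and at most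
          \<open>n\<close>, so the measure drops strictly.\<close>
        then have 1: "sub_psh C N \<in> D"
          using less.hyps[OF _ sub_psh_Ac[OF noeth Cc N]] j False by (meson diff_less_mono2 le_less_trans linorder_not_less)
        have QA: "?Q \<in> A_of k U" by (rule quot_psh_A_of[OF CA N r])
        have gQ: "generates ?Q {(G, r G x)} (\<lambda>G. carrier (obj ?Q G))"
          using generates_epi[OF CA gen quot_psh_epi[OF CA N r]] by simp
        have "?Q \<in> D"
        proof (rule serre_ideal_bottom[OF D noeth YD inf G y re QA gQ])
          fix H assume H: "H \<in> U" "order G < order H"
          have "z = \<zero>\<^bsub>obj ?Q H\<^esub>" if "z \<in> carrier (obj ?Q H)" for z
            using that quot_psh_ker[OF CA N r H(1)] H(2) by (auto simp: N_def)
          then show "carrier (obj ?Q H) = {\<zero>\<^bsub>obj ?Q H\<^esub>}"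
            using submodule.zero_closed[OF submodule_carrier[OF A_of_module[OF QA H(1)]]] by blast
        qed
        then show ?thesis using serre_sub_quot[OF ss noeth Cc N r] 1 by blast
      qed
    qed
  qed
qed

end

theorem theorem1p1:
  fixes k :: "'k ring" and U :: "'a monoid set" and X Y :: "('a, 'k, 'v) presheaf"
  assumes "field k" and "\<forall>n::nat. n > 0 \<longrightarrow> [n] \<cdot>\<^bsub>k\<^esub> \<one>\<^bsub>k\<^esub> \<noteq> \<zero>\<^bsub>k\<^esub>"
    and "replete_full_subcat U" and "widely_closed U"
    and "fin_gen k U (unit_psh k)" and "noetherian k U"
    and "X \<in> Ac_of k U" and "Y \<in> Ac_of k U"
    and "supp U X \<subseteq> supp U Y"
  shows "X \<in> serre_plus k U Y"
proof -
  interpret presheaves k U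
    using assms(1,3) by (simp add: presheaves_def replete_full_subcat_def)
  note noeth = assms(6)
  have XA: "X \<in> A_of k U" and YA: "Y \<in> A_of k U" using assms(7,8) by (auto simp: Ac_of_def)
  have k_inf: "infinite (carrier k)"
    by (rule ring.infinite_carrier_char_0[OF cring.axioms(1)[OF cring_k] assms(2)])
  \<comment> \<open>\<open>serre_gen\<close> is an intersection over Serre ideals, so one ideal
    containing the generators is fixed, for arbitrary \<open>n\<close>.\<close>
  have "X \<in> D"
    if D: "serre_ideal k U D" and S: "{Y} \<union> {E \<in> A_of k U. \<exists>G\<in>U. iso_class U G \<in> up_gt U (supp U Y) n \<and>
        psh_iso k U E (e_psh k G)} \<subseteq> D" for D :: "('a, 'k, 'v) presheaf set" and n
  proof -
    have YD: "Y \<in> D" using S by blast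
    have "E \<in> D" if G: "G \<in> U" and o: "n < order G" and YG: "carrier (obj Y G) \<noteq> {\<zero>\<^bsub>obj Y G\<^esub>}"
      and E: "E \<in> A_of k U" "psh_iso k U E (e_psh k G)" for G E
    proof -
      have "\<And>H. H \<in> iso_class U G \<Longrightarrow> order H = order G"
        using is_iso_order by (fastforce simp: iso_class_def)
      \<comment> \<open>\<open>id_cls_Hom\<close> makes \<open>epi G G\<close> nonempty, which
        places a class of the support in its own upward closure.\<close>
      then have "iso_class U G \<in> up_gt U (supp U Y) n"
        using G o supp_iff[OF YA G] YG id_cls_Hom[of G]
        by (auto simp: up_gt_def up_def pi0_def Hom_def)
      then show ?thesis using S E G by blast
    qed
    moreover have "supported_above Y 0 X"
      unfolding supported_above_def
    proof (intro ballI impI conjI)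
      fix H assume H: "H \<in> U" and "carrier (obj X H) \<noteq> {\<zero>\<^bsub>obj X H\<^esub>}"
      then show "carrier (obj Y H) \<noteq> {\<zero>\<^bsub>obj Y H\<^esub>}"
        using supp_iff[OF XA H] supp_iff[OF YA H] assms(9) by blast
      show "0 < order H"
        using monoid.order_gt_0_iff_finite[OF group.is_monoid[OF group_U[OF H]]] finite_U[OF H] by simp
    qed
    ultimately show ?thesis using serre_ideal_supported[OF D noeth k_inf YD _ assms(7)] by blast
  qed
  then show ?thesis using assms(7) unfolding serre_plus_def serre_plus_n_def serre_gen_def by blast
qed

end
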